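(* (1) Let $n\geq 1$. If a nontrivial automorphism of a thick generalised $(2n+1)$-gon is domestic, then it is an exceptional domestic duality. (2) If $\Gamma$ is a thick projective plane (potentially infinite) not isomorphic to the Fano plane, then $\Gamma$ admits no nontrivial domestic automorphisms. (3) The Fano plane admits a unique nontrivial domestic automorphism up to conjugation (in its full automorphism group, including dualities). This automorphism is an exceptional domestic duality of order $8$. In $\mathbb{ATLAS}$ notation the conjugacy class of this domestic duality is class $8A$ of the group $L_3(2):2$.
   Context: A generalised $n$-gon ($n\geq 2$) is a nonempty point-line geometry $\Gamma=(\mathcal{P},\mathcal{L},\mathbf{I})$ containing no ordinary $k$-gon (as a subgeometry) for $2\leq k<n$ and such that any two elements of $\mathcal{P}\cup\mathcal{L}$ are contained in some ordinary $n$-gon in $\Gamma$. It is thick if each point is on at least $3$ lines and each line contains at least $3$ points. Generalised $3$-gons are projective planes; the Fano plane is the projective plane with $3$ points per line and $3$ lines per point. Let $d(x,y)$ be the distance between $x,y\in\mathcal{P}\cup\mathcal{L}$ in the incidence graph (vertex set $\mathcal{P}\cup\mathcal{L}$, edges the incident pairs). An automorphism is a bijection $\theta:\mathcal{P}\cup\mathcal{L}\to\mathcal{P}\cup\mathcal{L}$ preserving incidence and non-incidence, which either maps points to points and lines to lines (a collineation), or interchanges the point set and the line set (a duality). Elements $x,y$ are opposite if $d(x,y)=n$. A chamber is a pair $\{p,L\}$ with $p\in\mathcal{P}$, $L\in\mathcal{L}$, $p\,\mathbf{I}\,L$. The chambers $\{p,L\}$ and $\{p',L'\}$ are opposite if either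 $p'$ is opposite $p$ and $L'$ is opposite $L$ ($n$ even), or $p'$ is opposite $L$ and $L'$ is opposite $p$ ($n$ odd). An automorphism is domestic if it maps no chamber to an opposite chamber. A domestic automorphism is exceptional domestic if it maps at least one point to an opposite element and at least one line to an opposite element. $\mathbb{ATLAS}$ convention: the full automorphism group of the Fano plane is $L_3(2):2$, and it has two conjugacy classes of elements of order $8$ (both consisting of dualities), denoted $8A$ and $B*$, distinguished by the value of the degree $6$ character $\chi_4$, which is $\sqrt2$ on $8A$. Here $\chi_4$ is the character of the following representation: let $W$ be the $6$-dimensional real Euclidean space spanned by unit vectors $e_p$ ($p\in\mathcal{P}$) with $\sum_p e_p=0$ and $\langle e_p,e_q\rangle=-1/6$ for $p\neq q$, and for each line $L'$ let $e_{L'}=\frac{1}{7\sqrt2}\left(4\sum_{p\mathbf{I}L'}e_p-3\sum_{p\not\mathbf{I}L'}e_p\right)$; an automorphism $\theta$ acts linearly on $W$ by $e_x\mapsto e_{x^\theta}$ for $x\in\mathcal{P}\cup\mathcal{L}$. *)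

theory Defs
  imports "HOL-Analysis.Analysis" "HOL-Library.Numeral_Type"
    "HOL-Algebra.Bij" "HOL-Algebra.Multiplicative_Group"
begin

section \<open>Point-line geometries and generalised polygons\<close>

record ('p, 'l) geometry =
  Points :: "'p set"
  Lines :: "'l set"
  Inc :: "('p \<times> 'l) set"

definition point_line_geometry :: "('p, 'l) geometry \<Rightarrow> bool" where
  "point_line_geometry \<Gamma> \<longleftrightarrow> Inc \<Gamma> \<subseteq> Points \<Gamma> \<times> Lines \<Gamma>"

text \<open>The disjoint union of the point set and the line set.\<close>

definition elements :: "('p, 'l) geometry \<Rightarrow> ('p + 'l) set" where
  "elements \<Gamma> = Inl ` Points \<Gamma> \<union> Inr ` Lines \<Gamma>"

text \<open>Edges of the incidence graph (a symmetric relation).\<close>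

definition incidence_graph :: "('p, 'l) geometry \<Rightarrow> (('p + 'l) \<times> ('p + 'l)) set" where
  "incidence_graph \<Gamma> =
     {(Inl p, Inr l) | p l. (p, l) \<in> Inc \<Gamma>} \<union> {(Inr l, Inl p) | p l. (p, l) \<in> Inc \<Gamma>}"

text \<open>Length of a shortest path. It is only used in generalised polygons; their incidence graphs
  are connected, since any two elements lie in a common ordinary polygon.\<close>

definition elem_dist :: "('p, 'l) geometry \<Rightarrow> 'p + 'l \<Rightarrow> 'p + 'l \<Rightarrow> nat" where
  "elem_dist \<Gamma> x y = (LEAST k. (x, y) \<in> incidence_graph \<Gamma> ^^ k)"

definition subgeometry :: "('p, 'l) geometry \<Rightarrow> ('p, 'l) geometry \<Rightarrow> bool" where
  "subgeometry \<Delta> \<Gamma> \<longleftrightarrow> Points \<Delta> \<subseteq> Points \<Gamma> \<and> Lines \<Delta> \<subseteq> Lines \<Gamma> \<and>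
     Inc \<Delta> = Inc \<Gamma> \<inter> (Points \<Delta> \<times> Lines \<Delta>)"

text \<open>The line \<open>l i\<close> joins the cyclically consecutive points \<open>p i\<close> and \<open>p (i + 1)\<close>.\<close>

definition ordinary_polygon :: "nat \<Rightarrow> ('p, 'l) geometry \<Rightarrow> bool" where
  "ordinary_polygon k \<Delta> \<longleftrightarrow>
     (\<exists>p l. bij_betw p {..<k} (Points \<Delta>) \<and> bij_betw l {..<k} (Lines \<Delta>) \<and>
        Inc \<Delta> = {(p i, l i) | i. i < k} \<union> {(p (Suc i mod k), l i) | i. i < k})"

definition generalised_polygon :: "nat \<Rightarrow> ('p, 'l) geometry \<Rightarrow> bool" where
  "generalised_polygon n \<Gamma> \<longleftrightarrow>
     n \<ge> 2 \<and> point_line_geometry \<Gamma> \<and> elements \<Gamma> \<noteq> {} \<and>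
     (\<forall>k. 2 \<le> k \<and> k < n \<longrightarrow> \<not> (\<exists>\<Delta>. subgeometry \<Delta> \<Gamma> \<and> ordinary_polygon k \<Delta>)) \<and>
     (\<forall>x \<in> elements \<Gamma>. \<forall>y \<in> elements \<Gamma>.
        \<exists>\<Delta>. subgeometry \<Delta> \<Gamma> \<and> ordinary_polygon n \<Delta> \<and> x \<in> elements \<Delta> \<and> y \<in> elements \<Delta>)"

definition lines_on :: "('p, 'l) geometry \<Rightarrow> 'p \<Rightarrow> 'l set" where
  "lines_on \<Gamma> p = {l. (p, l) \<in> Inc \<Gamma>}"

definition points_on :: "('p, 'l) geometry \<Rightarrow> 'l \<Rightarrow> 'p set" where
  "points_on \<Gamma> l = {p. (p, l) \<in> Inc \<Gamma>}"

text \<open>``At least three'' is expressed by a three-element subset, since \<open>card\<close> is \<open>0\<close> on infinite sets.\<close>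

definition thick :: "('p, 'l) geometry \<Rightarrow> bool" where
  "thick \<Gamma> \<longleftrightarrow>
     (\<forall>p \<in> Points \<Gamma>. \<exists>A \<subseteq> lines_on \<Gamma> p. card A = 3) \<and>
     (\<forall>l \<in> Lines \<Gamma>. \<exists>A \<subseteq> points_on \<Gamma> l. card A = 3)"

abbreviation projective_plane :: "('p, 'l) geometry \<Rightarrow> bool" where
  "projective_plane \<equiv> generalised_polygon 3"

definition fano_plane :: "('p, 'l) geometry \<Rightarrow> bool" where
  "fano_plane \<Gamma> \<longleftrightarrow> projective_plane \<Gamma> \<and>
     (\<forall>l \<in> Lines \<Gamma>. card (points_on \<Gamma> l) = 3) \<and>
     (\<forall>p \<in> Points \<Gamma>. card (lines_on \<Gamma> p) = 3)"

definition isomorphic_geometries :: "('p, 'l) geometry \<Rightarrow> ('r, 's) geometry \<Rightarrow> bool" where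
  "isomorphic_geometries \<Gamma> \<Gamma>' \<longleftrightarrow>
     (\<exists>f g. bij_betw f (Points \<Gamma>) (Points \<Gamma>') \<and> bij_betw g (Lines \<Gamma>) (Lines \<Gamma>') \<and>
        (\<forall>p \<in> Points \<Gamma>. \<forall>l \<in> Lines \<Gamma>. (p, l) \<in> Inc \<Gamma> \<longleftrightarrow> (f p, g l) \<in> Inc \<Gamma>'))"

section \<open>Automorphisms\<close>

definition preserves_types :: "('p, 'l) geometry \<Rightarrow> ('p + 'l \<Rightarrow> 'p + 'l) \<Rightarrow> bool" where
  "preserves_types \<Gamma> \<theta> \<longleftrightarrow>
     \<theta> ` Inl ` Points \<Gamma> = Inl ` Points \<Gamma> \<and> \<theta> ` Inr ` Lines \<Gamma> = Inr ` Lines \<Gamma>"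

definition interchanges_types :: "('p, 'l) geometry \<Rightarrow> ('p + 'l \<Rightarrow> 'p + 'l) \<Rightarrow> bool" where
  "interchanges_types \<Gamma> \<theta> \<longleftrightarrow>
     \<theta> ` Inl ` Points \<Gamma> = Inr ` Lines \<Gamma> \<and> \<theta> ` Inr ` Lines \<Gamma> = Inl ` Points \<Gamma>"

definition automorphism :: "('p, 'l) geometry \<Rightarrow> ('p + 'l \<Rightarrow> 'p + 'l) \<Rightarrow> bool" where
  "automorphism \<Gamma> \<theta> \<longleftrightarrow>
     bij_betw \<theta> (elements \<Gamma>) (elements \<Gamma>) \<and>
     (\<forall>x \<in> elements \<Gamma>. \<forall>y \<in> elements \<Gamma>.
        (x, y) \<in> incidence_graph \<Gamma> \<longleftrightarrow> (\<theta> x, \<theta> y) \<in> incidence_graph \<Gamma>) \<and>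
     (preserves_types \<Gamma> \<theta> \<or> interchanges_types \<Gamma> \<theta>)"

definition duality :: "('p, 'l) geometry \<Rightarrow> ('p + 'l \<Rightarrow> 'p + 'l) \<Rightarrow> bool" where
  "duality \<Gamma> \<theta> \<longleftrightarrow> automorphism \<Gamma> \<theta> \<and> interchanges_types \<Gamma> \<theta>"

definition nontrivial :: "('p, 'l) geometry \<Rightarrow> ('p + 'l \<Rightarrow> 'p + 'l) \<Rightarrow> bool" where
  "nontrivial \<Gamma> \<theta> \<longleftrightarrow> (\<exists>x \<in> elements \<Gamma>. \<theta> x \<noteq> x)"

text \<open>The full automorphism group (collineations and dualities). As in \<^const>\<open>BijGroup\<close>, its members
  are extensional, so that two automorphisms agreeing on all elements of the geometry are equal.\<close>

definition aut_group :: "('p, 'l) geometry \<Rightarrow> ('p + 'l \<Rightarrow> 'p + 'l) monoid" where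
  "aut_group \<Gamma> = (BijGroup (elements \<Gamma>))
     \<lparr>carrier := {\<theta> \<in> Bij (elements \<Gamma>). automorphism \<Gamma> \<theta>}\<rparr>"

lemma group_aut_group: "group (aut_group \<Gamma>)"
proof -
  let ?S = "elements \<Gamma>" and ?A = "{\<theta> \<in> Bij (elements \<Gamma>). automorphism \<Gamma> \<theta>}"
  interpret B: group "BijGroup ?S" by (rule group_BijGroup)
  have "subgroup ?A (BijGroup ?S)"
  proof (rule B.subgroupI)
    show "?A \<subseteq> carrier (BijGroup ?S)" by (auto simp: BijGroup_def)
    have "automorphism \<Gamma> (\<lambda>x\<in>?S. x)"
      unfolding automorphism_def preserves_types_def
      by (auto simp: elements_def bij_betw_def inj_on_def image_iff)
    then show "?A \<noteq> {}" using id_Bij by blast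
  next
    fix a assume a: "a \<in> ?A"
    let ?b = "restrict (inv_into ?S a) ?S"
    have b: "inv\<^bsub>BijGroup ?S\<^esub> a = ?b" using a by (simp add: inv_BijGroup)
    have bb: "bij_betw a ?S ?S" using a by (simp add: Bij_def)
    have r: "a (?b x) = x" "?b x \<in> ?S" if "x \<in> ?S" for x
      using that bb by (auto simp: bij_betw_def f_inv_into_f inv_into_into)
    have l: "?b (a x) = x" "a x \<in> ?S" if "x \<in> ?S" for x
      using that bb by (auto simp: bij_betw_def)
    have img: "?b ` a ` X = X" if "X \<subseteq> ?S" for X
      proof -
      have "?b ` a ` X = (\<lambda>x. ?b (a x)) ` X" by (rule image_image)
      also have "\<dots> = (\<lambda>x. x) ` X" using that by (intro image_cong refl l(1)) blast
      finally show ?thesis by simp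
    qed
    have PL: "Inl ` Points \<Gamma> \<subseteq> ?S" "Inr ` Lines \<Gamma> \<subseteq> ?S" by (auto simp: elements_def)
    have "preserves_types \<Gamma> ?b \<or> interchanges_types \<Gamma> ?b"
      using a img[OF PL(1)] img[OF PL(2)]
      unfolding mem_Collect_eq automorphism_def preserves_types_def interchanges_types_def by metis
    moreover have "bij_betw ?b ?S ?S" using restrict_inv_into_Bij[of a ?S] a by (simp add: Bij_def)
    moreover have "(x, y) \<in> incidence_graph \<Gamma> \<longleftrightarrow> (?b x, ?b y) \<in> incidence_graph \<Gamma>"
      if "x \<in> ?S" "y \<in> ?S" for x y
    proof -
      have "(?b x, ?b y) \<in> incidence_graph \<Gamma> \<longleftrightarrow> (a (?b x), a (?b y)) \<in> incidence_graph \<Gamma>"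
        using a r that unfolding automorphism_def by blast
      then show ?thesis using r that by simp
    qed
    ultimately have "automorphism \<Gamma> ?b" unfolding automorphism_def by blast
    then show "inv\<^bsub>BijGroup ?S\<^esub> a \<in> ?A" using a b restrict_inv_into_Bij[of a ?S] by simp
  next
    fix a b assume ab: "a \<in> ?A" "b \<in> ?A"
    have m: "a \<otimes>\<^bsub>BijGroup ?S\<^esub> b = compose ?S a b" using ab by (simp add: BijGroup_def)
    have bS: "b x \<in> ?S" if "x \<in> ?S" for x using that ab by (auto simp: Bij_def bij_betw_def)
    have img: "compose ?S a b ` X = a ` b ` X" if "X \<subseteq> ?S" for X
      proof -
      have "a ` b ` X = (\<lambda>x. a (b x)) ` X" by (rule image_image)
      also have "\<dots> = compose ?S a b ` X" using that by (intro image_cong) (auto simp: compose_def)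
      finally show ?thesis by simp
    qed
    have PL: "Inl ` Points \<Gamma> \<subseteq> ?S" "Inr ` Lines \<Gamma> \<subseteq> ?S" by (auto simp: elements_def)
    have "preserves_types \<Gamma> (compose ?S a b) \<or> interchanges_types \<Gamma> (compose ?S a b)"
      using ab img[OF PL(1)] img[OF PL(2)]
      unfolding mem_Collect_eq automorphism_def preserves_types_def interchanges_types_def by metis
    moreover have "compose ?S a b \<in> Bij ?S" using ab by (simp add: compose_Bij)
    moreover have "(x, y) \<in> incidence_graph \<Gamma> \<longleftrightarrow>
        (compose ?S a b x, compose ?S a b y) \<in> incidence_graph \<Gamma>"
      if "x \<in> ?S" "y \<in> ?S" for x y
      using ab that bS by (simp add: compose_def automorphism_def)
    ultimately show "a \<otimes>\<^bsub>BijGroup ?S\<^esub> b \<in> ?A"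
      using m by (simp add: automorphism_def Bij_def)
  qed
  then show ?thesis unfolding aut_group_def by (rule B.subgroup_imp_group)
qed

definition conj_class :: "('a, 'b) monoid_scheme \<Rightarrow> 'a \<Rightarrow> 'a set" where
  "conj_class G a = {inv\<^bsub>G\<^esub> g \<otimes>\<^bsub>G\<^esub> a \<otimes>\<^bsub>G\<^esub> g | g. g \<in> carrier G}"

section \<open>Opposition and domesticity\<close>

definition opposite :: "nat \<Rightarrow> ('p, 'l) geometry \<Rightarrow> 'p + 'l \<Rightarrow> 'p + 'l \<Rightarrow> bool" where
  "opposite n \<Gamma> x y \<longleftrightarrow> elem_dist \<Gamma> x y = n"

definition chambers :: "('p, 'l) geometry \<Rightarrow> ('p + 'l) set set" where
  "chambers \<Gamma> = {{Inl p, Inr l} | p l. p \<in> Points \<Gamma> \<and> l \<in> Lines \<Gamma> \<and> (p, l) \<in> Inc \<Gamma>}"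

definition opposite_chambers ::
    "nat \<Rightarrow> ('p, 'l) geometry \<Rightarrow> ('p + 'l) set \<Rightarrow> ('p + 'l) set \<Rightarrow> bool" where
  "opposite_chambers n \<Gamma> C C' \<longleftrightarrow>
     (\<exists>p l p' l'. C = {Inl p, Inr l} \<and> C' = {Inl p', Inr l'} \<and>
        (if even n
         then opposite n \<Gamma> (Inl p') (Inl p) \<and> opposite n \<Gamma> (Inr l') (Inr l)
         else opposite n \<Gamma> (Inl p') (Inr l) \<and> opposite n \<Gamma> (Inr l') (Inl p)))"

definition domestic :: "nat \<Rightarrow> ('p, 'l) geometry \<Rightarrow> ('p + 'l \<Rightarrow> 'p + 'l) \<Rightarrow> bool" where
  "domestic n \<Gamma> \<theta> \<longleftrightarrow> (\<forall>C \<in> chambers \<Gamma>. \<not> opposite_chambers n \<Gamma> C (\<theta> ` C))"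

definition exceptional_domestic ::
    "nat \<Rightarrow> ('p, 'l) geometry \<Rightarrow> ('p + 'l \<Rightarrow> 'p + 'l) \<Rightarrow> bool" where
  "exceptional_domestic n \<Gamma> \<theta> \<longleftrightarrow> domestic n \<Gamma> \<theta> \<and>
     (\<exists>p \<in> Points \<Gamma>. opposite n \<Gamma> (Inl p) (\<theta> (Inl p))) \<and>
     (\<exists>l \<in> Lines \<Gamma>. opposite n \<Gamma> (Inr l) (\<theta> (Inr l)))"

section \<open>The character of degree 6 and the class 8A\<close>

definition fano_frame :: "('p, 'l) geometry \<Rightarrow> ('p \<Rightarrow> real ^ 6) \<Rightarrow> bool" where
  "fano_frame F e \<longleftrightarrow>
     span (e ` Points F) = UNIV \<and>
     (\<forall>p \<in> Points F. norm (e p) = 1) \<and>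
     (\<Sum>p \<in> Points F. e p) = 0 \<and>
     (\<forall>p \<in> Points F. \<forall>q \<in> Points F. p \<noteq> q \<longrightarrow> e p \<bullet> e q = - 1 / 6)"

text \<open>The prescribed inner products are realised by the vertices of a regular simplex.\<close>

lemma fano_frame_exists:
  assumes "card (Points F) = 7"
  shows "\<exists>e. fano_frame F e"
proof -
  let ?P = "Points F"
  have fin: "finite ?P" using assms card.infinite by fastforce
  obtain p0 where p0: "p0 \<in> ?P" using assms by fastforce
  let ?Q = "?P - {p0}"
  have "card ?Q = card (UNIV :: 6 set)" using assms p0 fin by simp
  then obtain h :: "_ \<Rightarrow> 6" where h: "bij_betw h ?Q UNIV"
    using fin by (metis finite_Diff finite_same_card_bij finite)
  define u :: "real ^ 6" where "u = (\<Sum>i\<in>UNIV. axis i 1)"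
  define s where "s = sqrt (1/6 :: real)"
  define t where "t = sqrt (7/6 :: real)"
  define b where "b = (s - t) / 6"
  define e where "e p = (if p = p0 then - s *\<^sub>R u else t *\<^sub>R axis (h p) 1 + b *\<^sub>R u)" for p
  have s2: "s * s = 1/6" and t2: "t * t = 7/6" by (auto simp: s_def t_def)
  have s0: "s > 0" and t0: "t > 0" by (auto simp: s_def t_def)
  have aa: "axis i (1::real) \<bullet> axis j 1 = (if i = j then 1 else 0)" for i j :: 6
    by (simp add: inner_axis_axis)
  have au: "axis i 1 \<bullet> u = 1" for i :: 6
    by (simp add: u_def inner_sum_right aa)
  have ua: "u \<bullet> axis i 1 = 1" for i :: 6 using au by (simp add: inner_commute)
  have uu: "u \<bullet> u = 6"
    by (simp add: u_def[THEN arg_cong[where f="\<lambda>v. v \<bullet> u"]] inner_sum_left au)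
  have tb: "t * b + t * b + b * b * 6 = - 1/6"
  proof -
    have "t * b + t * b + b * b * 6 = (s * s - t * t) / 6"
      by (simp add: b_def field_simps)
    then show ?thesis by (simp add: s2 t2)
  qed
  have n0: "e p0 \<bullet> e p0 = 1" using s2 by (simp add: e_def uu)
  have n1: "e p \<bullet> e p = 1" if "p \<noteq> p0" for p
    using that tb t2 by (simp add: e_def uu au ua aa inner_left_distrib inner_right_distrib algebra_simps)
  have i0: "e p \<bullet> e p0 = - 1/6" if "p \<noteq> p0" for p
    using that s2 by (simp add: e_def uu au ua aa inner_left_distrib inner_right_distrib b_def algebra_simps)
  have i1: "e p \<bullet> e q = - 1/6" if "p \<in> ?Q" "q \<in> ?Q" "p \<noteq> q" for p q
  proof -
    have "h p \<noteq> h q" using h that by (auto simp: bij_betw_def inj_on_def)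
    then show ?thesis using that tb
      by (simp add: e_def uu au ua aa inner_left_distrib inner_right_distrib algebra_simps)
  qed
  have "(\<Sum>p\<in>?Q. e p) = (\<Sum>p\<in>?Q. t *\<^sub>R axis (h p) 1 + b *\<^sub>R u)"
    by (rule sum.cong) (auto simp: e_def)
  also have "\<dots> = (\<Sum>i\<in>UNIV. t *\<^sub>R axis i 1 + b *\<^sub>R u)"
    by (rule sum.reindex_bij_betw[OF h])
  also have "\<dots> = t *\<^sub>R u + (6 * b) *\<^sub>R u"
  proof -
    have "(\<Sum>i\<in>(UNIV :: 6 set). b *\<^sub>R u) = (6 * b) *\<^sub>R u"
      by (simp only: sum_constant_scaleR) simp
    moreover have "(\<Sum>i\<in>UNIV. t *\<^sub>R axis i (1::real) :: real ^ 6) = t *\<^sub>R u"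
      by (simp add: u_def scaleR_right.sum)
    ultimately show ?thesis by (simp only: sum.distrib)
  qed
  also have "\<dots> = s *\<^sub>R u" by (simp add: b_def scaleR_left_distrib[symmetric] diff_divide_distrib)
  finally have sum0: "(\<Sum>p\<in>?P. e p) = 0"
    using p0 fin by (simp add: sum.remove[of ?P p0] e_def)
  have "u = (- 1 / s) *\<^sub>R e p0" using s0 by (simp add: e_def)
  then have us: "u \<in> span (e ` ?P)" by (metis p0 imageI span_base span_scale)
  have ax: "axis i 1 \<in> span (e ` ?P)" for i :: 6
  proof -
    obtain p where p: "p \<in> ?Q" "h p = i" using h by (metis UNIV_I bij_betw_iff_bijections)
    have "axis i 1 = (1 / t) *\<^sub>R (e p - b *\<^sub>R u)" using p t0 by (simp add: e_def)
    then show ?thesis using p us by (metis DiffD1 imageI span_base span_diff span_scale)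
  qed
  have "(Basis :: (real ^ 6) set) \<subseteq> span (e ` ?P)" using ax by (auto simp: Basis_vec_def)
  then have "span (e ` ?P) = UNIV"
    by (metis span_Basis span_span span_mono top.extremum_uniqueI)
  moreover have "\<forall>p\<in>?P. norm (e p) = 1" using n0 n1 by (metis norm_eq_1)
  moreover have "\<forall>p\<in>?P. \<forall>q\<in>?P. p \<noteq> q \<longrightarrow> e p \<bullet> e q = - 1 / 6"
    using i0 i1 by (metis DiffI inner_commute singletonD)
  ultimately show ?thesis using sum0 unfolding fano_frame_def by blast
qed

fun elem_vec :: "('p, 'l) geometry \<Rightarrow> ('p \<Rightarrow> real ^ 6) \<Rightarrow> 'p + 'l \<Rightarrow> real ^ 6" where
  "elem_vec F e (Inl p) = e p"
| "elem_vec F e (Inr l) = (1 / (7 * sqrt 2)) *\<^sub>R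
     (4 *\<^sub>R (\<Sum>p \<in> points_on F l. e p) - 3 *\<^sub>R (\<Sum>p \<in> Points F - points_on F l. e p))"

text \<open>The linear action of an automorphism. It is unique because the \<open>e p\<close> span the space, and it
  exists for dualities as well as for collineations by the choice of the vectors of the lines.\<close>

definition lin_action ::
    "('p, 'l) geometry \<Rightarrow> ('p \<Rightarrow> real ^ 6) \<Rightarrow> ('p + 'l \<Rightarrow> 'p + 'l) \<Rightarrow> real ^ 6 \<Rightarrow> real ^ 6" where
  "lin_action F e \<theta> =
     (THE \<rho>. linear \<rho> \<and> (\<forall>x \<in> elements F. \<rho> (elem_vec F e x) = elem_vec F e (\<theta> x)))"

definition chi4 :: "('p, 'l) geometry \<Rightarrow> ('p \<Rightarrow> real ^ 6) \<Rightarrow> ('p + 'l \<Rightarrow> 'p + 'l) \<Rightarrow> real" where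
  "chi4 F e \<theta> = trace (matrix (lin_action F e \<theta>))"

text \<open>Of the two conjugacy classes of elements of order 8 in \<open>L\<^sub>3(2):2\<close>, the class 8A is
  the one on which the character takes the value \<open>\<surd>2\<close>.\<close>

definition class_8A ::
    "('p, 'l) geometry \<Rightarrow> ('p \<Rightarrow> real ^ 6) \<Rightarrow> ('p + 'l \<Rightarrow> 'p + 'l) set" where
  "class_8A F e =
     {\<theta> \<in> carrier (aut_group F). group.ord (aut_group F) \<theta> = 8 \<and> chi4 F e \<theta> = sqrt 2}"

end

theory Submission
  imports Defs
begin

text \<open>For an automorphism \<open>\<theta>\<close> take an element \<open>x\<close> whose distance to \<open>\<theta> x\<close> is largest. By thickness the
  geodesic from \<open>x\<close> to \<open>\<theta> x\<close> can be prolonged at both ends by a neighbour \<open>y\<close> of \<open>x\<close> and its image, and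
  non-backtracking walks of length at most \<open>n\<close> are geodesics. Hence a duality of a \<open>(2n + 1)\<close>-gon
  attains the distance \<open>2n + 1\<close>, while a nontrivial collineation attains \<open>2n\<close> and then maps the
  chamber \<open>{x, y}\<close> to an opposite one.

  For a duality of a plane call \<open>x\<close> absolute if it is incident with \<open>\<theta> x\<close>. Domesticity means that every
  flag has an absolute member. A line through a non-absolute point then carries at most two absolute
  and at most two non-absolute points, and a parity argument excludes four points on a line, which
  leaves the Fano plane. There a non-absolute point \<open>p\<close>, its image \<open>\<theta> (\<theta> p)\<close> and a suitable third point
  give coordinates in which \<open>\<theta>\<close> is one fixed permutation. A duality with \<open>a\<close> absolute points has
  character value \<open>(a - 3) / \<surd>2\<close>, collineations have rational values, and a duality is domestic
  if it has five absolute points.\<close>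

section \<open>Non-backtracking walks\<close>

text \<open>Non-backtracking walks can be checked locally, yet they decide distances: two of them
  with the same ends, different lengths and total length below \<open>2 * n\<close> would yield a
  closed one shorter than \<open>2 * n\<close>, and a shortest such walk is an ordinary
  \<open>k\<close>-gon with \<open>k < n\<close>. At a maximal displacement \<open>d\<close> the
  prolonged walk cannot be a geodesic, so \<open>d + 2\<close> exceeds \<open>2 * n + 1\<close>. The
  distance from an element to its image is odd for a duality and even for a collineation, and since
  the diameter \<open>2 * n + 1\<close> is odd, the two kinds end with different values of
  \<open>d\<close>.

  The plane is not assumed to be finite; finiteness results from covering one line by two pairs of
  points. In the Fano plane the fixed permutation does two things. Dualities with the same table are
  conjugate by relabelling. And the character value \<open>sqrt 2\<close> means five absolute
  points, which gives domesticity and so again this table; hence the elements singled out by the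
  character form a single conjugacy class.\<close>

definition nb_walk :: "('a \<times> 'a) set \<Rightarrow> (nat \<Rightarrow> 'a) \<Rightarrow> nat \<Rightarrow> bool" where
  "nb_walk E f k \<longleftrightarrow> (\<forall>i<k. (f i, f (Suc i)) \<in> E) \<and> (\<forall>i. Suc (Suc i) \<le> k \<longrightarrow> f i \<noteq> f (Suc (Suc i)))"

lemma nb_walkD1: "nb_walk E f k \<Longrightarrow> i < k \<Longrightarrow> (f i, f (Suc i)) \<in> E"
  and nb_walkD2: "nb_walk E f k \<Longrightarrow> Suc (Suc i) \<le> k \<Longrightarrow> f i \<noteq> f (Suc (Suc i))"
  unfolding nb_walk_def by auto

lemma nb_walk_sub: "nb_walk E f k \<Longrightarrow> a + j \<le> k \<Longrightarrow> nb_walk E (\<lambda>i. f (a + i)) j"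
  unfolding nb_walk_def by auto

lemma nb_walk_rev:
  assumes "sym E" "nb_walk E f k"
  shows "nb_walk E (\<lambda>i. f (k - i)) k"
  unfolding nb_walk_def
proof safe
  fix i assume i: "i < k"
  have "(f (k - Suc i), f (Suc (k - Suc i))) \<in> E"
    by (rule nb_walkD1[OF assms(2)]) (use i in auto)
  then show "(f (k - i), f (k - Suc i)) \<in> E"
    using i assms(1) by (simp add: Suc_diff_Suc symD)
next
  fix i assume i: "Suc (Suc i) \<le> k" and e: "f (k - i) = f (k - Suc (Suc i))"
  have "f (k - Suc (Suc i)) \<noteq> f (Suc (Suc (k - Suc (Suc i))))"
    by (rule nb_walkD2[OF assms(2)]) (use i in auto)
  moreover have "Suc (Suc (k - Suc (Suc i))) = k - i" using i by simp
  ultimately show False using e by simp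
qed

text \<open>A step back can only arise at the junction, and there only if both walks have an edge;
  hence the guards on \<open>turn\<close>.\<close>

lemma nb_walk_append:
  assumes f: "nb_walk E f k" and g: "nb_walk E g m" and fg: "f k = g 0"
    and turn: "k > 0 \<Longrightarrow> m > 0 \<Longrightarrow> f (k - 1) \<noteq> g 1"
  shows "nb_walk E (\<lambda>i. if i \<le> k then f i else g (i - k)) (k + m)" (is "nb_walk E ?h _")
  unfolding nb_walk_def
proof safe
  fix i assume i: "i < k + m"
  consider "Suc i \<le> k" | "i = k" | "i > k" by linarith
  then show "(?h i, ?h (Suc i)) \<in> E"
  proof cases
    case 1
    then show ?thesis using nb_walkD1[OF f, of i] by simp
  next
    case 2
    then show ?thesis using i nb_walkD1[OF g, of 0] fg by simp
  next
    case 3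
    then have "Suc i - k = Suc (i - k)" by simp
    then show ?thesis using 3 i nb_walkD1[OF g, of "i - k"] by simp
  qed
next
  fix i assume i: "Suc (Suc i) \<le> k + m" and e: "?h i = ?h (Suc (Suc i))"
  consider "Suc (Suc i) \<le> k" | "Suc i = k" | "i = k" | "i > k" by linarith
  then show False
  proof cases
    case 1
    then show ?thesis using e nb_walkD2[OF f, of i] by simp
  next
    case 2
    then have "Suc (Suc i) - k = 1" "k - 1 = i" by auto
    then show ?thesis using 2 i e turn by simp
  next
    case 3
    then show ?thesis using e i nb_walkD2[OF g, of 0] fg by (simp add: numeral_2_eq_2)
  next
    case 4
    then have "Suc (Suc i) - k = Suc (Suc (i - k))" by simp
    then show ?thesis using 4 e i nb_walkD2[OF g, of "i - k"] by simp
  qed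
qed

lemma nb_walk_imp_relpow: "nb_walk E f k \<Longrightarrow> (f 0, f k) \<in> E ^^ k"
  unfolding relpow_fun_conv nb_walk_def by blast

text \<open>Cutting out a step back, where \<open>f i = f (Suc (Suc i))\<close>, would leave a walk
  two edges shorter.\<close>

lemma shortest_walk_nb:
  assumes "(x, y) \<in> E ^^ k" and min: "\<And>j. (x, y) \<in> E ^^ j \<Longrightarrow> k \<le> j"
  shows "\<exists>f. f 0 = x \<and> f k = y \<and> nb_walk E f k"
proof -
  obtain f where f: "f 0 = x" "f k = y" and step: "\<forall>i<k. (f i, f (Suc i)) \<in> E"
    using assms(1) unfolding relpow_fun_conv by blast
  have "f i \<noteq> f (Suc (Suc i))" if i: "Suc (Suc i) \<le> k" for i
  proof
    assume e: "f i = f (Suc (Suc i))"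
    have "(f 0, f i) \<in> E ^^ i" unfolding relpow_fun_conv using step i by (intro exI[of _ f]) auto
    moreover have "Suc (Suc i) + (k - Suc (Suc i)) = k" using i by simp
    then have "(f (Suc (Suc i)), f k) \<in> E ^^ (k - Suc (Suc i))" unfolding relpow_fun_conv
      using step i by (intro exI[of _ "\<lambda>j. f (Suc (Suc i) + j)"]) auto
    ultimately have "(x, y) \<in> E ^^ (i + (k - Suc (Suc i)))"
      using e f by (auto simp: relpow_add)
    then have "k \<le> i + (k - Suc (Suc i))" by (rule min)
    then show False using i by simp
  qed
  then show ?thesis using f step unfolding nb_walk_def by blast
qed

section \<open>Incidence graphs\<close>

lemma sym_incidence_graph: "sym (incidence_graph \<Gamma>)"
  unfolding incidence_graph_def sym_def by blast

lemma incidence_graph_iff [simp]: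
  "(Inl p, Inr l) \<in> incidence_graph \<Gamma> \<longleftrightarrow> (p, l) \<in> Inc \<Gamma>"
  "(Inr l, Inl p) \<in> incidence_graph \<Gamma> \<longleftrightarrow> (p, l) \<in> Inc \<Gamma>"
  "(Inl p, Inl q) \<notin> incidence_graph \<Gamma>"
  "(Inr l, Inr m) \<notin> incidence_graph \<Gamma>"
  unfolding incidence_graph_def by auto

lemma elements_iff [simp]:
  "Inl p \<in> elements \<Gamma> \<longleftrightarrow> p \<in> Points \<Gamma>"
  "Inr l \<in> elements \<Gamma> \<longleftrightarrow> l \<in> Lines \<Gamma>"
  unfolding elements_def by auto

lemma incidence_graph_sym: "(x, y) \<in> incidence_graph \<Gamma> \<longleftrightarrow> (y, x) \<in> incidence_graph \<Gamma>"
  using sym_incidence_graph symD by metis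

lemma incidence_graph_isl: "(x, y) \<in> incidence_graph \<Gamma> \<Longrightarrow> isl y \<longleftrightarrow> \<not> isl x"
  unfolding incidence_graph_def by auto

lemma relpow_incidence_graph_isl: "(x, y) \<in> incidence_graph \<Gamma> ^^ k \<Longrightarrow> isl y = (isl x = even k)"
proof (induction k arbitrary: y)
  case (Suc k)
  then obtain z where "(x, z) \<in> incidence_graph \<Gamma> ^^ k" "(z, y) \<in> incidence_graph \<Gamma>" by auto
  then show ?case using Suc.IH incidence_graph_isl by fastforce
qed simp

lemma incidence_graph_elements:
  assumes "point_line_geometry \<Gamma>" "(x, y) \<in> incidence_graph \<Gamma>"
  shows "x \<in> elements \<Gamma>" "y \<in> elements \<Gamma>"
  using assms unfolding incidence_graph_def point_line_geometry_def by auto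

lemma relpow_sym: "sym E \<Longrightarrow> (x, y) \<in> E ^^ k \<Longrightarrow> (y, x) \<in> E ^^ k"
proof (induction k arbitrary: y)
  case (Suc k)
  then obtain z where "(x, z) \<in> E ^^ k" "(z, y) \<in> E" by auto
  then show ?case using Suc relpow_Suc_I2[of y z E x k] by (auto dest: symD)
qed simp

lemma elem_dist_commute: "elem_dist \<Gamma> x y = elem_dist \<Gamma> y x"
proof -
  have "(x, y) \<in> incidence_graph \<Gamma> ^^ k \<longleftrightarrow> (y, x) \<in> incidence_graph \<Gamma> ^^ k" for k
    using relpow_sym[OF sym_incidence_graph] by metis
  then show ?thesis unfolding elem_dist_def by simp
qed

section \<open>Cycles and geodesics in generalised polygons\<close>

text \<open>A subgeometry inherits all incidences between its elements, so the cycle must be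
  induced; \<open>adj\<close> therefore rules out chords. Starting at a point puts the points at
  even and the lines at odd positions.\<close>

lemma ordinary_polygon_of_cycle:
  assumes geo: "point_line_geometry \<Gamma>" and inj: "inj_on h {..<2 * k}" and h0: "isl (h 0)"
    and adj: "\<And>i j. i < 2 * k \<Longrightarrow> j < 2 * k \<Longrightarrow>
      (h i, h j) \<in> incidence_graph \<Gamma> \<longleftrightarrow> j = Suc i mod (2 * k) \<or> i = Suc j mod (2 * k)"
  shows "\<exists>\<Delta>. subgeometry \<Delta> \<Gamma> \<and> ordinary_polygon k \<Delta>"
proof -
  have step: "(h i, h (Suc i)) \<in> incidence_graph \<Gamma>" if "Suc i < 2 * k" for i
    using adj[of i "Suc i"] that by simp
  have par: "i < 2 * k \<Longrightarrow> isl (h i) = even i" for i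
  proof (induction i)
    case (Suc i)
    then show ?case using incidence_graph_isl[OF step[of i]] by simp
  qed (use h0 in simp)
  define p where "p i = projl (h (2 * i))" for i
  define l where "l i = projr (h (2 * i + 1))" for i
  have hp: "h (2 * i) = Inl (p i)" if "i < k" for i
    using par[of "2 * i"] that by (simp add: p_def)
  have hl: "h (2 * i + 1) = Inr (l i)" if "i < k" for i
    using par[of "2 * i + 1"] that by (simp add: l_def)
  have inc: "(p i, l j) \<in> Inc \<Gamma> \<longleftrightarrow> j = i \<or> i = Suc j mod k" if "i < k" "j < k" for i j
  proof -
    have "(p i, l j) \<in> Inc \<Gamma> \<longleftrightarrow> (h (2 * i), h (2 * j + 1)) \<in> incidence_graph \<Gamma>"
      using hp[OF that(1)] hl[OF that(2)] by simp
    also have "\<dots> \<longleftrightarrow> 2 * j + 1 = Suc (2 * i) mod (2 * k) \<or> 2 * i = Suc (2 * j + 1) mod (2 * k)"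
      by (rule adj) (use that in auto)
    also have "Suc (2 * i) mod (2 * k) = 2 * i + 1" using that by simp
    also have "Suc (2 * j + 1) mod (2 * k) = 2 * (Suc j mod k)"
      using mult_mod_right[of 2 "Suc j" k] by simp
    finally show ?thesis by auto
  qed
  have k0: "Suc j mod k < k" if "j < k" for j using that by simp
  have ip: "inj_on p {..<k}"
  proof (rule inj_onI)
    fix i j assume "i \<in> {..<k}" "j \<in> {..<k}" "p i = p j"
    then have "h (2 * i) = h (2 * j)" "2 * i < 2 * k" "2 * j < 2 * k" using hp by auto
    then have "2 * i = 2 * j" using inj unfolding inj_on_def by blast
    then show "i = j" by simp
  qed
  have il: "inj_on l {..<k}"
  proof (rule inj_onI)
    fix i j assume "i \<in> {..<k}" "j \<in> {..<k}" "l i = l j"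
    then have "h (2 * i + 1) = h (2 * j + 1)" "2 * i + 1 < 2 * k" "2 * j + 1 < 2 * k"
      using hl by auto
    then have "2 * i + 1 = 2 * j + 1" using inj unfolding inj_on_def by blast
    then show "i = j" by simp
  qed
  define \<Delta> where "\<Delta> = \<lparr>Points = p ` {..<k}, Lines = l ` {..<k}, Inc = Inc \<Gamma> \<inter> (p ` {..<k} \<times> l ` {..<k})\<rparr>"
  have "p i \<in> Points \<Gamma>" "l i \<in> Lines \<Gamma>" if "i < k" for i
    using inc[OF that that] geo unfolding point_line_geometry_def by auto
  then have "subgeometry \<Delta> \<Gamma>" unfolding subgeometry_def \<Delta>_def by auto
  moreover have "Inc \<Delta> = {(p i, l i) | i. i < k} \<union> {(p (Suc i mod k), l i) | i. i < k}"
    unfolding \<Delta>_def using inc k0 by auto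
  then have "ordinary_polygon k \<Delta>"
    unfolding ordinary_polygon_def using ip il
    by (intro exI[of _ p] exI[of _ l]) (auto simp: \<Delta>_def bij_betw_def)
  ultimately show ?thesis by blast
qed

text \<open>A shortest closed walk is an induced cycle: a repeated vertex or a chord would give a shorter one.\<close>

lemma closed_nb_walk_length:
  assumes gp: "generalised_polygon n \<Gamma>" and "nb_walk (incidence_graph \<Gamma>) f r" "r \<ge> 1" "f 0 = f r"
  shows "2 * n \<le> r"
proof (rule ccontr)
  let ?E = "incidence_graph \<Gamma>"
  let ?Q = "\<lambda>r. \<exists>f. nb_walk ?E f r \<and> r \<ge> 1 \<and> f 0 = f r"
  assume less: "\<not> 2 * n \<le> r"
  define m where "m = (LEAST r. ?Q r)"
  have "?Q r" using assms by blast
  then have "?Q m" "m \<le> r" unfolding m_def by (rule LeastI, rule Least_le)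
  then obtain f where f: "nb_walk ?E f m" "m \<ge> 1" "f 0 = f m" by blast
  have least: "m \<le> j" if "?Q j" for j unfolding m_def by (rule Least_le) (rule that)
  have par: "isl (f i) = (isl (f 0) = even i)" if "i \<le> m" for i
  proof -
    have "nb_walk ?E f i" using nb_walk_sub[OF f(1), of 0 i] that by simp
    then show ?thesis using relpow_incidence_graph_isl nb_walk_imp_relpow by blast
  qed
  from par[of m] have "even m" unfolding f(3)[symmetric] by blast
  moreover have "m \<noteq> 2" using nb_walkD2[OF f(1), of 0] f(3) by (auto simp: numeral_2_eq_2)
  ultimately obtain k where k: "m = 2 * k" "k \<ge> 2"
  proof -
    obtain k where "m = 2 * k" using \<open>even m\<close> by blast
    then show ?thesis using that \<open>m \<noteq> 2\<close> f(2) by (cases "k = 1") auto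
  qed
  \<comment> \<open>This includes backtracking across the base point, which \<open>nb_walk\<close>
    does not forbid: \<open>f 1 = f (m - 1)\<close> is a repetition too.\<close>
  have neq: "f i \<noteq> f j" if "i < j" "j < m" for i j
  proof
    assume "f i = f j"
    then have "?Q (j - i)"
      using nb_walk_sub[OF f(1), of i "j - i"] that by (intro exI[of _ "\<lambda>t. f (i + t)"]) auto
    then have "m \<le> j - i" by (rule least)
    then show False using that by simp
  qed
  have inj: "inj_on f {..<m}"
  proof (rule inj_onI)
    fix i j assume "i \<in> {..<m}" "j \<in> {..<m}" "f i = f j"
    then show "i = j" using neq[of i j] neq[of j i] by (cases i j rule: linorder_cases) auto
  qed
  have chord: "j = Suc i \<or> (i = 0 \<and> Suc j = m)" if ij: "i < j" "j < m" and e: "(f i, f j) \<in> ?E" for i j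
  proof (rule ccontr)
    assume neg: "\<not> ?thesis"
    \<comment> \<open>The arc from \<open>f i\<close> to \<open>f j\<close>, closed by the chord as
      a walk with one edge.\<close>
    let ?h = "\<lambda>t. if t \<le> j - i then f (i + t) else (\<lambda>t. if t = 0 then f j else f i) (t - (j - i))"
    have "j - 1 \<noteq> i" "j - 1 \<in> {..<m}" "i \<in> {..<m}" using ij neg by auto
    then have "f (j - 1) \<noteq> f i" using inj unfolding inj_on_def by blast
    then have "nb_walk ?E ?h (j - i + 1)"
      using ij e nb_walk_sub[OF f(1), of i "j - i"] incidence_graph_sym[of "f i" "f j" \<Gamma>]
      by (intro nb_walk_append) (auto simp: nb_walk_def)
    then have "?Q (j - i + 1)" by (intro exI[of _ ?h]) auto
    then have "m \<le> j - i + 1" by (rule least)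
    then show False using neg ij by arith
  qed
  have adj: "(f i, f j) \<in> ?E \<longleftrightarrow> j = Suc i mod m \<or> i = Suc j mod m" if "i < m" "j < m" for i j
  proof
    assume e: "(f i, f j) \<in> ?E"
    have "i \<noteq> j" using incidence_graph_isl[OF e] by auto
    then show "j = Suc i mod m \<or> i = Suc j mod m"
      using chord[of i j] chord[of j i] that e incidence_graph_sym[of "f i" "f j" \<Gamma>]
      by (cases "i < j") auto
  next
    have "(f i, f (Suc i mod m)) \<in> ?E" if "i < m" for i
      using nb_walkD1[OF f(1) that] that f(3) by (cases "Suc i = m") auto
    then show "j = Suc i mod m \<or> i = Suc j mod m \<Longrightarrow> (f i, f j) \<in> ?E"
      using that incidence_graph_sym[of "f i" "f j" \<Gamma>] by blast
  qed
  have geo: "point_line_geometry \<Gamma>" using gp unfolding generalised_polygon_def by blast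
  have "\<exists>\<Delta>. subgeometry \<Delta> \<Gamma> \<and> ordinary_polygon k \<Delta>"
  proof (cases "isl (f 0)")
    case True
    show ?thesis by (rule ordinary_polygon_of_cycle[OF geo, of f k]) (use True inj adj k in auto)
  next
    case False
    \<comment> \<open>Shifting the cycle by one position makes it start at a point.\<close>
    let ?h = "\<lambda>i. f (Suc i mod m)"
    have "isl (?h 0)" using False par[of 1] k by simp
    moreover have "inj_on ?h {..<2 * k}"
    proof (rule inj_onI)
      fix i j assume ij: "i \<in> {..<2 * k}" "j \<in> {..<2 * k}" "?h i = ?h j"
      then have "Suc i mod m < m" "Suc j mod m < m" using k by auto
      then have "Suc i mod m = Suc j mod m" using ij inj unfolding inj_on_def by blast
      then show "i = j" using ij k by (auto simp: mod_Suc split: if_splits)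
    qed
    moreover have "(?h i, ?h j) \<in> ?E \<longleftrightarrow> j = Suc i mod (2 * k) \<or> i = Suc j mod (2 * k)"
      if "i < 2 * k" "j < 2 * k" for i j
      using that adj[of "Suc i mod m" "Suc j mod m"] k by (auto simp: mod_Suc)
    ultimately show ?thesis by (intro ordinary_polygon_of_cycle[OF geo])
  qed
  moreover have "k < n" using k \<open>m \<le> r\<close> less by simp
  ultimately show False using gp k(2) unfolding generalised_polygon_def by blast
qed

text \<open>If the last edges differ, \<open>f\<close> followed by the reverse of \<open>g\<close>
  is a closed non-backtracking walk of length below \<open>2 * n\<close>, which does not exist. If
  they agree, both walks lose their last edge and the induction applies.\<close>

lemma nb_walks_same_length:
  assumes gp: "generalised_polygon n \<Gamma>"
  shows "nb_walk (incidence_graph \<Gamma>) f r \<Longrightarrow> nb_walk (incidence_graph \<Gamma>) g s \<Longrightarrow>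
    f 0 = g 0 \<Longrightarrow> f r = g s \<Longrightarrow> r + s < 2 * n \<Longrightarrow> r = s"
proof (induction r arbitrary: s)
  case 0
  then show ?case using closed_nb_walk_length[OF gp, of g s] by (cases "s = 0") auto
next
  case (Suc r)
  let ?E = "incidence_graph \<Gamma>"
  consider "s = 0" | "s > 0" "f r = g (s - 1)" | "s > 0" "f r \<noteq> g (s - 1)" by auto
  then show ?case
  proof cases
    case 1
    then show ?thesis using Suc.prems closed_nb_walk_length[OF gp, of f "Suc r"] by auto
  next
    case 2
    have "r = s - 1"
      using Suc.prems nb_walk_sub[of ?E f "Suc r" 0 r] nb_walk_sub[of ?E g s 0 "s - 1"] 2
      by (intro Suc.IH) auto
    then show ?thesis using 2 by simp
  next
    case 3
    let ?h = "\<lambda>i. if i \<le> Suc r then f i else (\<lambda>i. g (s - i)) (i - Suc r)"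
    have "nb_walk ?E ?h (Suc r + s)"
      using Suc.prems 3 by (intro nb_walk_append nb_walk_rev sym_incidence_graph) auto
    then have "2 * n \<le> Suc r + s"
      using 3 Suc.prems by (intro closed_nb_walk_length[OF gp, of ?h]) auto
    then show ?thesis using Suc.prems by simp
  qed
qed

lemma relpow_mono_set:
  fixes R S :: "('a \<times> 'a) set"
  assumes "R \<subseteq> S"
  shows "R ^^ k \<subseteq> S ^^ k"
  by (induction k) (use assms in auto)

text \<open>Two elements split the cycle of length \<open>2 * n\<close> into two arcs, one of which
  has at most \<open>n\<close> edges. The sequence \<open>c\<close> is periodic, so that the arc
  across the end of the numbering is also a piece of it.\<close>

lemma ordinary_polygon_relpow:
  assumes "ordinary_polygon n \<Delta>" "x \<in> elements \<Delta>" "y \<in> elements \<Delta>"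
  shows "\<exists>k\<le>n. (x, y) \<in> incidence_graph \<Delta> ^^ k"
proof -
  obtain p l where p: "bij_betw p {..<n} (Points \<Delta>)" and l: "bij_betw l {..<n} (Lines \<Delta>)"
    and inc: "Inc \<Delta> = {(p i, l i) | i. i < n} \<union> {(p (Suc i mod n), l i) | i. i < n}"
    using assms(1) unfolding ordinary_polygon_def by blast
  define c where "c i = (if even i then Inl (p (i div 2 mod n)) else Inr (l (i div 2 mod n)))" for i
  have n0: "n > 0" using assms(2) p l unfolding elements_def bij_betw_def by auto
  have on: "(p i, l i) \<in> Inc \<Delta>" "(p (Suc i mod n), l i) \<in> Inc \<Delta>" if "i < n" for i
    unfolding inc using that by blast+
  have step: "(c i, c (Suc i)) \<in> incidence_graph \<Delta>" for i
  proof (cases "even i")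
    case True
    then have "Suc i div 2 = i div 2" by simp
    then show ?thesis using True on(1)[of "i div 2 mod n"] n0 unfolding c_def by simp
  next
    case False
    then have "Suc i div 2 = Suc (i div 2)" by simp
    moreover have "Suc (i div 2) mod n = Suc (i div 2 mod n) mod n"
      by (rule mod_Suc_eq[symmetric])
    ultimately show ?thesis using False on(2)[of "i div 2 mod n"] n0 unfolding c_def
      by simp
  qed
  have walk: "(c i, c (i + k)) \<in> incidence_graph \<Delta> ^^ k" for i k
    by (induction k) (use step in auto)
  have surj: "\<exists>i<2 * n. z = c i" if "z \<in> elements \<Delta>" for z
  proof -
    have "Points \<Delta> = p ` {..<n}" "Lines \<Delta> = l ` {..<n}" using p l unfolding bij_betw_def by auto
    then have "z \<in> Inl ` p ` {..<n} \<union> Inr ` l ` {..<n}" using that unfolding elements_def by simp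
    then consider i where "i < n" "z = Inl (p i)" | i where "i < n" "z = Inr (l i)" by auto
    then show ?thesis
    proof cases
      case 1
      then show ?thesis by (intro exI[of _ "2 * i"]) (auto simp: c_def)
    next
      case 2
      then show ?thesis by (intro exI[of _ "2 * i + 1"]) (auto simp: c_def)
    qed
  qed
  have ordered: "\<exists>k\<le>n. (c a, c b) \<in> incidence_graph \<Delta> ^^ k" if "a \<le> b" "b < 2 * n" for a b
  proof (cases "b - a \<le> n")
    case True
    then show ?thesis using walk[of a "b - a"] that by auto
  next
    case False
    have "c (b + (2 * n + a - b)) = c a" using that unfolding c_def by simp
    then have "(c b, c a) \<in> incidence_graph \<Delta> ^^ (2 * n + a - b)"
      using walk[of b "2 * n + a - b"] by simp
    then show ?thesis using False that relpow_sym[OF sym_incidence_graph] by (intro exI[of _ "2 * n + a - b"]) auto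
  qed
  obtain a b where ab: "a < 2 * n" "b < 2 * n" "x = c a" "y = c b" using surj assms by blast
  then show ?thesis
    using ordered[of a b] ordered[of b a] relpow_sym[OF sym_incidence_graph]
    by (cases "a \<le> b") (auto, blast)
qed

lemma geodesic_exists:
  assumes gp: "generalised_polygon n \<Gamma>" and xy: "x \<in> elements \<Gamma>" "y \<in> elements \<Gamma>"
  shows "elem_dist \<Gamma> x y \<le> n"
    and "\<exists>f. nb_walk (incidence_graph \<Gamma>) f (elem_dist \<Gamma> x y) \<and> f 0 = x \<and> f (elem_dist \<Gamma> x y) = y"
proof -
  obtain \<Delta> where \<Delta>: "subgeometry \<Delta> \<Gamma>" "ordinary_polygon n \<Delta>" "x \<in> elements \<Delta>" "y \<in> elements \<Delta>"
    using gp xy unfolding generalised_polygon_def by blast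
  have "incidence_graph \<Delta> \<subseteq> incidence_graph \<Gamma>"
    using \<Delta>(1) unfolding subgeometry_def incidence_graph_def by auto
  then obtain k where k: "k \<le> n" "(x, y) \<in> incidence_graph \<Gamma> ^^ k"
    using ordinary_polygon_relpow[OF \<Delta>(2-4)] relpow_mono_set by blast
  then have "elem_dist \<Gamma> x y \<le> k" unfolding elem_dist_def by (intro Least_le)
  then show "elem_dist \<Gamma> x y \<le> n" using k by simp
  have "(x, y) \<in> incidence_graph \<Gamma> ^^ elem_dist \<Gamma> x y"
    unfolding elem_dist_def by (rule LeastI) (rule k)
  then show "\<exists>f. nb_walk (incidence_graph \<Gamma>) f (elem_dist \<Gamma> x y) \<and> f 0 = x \<and> f (elem_dist \<Gamma> x y) = y"
    using shortest_walk_nb[of x y "elem_dist \<Gamma> x y" "incidence_graph \<Gamma>"] unfolding elem_dist_def by (metis Least_le)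
qed

text \<open>A shorter walk between the ends, together with this one, would have total length below
  \<open>2 * n\<close> but a different length.\<close>

lemma nb_walk_geodesic:
  assumes gp: "generalised_polygon n \<Gamma>" and f: "nb_walk (incidence_graph \<Gamma>) f r" "r \<le> n" "n > 0"
  shows "elem_dist \<Gamma> (f 0) (f r) = r"
proof (rule antisym)
  let ?E = "incidence_graph \<Gamma>" and ?x = "f 0" and ?y = "f r"
  have r: "(?x, ?y) \<in> ?E ^^ r" by (rule nb_walk_imp_relpow[OF f(1)])
  then show le: "elem_dist \<Gamma> ?x ?y \<le> r" unfolding elem_dist_def by (intro Least_le)
  have "(?x, ?y) \<in> ?E ^^ elem_dist \<Gamma> ?x ?y" unfolding elem_dist_def by (rule LeastI) (rule r)
  then obtain g where g: "nb_walk ?E g (elem_dist \<Gamma> ?x ?y)" "g 0 = ?x" "g (elem_dist \<Gamma> ?x ?y) = ?y"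
    using shortest_walk_nb[of ?x ?y "elem_dist \<Gamma> ?x ?y" ?E] unfolding elem_dist_def by (metis Least_le)
  show "r \<le> elem_dist \<Gamma> ?x ?y"
  proof (rule ccontr)
    assume neg: "\<not> ?thesis"
    then have "r = elem_dist \<Gamma> ?x ?y"
      using f g by (intro nb_walks_same_length[OF gp f(1) g(1)]) auto
    then show False using neg by simp
  qed
qed

lemma elem_dist_parity:
  assumes "generalised_polygon n \<Gamma>" "x \<in> elements \<Gamma>" "y \<in> elements \<Gamma>"
  shows "even (elem_dist \<Gamma> x y) \<longleftrightarrow> isl x = isl y"
proof -
  obtain f where "nb_walk (incidence_graph \<Gamma>) f (elem_dist \<Gamma> x y)" "f 0 = x" "f (elem_dist \<Gamma> x y) = y"
    using geodesic_exists(2)[OF assms] by blast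
  then have "isl y = (isl x = even (elem_dist \<Gamma> x y))"
    using nb_walk_imp_relpow relpow_incidence_graph_isl by metis
  then show ?thesis by blast
qed

section \<open>Automorphisms and displacement\<close>

lemma automorphism_elements: "automorphism \<Gamma> \<theta> \<Longrightarrow> x \<in> elements \<Gamma> \<Longrightarrow> \<theta> x \<in> elements \<Gamma>"
  unfolding automorphism_def by (auto dest: bij_betwE)

lemma automorphism_inj:
  "automorphism \<Gamma> \<theta> \<Longrightarrow> x \<in> elements \<Gamma> \<Longrightarrow> y \<in> elements \<Gamma> \<Longrightarrow> \<theta> x = \<theta> y \<Longrightarrow> x = y"
  unfolding automorphism_def bij_betw_def inj_on_def by blast

lemma automorphism_surj:
  assumes "automorphism \<Gamma> \<theta>" "y \<in> elements \<Gamma>"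
  obtains x where "x \<in> elements \<Gamma>" "\<theta> x = y"
proof -
  have "y \<in> \<theta> ` elements \<Gamma>"
    using assms unfolding automorphism_def bij_betw_def by simp
  then show ?thesis using that by blast
qed

lemma automorphism_incident:
  "automorphism \<Gamma> \<theta> \<Longrightarrow> x \<in> elements \<Gamma> \<Longrightarrow> y \<in> elements \<Gamma> \<Longrightarrow>
    (\<theta> x, \<theta> y) \<in> incidence_graph \<Gamma> \<longleftrightarrow> (x, y) \<in> incidence_graph \<Gamma>"
  unfolding automorphism_def by blast

lemma preserves_types_isl: "preserves_types \<Gamma> \<theta> \<Longrightarrow> x \<in> elements \<Gamma> \<Longrightarrow> isl (\<theta> x) = isl x"
  unfolding preserves_types_def elements_def by (auto simp: set_eq_iff image_iff) (metis sum.disc(1), metis sum.disc(2))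

lemma interchanges_types_isl: "interchanges_types \<Gamma> \<theta> \<Longrightarrow> x \<in> elements \<Gamma> \<Longrightarrow> isl (\<theta> x) \<longleftrightarrow> \<not> isl x"
  unfolding interchanges_types_def elements_def by (auto simp: set_eq_iff image_iff) (metis sum.disc(2), metis sum.disc(1))

lemma generalised_polygonD:
  assumes "generalised_polygon n \<Gamma>"
  shows "point_line_geometry \<Gamma>" "n \<ge> 2" "elements \<Gamma> \<noteq> {}"
  using assms unfolding generalised_polygon_def by auto

text \<open>The image of a geodesic is a non-backtracking walk of length at most \<open>n\<close>,
  hence again a geodesic.\<close>

lemma elem_dist_automorphism:
  assumes gp: "generalised_polygon n \<Gamma>" and aut: "automorphism \<Gamma> \<theta>"
    and xy: "x \<in> elements \<Gamma>" "y \<in> elements \<Gamma>"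
  shows "elem_dist \<Gamma> (\<theta> x) (\<theta> y) = elem_dist \<Gamma> x y"
proof -
  let ?d = "elem_dist \<Gamma> x y"
  obtain f where f: "nb_walk (incidence_graph \<Gamma>) f ?d" "f 0 = x" "f ?d = y"
    using geodesic_exists(2)[OF gp xy] by blast
  have V: "f i \<in> elements \<Gamma>" if "i \<le> ?d" for i
  proof (cases "i = ?d")
    case False
    then show ?thesis
      using that nb_walkD1[OF f(1), of i] incidence_graph_elements(1)[OF generalised_polygonD(1)[OF gp]]
      by simp
  qed (use f xy in simp)
  have "nb_walk (incidence_graph \<Gamma>) (\<lambda>i. \<theta> (f i)) ?d"
    unfolding nb_walk_def
  proof safe
    fix i assume "i < ?d"
    then show "(\<theta> (f i), \<theta> (f (Suc i))) \<in> incidence_graph \<Gamma>"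
      using V[of i] V[of "Suc i"] nb_walkD1[OF f(1)] automorphism_incident[OF aut] by simp
  next
    fix i assume "Suc (Suc i) \<le> ?d" "\<theta> (f i) = \<theta> (f (Suc (Suc i)))"
    then show False
      using V[of i] V[of "Suc (Suc i)"] nb_walkD2[OF f(1), of i] automorphism_inj[OF aut] by auto
  qed
  then show ?thesis
    using nb_walk_geodesic[OF gp] geodesic_exists(1)[OF gp xy] f generalised_polygonD(2)[OF gp] by fastforce
qed

lemma thick_neighbour:
  assumes "thick \<Gamma>" "x \<in> elements \<Gamma>"
  obtains y where "(x, y) \<in> incidence_graph \<Gamma>" "y \<noteq> a" "y \<noteq> b"
proof -
  have "\<exists>A. card A = 3 \<and> (\<forall>y\<in>A. (x, y) \<in> incidence_graph \<Gamma>)"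
  proof (cases x)
    case (Inl p)
    then obtain A where "A \<subseteq> lines_on \<Gamma> p" "card A = 3" using assms unfolding thick_def by auto
    then show ?thesis using Inl unfolding lines_on_def
      by (intro exI[of _ "Inr ` A"]) (auto simp: card_image)
  next
    case (Inr l)
    then obtain A where "A \<subseteq> points_on \<Gamma> l" "card A = 3" using assms unfolding thick_def by auto
    then show ?thesis using Inr unfolding points_on_def
      by (intro exI[of _ "Inl ` A"]) (auto simp: card_image)
  qed
  then obtain A where A: "card A = 3" "\<And>y. y \<in> A \<Longrightarrow> (x, y) \<in> incidence_graph \<Gamma>" by blast
  have "\<not> A \<subseteq> {a, b}"
  proof
    assume "A \<subseteq> {a, b}"
    then have "card A \<le> card {a, b}" by (rule card_mono[rotated]) simp
    also have "\<dots> \<le> 2" by (simp add: card_insert_if)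
    finally show False using A by simp
  qed
  then show ?thesis using A that by blast
qed

text \<open>Thickness leaves a neighbour \<open>y\<close> of \<open>x\<close> that avoids the first step of the geodesic from \<open>x\<close>
  to \<open>\<theta> x\<close> and whose image avoids its last step.\<close>

lemma displacement_extend:
  assumes gp: "generalised_polygon n \<Gamma>" and thick: "thick \<Gamma>" and aut: "automorphism \<Gamma> \<theta>"
    and x: "x \<in> elements \<Gamma>" and d: "elem_dist \<Gamma> x (\<theta> x) = d" "d \<ge> 1"
  shows "\<exists>h. nb_walk (incidence_graph \<Gamma>) h (Suc (Suc d)) \<and> h 1 = x \<and> h (Suc d) = \<theta> x \<and>
    h (Suc (Suc d)) = \<theta> (h 0)"
proof -
  let ?E = "incidence_graph \<Gamma>"
  have tx: "\<theta> x \<in> elements \<Gamma>" using aut x by (rule automorphism_elements)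
  obtain f where f: "nb_walk ?E f d" "f 0 = x" "f d = \<theta> x"
    using geodesic_exists(2)[OF gp x tx] d by blast
  note E = incidence_graph_elements[OF generalised_polygonD(1)[OF gp]]
  have "(f (d - 1), f (Suc (d - 1))) \<in> ?E" by (rule nb_walkD1[OF f(1)]) (use d in simp)
  then have "f (d - 1) \<in> elements \<Gamma>" by (rule E)
  then obtain b where b: "b \<in> elements \<Gamma>" "\<theta> b = f (d - 1)" by (rule automorphism_surj[OF aut])
  obtain y where y: "(x, y) \<in> ?E" "y \<noteq> f 1" "y \<noteq> b" by (rule thick_neighbour[OF thick x])
  have ye: "y \<in> elements \<Gamma>" using E y by blast
  have ty: "(\<theta> x, \<theta> y) \<in> ?E" using automorphism_incident[OF aut x ye] y by simp
  have nb: "\<theta> y \<noteq> f (d - 1)" using automorphism_inj[OF aut ye b(1)] b y by auto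
  define h where "h i = (case i of 0 \<Rightarrow> y | Suc j \<Rightarrow> if j \<le> d then f j else \<theta> y)" for i
  have hs: "h 0 = y" "h (Suc j) = (if j \<le> d then f j else \<theta> y)" for j
    by (simp_all add: h_def)
  have "nb_walk ?E h (Suc (Suc d))"
    unfolding nb_walk_def
  proof (intro conjI allI impI notI)
    fix i assume i: "i < Suc (Suc d)"
    show "(h i, h (Suc i)) \<in> ?E"
    proof (cases i)
      case 0
      then show ?thesis using y f incidence_graph_sym by (auto simp: hs)
    next
      case (Suc j)
      then show ?thesis using i nb_walkD1[OF f(1), of j] ty f by (cases "j = d") (auto simp: hs)
    qed
  next
    fix i assume i: "Suc (Suc i) \<le> Suc (Suc d)" and eq: "h i = h (Suc (Suc i))"
    show False
    proof (cases i)
      case 0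
      then show ?thesis using y eq d by (auto simp: hs)
    next
      case (Suc j)
      show ?thesis
      proof (cases "Suc j = d")
        case True
        then have "h i = f (d - 1)" "h (Suc (Suc i)) = \<theta> y" using Suc hs by auto
        then show ?thesis using eq nb by simp
      next
        case False
        then show ?thesis using Suc i eq nb_walkD2[OF f(1), of j] by (auto simp: hs)
      qed
    qed
  qed
  then show ?thesis using f hs by (intro exI[of _ h]) simp
qed

lemma chamber_incident:
  assumes "generalised_polygon n \<Gamma>" "(Inl p, Inr l) \<in> incidence_graph \<Gamma>"
  shows "{Inl p, Inr l} \<in> chambers \<Gamma>"
proof -
  have "p \<in> Points \<Gamma>" "l \<in> Lines \<Gamma>" "(p, l) \<in> Inc \<Gamma>"
    using incidence_graph_elements[OF generalised_polygonD(1)[OF assms(1)] assms(2)] assms(2) by simp_all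
  then show ?thesis unfolding chambers_def by (intro CollectI exI[of _ p] exI[of _ l]) simp
qed

lemma domestic_automorphism_odd:
  assumes gp: "generalised_polygon (2 * n + 1) \<Gamma>" and thick: "thick \<Gamma>" and aut: "automorphism \<Gamma> \<theta>"
    and nontriv: "nontrivial \<Gamma> \<theta>" and dom: "domestic (2 * n + 1) \<Gamma> \<theta>"
  shows "exceptional_domestic (2 * n + 1) \<Gamma> \<theta> \<and> duality \<Gamma> \<theta>"
proof -
  let ?N = "2 * n + 1" and ?E = "incidence_graph \<Gamma>"
  let ?d = "\<lambda>x. elem_dist \<Gamma> x (\<theta> x)"
  note E = incidence_graph_elements[OF generalised_polygonD(1)[OF gp]]
  note el = automorphism_elements[OF aut]
  have bound: "?d x \<le> ?N" if "x \<in> elements \<Gamma>" for x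
    by (rule geodesic_exists(1)[OF gp that el[OF that]])
  obtain x0 where x0: "x0 \<in> elements \<Gamma>" "\<theta> x0 \<noteq> x0" using nontriv unfolding nontrivial_def by blast
  have d0: "?d x0 \<ge> 1"
  proof (rule ccontr)
    assume "\<not> ?thesis"
    then have "?d x0 = 0" by simp
    then show False using geodesic_exists(2)[OF gp x0(1) el[OF x0(1)]] x0 by auto
  qed
  obtain x where x: "x \<in> elements \<Gamma>" and max: "\<And>y. y \<in> elements \<Gamma> \<Longrightarrow> ?d y \<le> ?d x"
    using ex_has_greatest_nat[of "\<lambda>x. x \<in> elements \<Gamma>" x0 ?d "Suc ?N"] x0(1) bound by (auto simp: less_Suc_eq_le)
  have d1: "?d x \<ge> 1" using max[OF x0(1)] d0 by simp
  obtain h where h: "nb_walk ?E h (Suc (Suc (?d x)))" "h 1 = x" "h (Suc (?d x)) = \<theta> x"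
      "h (Suc (Suc (?d x))) = \<theta> (h 0)"
    using displacement_extend[OF gp thick aut x refl d1] by blast
  let ?y = "h 0"
  have yx: "(?y, x) \<in> ?E" using nb_walkD1[OF h(1), of 0] h(2) by simp
  then have y: "?y \<in> elements \<Gamma>" by (rule E)
  \<comment> \<open>Otherwise the prolonged walk is a geodesic from \<open>?y\<close> to its image,
    and \<open>?y\<close> is displaced farther than \<open>x\<close>.\<close>
  have large: "?N < Suc (Suc (?d x))"
  proof (rule ccontr)
    assume "\<not> ?thesis"
    then have "?d ?y = Suc (Suc (?d x))"
      using nb_walk_geodesic[OF gp h(1)] h(4) by simp
    then show False using max[OF y] by simp
  qed
  show ?thesis
  proof (cases "interchanges_types \<Gamma> \<theta>")
    case True
    then have "odd (?d x)"
      using elem_dist_parity[OF gp x el[OF x]] interchanges_types_isl[OF True x] by blast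
    then have dx: "?d x = ?N" using large bound[OF x] by (auto elim!: oddE)
    \<comment> \<open>\<open>\<theta> x\<close> has the same displacement as \<open>x\<close> and
      the other type, so the two provide both the point and the line mapped to an opposite
      element.\<close>
    then have dtx: "?d (\<theta> x) = ?N"
      using elem_dist_automorphism[OF gp aut x el[OF x]] by simp
    have "(\<exists>p \<in> Points \<Gamma>. ?d (Inl p) = ?N) \<and> (\<exists>l \<in> Lines \<Gamma>. ?d (Inr l) = ?N)"
    proof (cases x)
      case (Inl p)
      then obtain l where "\<theta> x = Inr l" using interchanges_types_isl[OF True x] by (cases "\<theta> x") auto
      then have "?d (Inl p) = ?N" "?d (Inr l) = ?N" "p \<in> Points \<Gamma>" "l \<in> Lines \<Gamma>"
        using Inl x dx dtx el[OF x] by auto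
      then show ?thesis by blast
    next
      case (Inr l)
      then obtain p where "\<theta> x = Inl p" using interchanges_types_isl[OF True x] by (cases "\<theta> x") auto
      then have "?d (Inl p) = ?N" "?d (Inr l) = ?N" "p \<in> Points \<Gamma>" "l \<in> Lines \<Gamma>"
        using Inr x dx dtx el[OF x] by auto
      then show ?thesis by blast
    qed
    then show ?thesis
      using True aut dom unfolding exceptional_domestic_def duality_def opposite_def by blast
  next
    case False
    then have pres: "preserves_types \<Gamma> \<theta>" using aut unfolding automorphism_def by blast
    have "even (?d x)"
      using elem_dist_parity[OF gp x el[OF x]] preserves_types_isl[OF pres x] by blast
    then have dx: "Suc (?d x) = ?N" using large bound[OF x] by (auto elim!: evenE)
    \<comment> \<open>Dropping the last or the first edge of \<open>h\<close> leaves walks of length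
      \<open>?N\<close>, from \<open>?y\<close> to \<open>\<theta> x\<close> and from
      \<open>x\<close> to \<open>\<theta> ?y\<close>. Both are geodesics, so the flag of
      \<open>x\<close> and \<open>?y\<close> goes to an opposite one.\<close>
    have 1: "elem_dist \<Gamma> ?y (\<theta> x) = ?N"
      using nb_walk_geodesic[OF gp nb_walk_sub[OF h(1), of 0 ?N]] dx h(3) by simp
    have 2: "elem_dist \<Gamma> x (\<theta> ?y) = ?N"
      using nb_walk_geodesic[OF gp nb_walk_sub[OF h(1), of 1 ?N]] dx h(2,4) by simp
    have opp: False if inc: "(Inl p, Inr l) \<in> ?E" and "elem_dist \<Gamma> (Inl p) (\<theta> (Inr l)) = ?N"
      "elem_dist \<Gamma> (Inr l) (\<theta> (Inl p)) = ?N" for p l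
    proof -
      obtain p' where p': "\<theta> (Inl p) = Inl p'"
        using preserves_types_isl[OF pres E(1)[OF inc]] by (cases "\<theta> (Inl p)") auto
      obtain l' where l': "\<theta> (Inr l) = Inr l'"
        using preserves_types_isl[OF pres E(2)[OF inc]] by (cases "\<theta> (Inr l)") auto
      have "opposite_chambers ?N \<Gamma> {Inl p, Inr l} (\<theta> ` {Inl p, Inr l})"
        unfolding opposite_chambers_def opposite_def using that p' l'
        by (intro exI[of _ p] exI[of _ l] exI[of _ p'] exI[of _ l']) (auto simp: elem_dist_commute)
      then show False
        using dom chamber_incident[OF gp that(1)] unfolding domestic_def by blast
    qed
    show ?thesis
    proof (cases x)
      case (Inl p)
      then obtain l where "?y = Inr l" using incidence_graph_isl[OF yx] by (cases ?y) auto
      then show ?thesis using opp[of p l] 1 2 yx Inl incidence_graph_sym by auto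
    next
      case (Inr l)
      then obtain p where "?y = Inl p" using incidence_graph_isl[OF yx] by (cases ?y) auto
      then show ?thesis using opp[of p l] 1 2 yx Inr by auto
    qed
  qed
qed

section \<open>Dualities of thick projective planes\<close>

text \<open>Points and lines are treated alike as vertices of the incidence graph, so each statement
  below also contains its dual.\<close>

locale thick_plane =
  fixes \<Gamma> :: "('p, 'l) geometry"
  assumes plane: "projective_plane \<Gamma>" and thick: "thick \<Gamma>"
begin

abbreviation adj :: "'p + 'l \<Rightarrow> 'p + 'l \<Rightarrow> bool" where
  "adj x y \<equiv> (x, y) \<in> incidence_graph \<Gamma>"

abbreviation nbrs :: "'p + 'l \<Rightarrow> ('p + 'l) set" where
  "nbrs x \<equiv> {y. adj x y}"

abbreviation V :: "('p + 'l) set" where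
  "V \<equiv> elements \<Gamma>"

lemmas adj_V = incidence_graph_elements[OF generalised_polygonD(1)[OF plane]]

lemma adj_sym: "adj x y \<Longrightarrow> adj y x"
  using incidence_graph_sym by metis

lemma adj_dist: "adj x y \<Longrightarrow> elem_dist \<Gamma> x y = 1"
  using nb_walk_geodesic[OF plane, of "case_nat x (\<lambda>_. y)" 1] by (simp add: nb_walk_def)

text \<open>Elements of different type have odd distance at most 3, that is, 1 or 3.\<close>

lemma opposite_iff:
  assumes xy: "x \<in> V" "y \<in> V" "isl x \<noteq> isl y"
  shows "opposite 3 \<Gamma> x y \<longleftrightarrow> \<not> adj x y"
proof
  show "opposite 3 \<Gamma> x y \<Longrightarrow> \<not> adj x y" using adj_dist unfolding opposite_def by force
  assume "\<not> adj x y"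
  have "elem_dist \<Gamma> x y \<noteq> 1"
  proof
    assume "elem_dist \<Gamma> x y = 1"
    then obtain f where "nb_walk (incidence_graph \<Gamma>) f 1" "f 0 = x" "f 1 = y"
      using geodesic_exists(2)[OF plane xy(1,2)] by auto
    then show False using \<open>\<not> adj x y\<close> nb_walkD1[of _ f 1 0] by auto
  qed
  moreover have "odd (elem_dist \<Gamma> x y)" using elem_dist_parity[OF plane xy(1,2)] xy(3) by blast
  moreover have "elem_dist \<Gamma> x y \<le> 3" by (rule geodesic_exists(1)[OF plane xy(1,2)])
  ultimately have "elem_dist \<Gamma> x y = 3" by (auto elim!: oddE)
  then show "opposite 3 \<Gamma> x y" unfolding opposite_def .
qed

lemma join:
  assumes xy: "x \<in> V" "y \<in> V" "isl x = isl y"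
  obtains z where "adj x z" "adj y z"
proof (cases "x = y")
  case True
  then show ?thesis using thick_neighbour[OF thick xy(1)] that by metis
next
  case False
  let ?d = "elem_dist \<Gamma> x y"
  obtain f where f: "nb_walk (incidence_graph \<Gamma>) f ?d" "f 0 = x" "f ?d = y"
    using geodesic_exists(2)[OF plane xy(1,2)] by blast
  have "even ?d" using elem_dist_parity[OF plane xy(1,2)] xy(3) by blast
  moreover have "?d \<le> 3" by (rule geodesic_exists(1)[OF plane xy(1,2)])
  moreover have "?d \<noteq> 0" using f False by metis
  ultimately have d: "?d = 2" by (auto elim!: evenE)
  have "adj x (f 1)" "adj (f 1) y"
    using nb_walkD1[OF f(1), of 0] nb_walkD1[OF f(1), of 1] f d by (auto simp: numeral_2_eq_2)
  then show ?thesis using that adj_sym by blast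
qed

text \<open>Otherwise \<open>x, z, y, w, x\<close> is a closed non-backtracking walk with 4 < 6
  edges.\<close>

lemma unique_join:
  assumes "adj x z" "adj y z" "adj x w" "adj y w" "x \<noteq> y"
  shows "z = w"
proof (rule ccontr)
  assume zw: "z \<noteq> w"
  let ?f = "\<lambda>i. [x, z, y, w, x] ! i"
  have "(\<forall>i<4. adj (?f i) (?f (Suc i)))"
    using assms adj_sym by (auto simp: numeral_eq_Suc less_Suc_eq)
  moreover have "\<forall>i. Suc (Suc i) \<le> 4 \<longrightarrow> ?f i \<noteq> ?f (Suc (Suc i))"
    using zw assms by (auto simp: numeral_eq_Suc le_Suc_eq)
  ultimately have "nb_walk (incidence_graph \<Gamma>) ?f 4" unfolding nb_walk_def by blast
  then show False using closed_nb_walk_length[OF plane, of ?f 4] by simp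
qed

lemma adj_isl: "adj x y \<Longrightarrow> isl y \<longleftrightarrow> \<not> isl x"
  by (rule incidence_graph_isl)

lemma third_neighbour:
  assumes "x \<in> V"
  obtains y where "adj x y" "y \<noteq> a" "y \<noteq> b"
  by (rule thick_neighbour[OF thick assms])

text \<open>The bijection \<open>m\<close> is the projection of a line from a point off it, or the
  dual: it sends \<open>z\<close> to the element joining \<open>z\<close> and
  \<open>y\<close>.\<close>

lemma perspectivity:
  assumes x: "x \<in> V" "y \<in> V" "isl x \<noteq> isl y" "\<not> adj x y"
  shows "card (nbrs x) = card (nbrs y)"
proof -
  define m where "m z = (SOME w. adj z w \<and> adj y w)" for z
  have m: "adj z (m z) \<and> adj y (m z)" if "adj x z" for z
  proof -
    have "isl z = isl y" using adj_isl[OF that] x(3) by blast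
    then show ?thesis unfolding m_def
      using join[OF adj_V(2)[OF that] x(2)] by (metis (mono_tags, lifting) someI_ex)
  qed
  have "bij_betw m (nbrs x) (nbrs y)"
    unfolding bij_betw_def
  proof
    show "inj_on m (nbrs x)"
    proof (rule inj_onI)
      fix z w assume zw: "z \<in> nbrs x" "w \<in> nbrs x" "m z = m w"
      show "z = w"
      proof (rule ccontr)
        assume "z \<noteq> w"
        then have "x = m z"
          using zw m[of z] m[of w] by (intro unique_join[of z x w]) (auto intro: adj_sym)
        then show False using m[of z] zw x(4) adj_sym by auto
      qed
    qed
    show "m ` nbrs x = nbrs y"
    proof safe
      fix w assume w: "adj y w"
      have "isl w = isl x" using adj_isl[OF w] x(3) by blast
      then obtain z where z: "adj w z" "adj x z" by (rule join[OF adj_V(2)[OF w] x(1)])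
      have "z \<noteq> y" using z x(4) by auto
      then have "m z = w"
        using m[OF z(2)] w z(1) by (intro unique_join[of z _ y]) (auto intro: adj_sym)
      then show "w \<in> m ` nbrs x" using z by blast
    qed (use m in auto)
  qed
  then show ?thesis by (rule bij_betw_same_card)
qed

text \<open>Two perspectivities through an element \<open>l\<close> incident with neither
  \<open>x\<close> nor \<open>y\<close>. Any neighbour \<open>l\<close> of a third element
  \<open>w\<close> on the join \<open>z\<close> will do, except \<open>z\<close> itself.\<close>

lemma card_nbrs_same_type:
  assumes x: "x \<in> V" "y \<in> V" "isl x = isl y"
  shows "card (nbrs x) = card (nbrs y)"
proof (cases "x = y")
  case False
  obtain z where z: "adj x z" "adj y z" by (rule join[OF x])
  obtain w where w: "adj z w" "w \<noteq> x" "w \<noteq> y" by (rule third_neighbour[OF adj_V(2)[OF z(1)]])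
  obtain l where l: "adj w l" "l \<noteq> z" by (rule third_neighbour[OF adj_V(2)[OF w(1)]])
  have "\<not> adj l x" using unique_join[of x z w l] z w l adj_sym by blast
  moreover have "\<not> adj l y" using unique_join[of y z w l] z w l adj_sym by blast
  moreover have "isl l \<noteq> isl x" "isl l \<noteq> isl y"
    using adj_isl[OF z(1)] adj_isl[OF w(1)] adj_isl[OF l(1)] x(3) by auto
  ultimately show ?thesis
    using perspectivity[of l x] perspectivity[of l y] x adj_V(2)[OF l(1)] by simp
qed simp

text \<open>Each member of \<open>N\<close> is joined to \<open>a\<close> by exactly one neighbour
  of \<open>a\<close>, so the pencil at \<open>a\<close> partitions \<open>N\<close>.\<close>

lemma card_by_pencil:
  assumes a: "a \<in> V" "a \<notin> N" and N: "finite N" "\<And>x. x \<in> N \<Longrightarrow> x \<in> V \<and> isl x = isl a"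
    and fin: "finite (nbrs a)"
  shows "card N = (\<Sum>l\<in>nbrs a. card (N \<inter> nbrs l))"
proof -
  have "N = (\<Union>l\<in>nbrs a. N \<inter> nbrs l)"
  proof safe
    fix x assume x: "x \<in> N"
    then obtain l where "adj a l" "adj x l" using join[of a x] a N by metis
    then show "x \<in> (\<Union>l\<in>nbrs a. N \<inter> nbrs l)" using x adj_sym by blast
  qed
  then have "card N = card (\<Union>l\<in>nbrs a. N \<inter> nbrs l)" by simp
  also have "\<dots> = (\<Sum>l\<in>nbrs a. card (N \<inter> nbrs l))"
  proof (rule card_UN_disjoint[OF fin])
    show "\<forall>l\<in>nbrs a. \<forall>m\<in>nbrs a. l \<noteq> m \<longrightarrow> (N \<inter> nbrs l) \<inter> (N \<inter> nbrs m) = {}"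
      using unique_join[of a] a adj_sym by blast
  qed (use N in auto)
  finally show ?thesis .
qed

end

section \<open>Absolute elements of a duality\<close>

locale plane_duality = thick_plane +
  fixes \<theta> :: "'a + 'b \<Rightarrow> 'a + 'b"
  assumes dual: "duality \<Gamma> \<theta>"
begin

lemma aut: "automorphism \<Gamma> \<theta>" and inter: "interchanges_types \<Gamma> \<theta>"
  using dual unfolding duality_def by auto

lemmas theta_V = automorphism_elements[OF aut]
lemmas theta_inj = automorphism_inj[OF aut]
lemmas theta_surj = automorphism_surj[OF aut]
lemmas theta_isl = interchanges_types_isl[OF inter]

lemma theta_adj: "x \<in> V \<Longrightarrow> y \<in> V \<Longrightarrow> adj (\<theta> x) (\<theta> y) \<longleftrightarrow> adj x y"
  by (rule automorphism_incident[OF aut])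

lemma theta_adjI: "adj x y \<Longrightarrow> adj (\<theta> x) (\<theta> y)"
  using theta_adj adj_V by blast

definition absolute :: "'a + 'b \<Rightarrow> bool" where
  "absolute x \<longleftrightarrow> adj x (\<theta> x)"

lemma absolute_theta: "x \<in> V \<Longrightarrow> absolute (\<theta> x) \<longleftrightarrow> absolute x"
  unfolding absolute_def using theta_adj theta_V by blast

lemma opposite_theta: "x \<in> V \<Longrightarrow> opposite 3 \<Gamma> x (\<theta> x) \<longleftrightarrow> \<not> absolute x"
  unfolding absolute_def using opposite_iff[of x "\<theta> x"] theta_V theta_isl by blast

text \<open>As 3 is odd, opposition of chambers compares the point of one with the line of the
  other, and \<open>\<theta>\<close> interchanges the types. So a flag goes to an opposite one
  exactly if both its members are opposite their own images.\<close>

lemma domestic_iff: "domestic 3 \<Gamma> \<theta> \<longleftrightarrow> (\<forall>x y. adj x y \<longrightarrow> absolute x \<or> absolute y)"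
proof
  assume dom: "domestic 3 \<Gamma> \<theta>"
  have *: "absolute (Inl p) \<or> absolute (Inr l)" if pl: "adj (Inl p) (Inr l)" for p l
  proof (rule ccontr)
    assume neg: "\<not> ?thesis"
    note e = adj_V[OF pl]
    obtain m where m: "\<theta> (Inl p) = Inr m" using theta_isl[OF e(1)] by (cases "\<theta> (Inl p)") auto
    obtain q where q: "\<theta> (Inr l) = Inl q" using theta_isl[OF e(2)] by (cases "\<theta> (Inr l)") auto
    have "opposite 3 \<Gamma> (Inl q) (Inr l)" "opposite 3 \<Gamma> (Inr m) (Inl p)"
      using opposite_theta[OF e(1)] opposite_theta[OF e(2)] neg m q elem_dist_commute
      unfolding opposite_def by metis+
    then have "opposite_chambers 3 \<Gamma> {Inl p, Inr l} (\<theta> ` {Inl p, Inr l})"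
      unfolding opposite_chambers_def using m q
      by (intro exI[of _ p] exI[of _ l] exI[of _ q] exI[of _ m]) auto
    then show False using dom chamber_incident[OF plane pl] unfolding domestic_def by blast
  qed
  show "\<forall>x y. adj x y \<longrightarrow> absolute x \<or> absolute y"
  proof (intro allI impI)
    fix x y assume xy: "adj x y"
    show "absolute x \<or> absolute y"
    proof (cases x)
      case (Inl p)
      then obtain l where "y = Inr l" using adj_isl[OF xy] by (cases y) auto
      then show ?thesis using * xy Inl by blast
    next
      case (Inr l)
      then obtain p where "y = Inl p" using adj_isl[OF xy] by (cases y) auto
      then show ?thesis using *[OF adj_sym] xy Inr by blast
    qed
  qed
next
  assume dom: "\<forall>x y. adj x y \<longrightarrow> absolute x \<or> absolute y"
  show "domestic 3 \<Gamma> \<theta>"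
    unfolding domestic_def
  proof (intro ballI notI)
    fix C assume "C \<in> chambers \<Gamma>" and opp: "opposite_chambers 3 \<Gamma> C (\<theta> ` C)"
    then obtain p l where C: "C = {Inl p, Inr l}" and pl: "adj (Inl p) (Inr l)"
      unfolding chambers_def by auto
    note e = adj_V[OF pl]
    obtain m where m: "\<theta> (Inl p) = Inr m" using theta_isl[OF e(1)] by (cases "\<theta> (Inl p)") auto
    obtain q where q: "\<theta> (Inr l) = Inl q" using theta_isl[OF e(2)] by (cases "\<theta> (Inr l)") auto
    have "opposite 3 \<Gamma> (Inl q) (Inr l) \<and> opposite 3 \<Gamma> (Inr m) (Inl p)"
      using opp m q unfolding opposite_chambers_def C by (auto simp: doubleton_eq_iff)
    then have "\<not> absolute (Inr l)" "\<not> absolute (Inl p)"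
      using opposite_theta[OF e(1)] opposite_theta[OF e(2)] m q elem_dist_commute
      unfolding opposite_def by metis+
    then show False using dom pl by blast
  qed
qed

text \<open>The elements \<open>x\<close>, \<open>M\<close>, \<open>\<theta> M\<close>,
  \<open>\<theta> x\<close> are cyclically incident, and a plane contains no ordinary 2-gon, so two
  of the same type coincide. Hence an absolute \<open>M\<close> has at most two absolute neighbours:
  \<open>\<theta> M\<close> and the preimage of \<open>M\<close>.\<close>

lemma absolute_pair:
  assumes "absolute M" "adj x M" "absolute x"
  shows "x = \<theta> M \<or> \<theta> x = M"
proof (rule ccontr)
  assume neg: "\<not> ?thesis"
  have "adj x (\<theta> x)" "adj M (\<theta> M)" "adj (\<theta> x) (\<theta> M)"
    using assms theta_adjI unfolding absolute_def by auto
  then have "\<theta> x = M" using neg assms(2)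
    by (intro unique_join[of x _ "\<theta> M"]) (auto intro: adj_sym)
  then show False using neg by simp
qed

text \<open>The duality maps the pencil of \<open>x\<close> onto that of \<open>\<theta> x\<close>,
  which has the other type.\<close>

lemma card_nbrs_const:
  assumes "x \<in> V" "y \<in> V"
  shows "card (nbrs x) = card (nbrs y)"
proof (cases "isl x = isl y")
  case True
  then show ?thesis by (rule card_nbrs_same_type[OF assms])
next
  case False
  have "nbrs (\<theta> x) = \<theta> ` nbrs x"
  proof safe
    fix z assume z: "adj (\<theta> x) z"
    then obtain w where "w \<in> V" "\<theta> w = z" using theta_surj adj_V by metis
    then show "z \<in> \<theta> ` nbrs x" using z theta_adj[OF assms(1)] by auto
  qed (rule theta_adjI)
  moreover have "inj_on \<theta> (nbrs x)" by (rule inj_onI) (use theta_inj adj_V in blast)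
  ultimately have "card (nbrs (\<theta> x)) = card (nbrs x)" by (simp add: card_image)
  then show ?thesis
    using card_nbrs_same_type[of "\<theta> x" y] theta_V theta_isl assms False by metis
qed

end

section \<open>Domestic dualities\<close>

lemma neighbours_line: "{y. (Inr l, y) \<in> incidence_graph \<Gamma>} = Inl ` points_on \<Gamma> l"
proof (rule Set.set_eqI)
  fix y show "y \<in> {y. (Inr l, y) \<in> incidence_graph \<Gamma>} \<longleftrightarrow> y \<in> Inl ` points_on \<Gamma> l"
    by (cases y) (auto simp: points_on_def)
qed

lemma neighbours_point: "{y. (Inl p, y) \<in> incidence_graph \<Gamma>} = Inr ` lines_on \<Gamma> p"
proof (rule Set.set_eqI)
  fix y show "y \<in> {y. (Inl p, y) \<in> incidence_graph \<Gamma>} \<longleftrightarrow> y \<in> Inr ` lines_on \<Gamma> p"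
    by (cases y) (auto simp: lines_on_def)
qed

locale domestic_duality = plane_duality +
  assumes dom: "domestic 3 \<Gamma> \<theta>"
begin

lemma domD: "adj x y \<Longrightarrow> \<not> absolute x \<Longrightarrow> absolute y"
  using dom domestic_iff by blast

text \<open>The theorem on odd polygons, for \<open>n = 1\<close>, makes \<open>\<theta>\<close>
  exceptional domestic, which provides a point mapped to an opposite line.\<close>

lemma nonabsolute_exists:
  obtains p where "p \<in> V" "isl p" "\<not> absolute p"
proof -
  obtain x where x: "x \<in> V" using generalised_polygonD(3)[OF plane] by blast
  then have "\<theta> x \<noteq> x" using theta_isl[OF x] by metis
  then have "nontrivial \<Gamma> \<theta>" using x unfolding nontrivial_def by blast
  then have "exceptional_domestic 3 \<Gamma> \<theta>"
    using domestic_automorphism_odd[of 1 \<Gamma> \<theta>] plane thick aut dom by simp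
  then obtain p where "p \<in> Points \<Gamma>" "opposite 3 \<Gamma> (Inl p) (\<theta> (Inl p))"
    unfolding exceptional_domestic_def by blast
  then show ?thesis using that[of "Inl p"] opposite_theta[of "Inl p"] by simp
qed

text \<open>The lines \<open>\<theta> p1\<close>, \<open>\<theta> p2\<close>, \<open>\<theta> p3\<close> pass through \<open>\<theta> M\<close> and consist of absolute points, so they
  would meet another line through \<open>p1\<close> in three absolute points.\<close>

lemma nonabsolute_collinear:
  assumes adj: "adj M p1" "adj M p2" "adj M p3"
    and non: "\<not> absolute p1" "\<not> absolute p2" "\<not> absolute p3"
    and dist: "p1 \<noteq> p2" "p1 \<noteq> p3" "p2 \<noteq> p3"
  shows False
proof -
  let ?k = "\<theta> M"
  have M: "absolute M" "M \<in> V" using domD adj_sym adj_V adj non by blast+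
  then have k: "adj M ?k" "absolute ?k" using absolute_theta unfolding absolute_def by auto
  obtain K where K: "adj p1 K" "K \<noteq> M" using third_neighbour[OF adj_V(2)[OF adj(1)]] by metis
  have KV: "absolute K" "K \<in> V" "isl K = isl M" using domD[OF K(1) non(1)] adj_V[OF K(1)]
      adj_isl[OF K(1)] adj_isl[OF adj(1)] by auto
  have ex: "\<exists>y. adj K y \<and> adj (\<theta> p) y" if "adj M p" for p
  proof -
    have "p \<in> V" "isl (\<theta> p) = isl K" using adj_V[OF that] theta_isl adj_isl[OF that] KV(3) by auto
    then show ?thesis using join[of K "\<theta> p"] KV theta_V by metis
  qed
  obtain y1 y2 y3 where y: "adj K y1" "adj (\<theta> p1) y1" "adj K y2" "adj (\<theta> p2) y2"
      "adj K y3" "adj (\<theta> p3) y3"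
    using ex adj by metis
  \<comment> \<open>\<open>\<theta> p\<close> and \<open>\<theta> q\<close> meet only in
    \<open>\<theta> M\<close>. If that were on \<open>K\<close>, it would be the common point
    \<open>p1\<close> of \<open>K\<close> and \<open>M\<close>; but \<open>\<theta> M\<close> is
    absolute.\<close>
  have neq: "u \<noteq> v" if uv: "adj M p" "adj M q" "p \<noteq> q" "adj K u" "adj (\<theta> p) u" "adj (\<theta> q) v" for p q u v
  proof
    assume "u = v"
    have "\<theta> p \<noteq> \<theta> q" using theta_inj adj_V uv by blast
    moreover have "adj (\<theta> p) ?k" "adj (\<theta> q) ?k" using theta_adjI[OF adj_sym] uv by auto
    ultimately have "u = ?k" using unique_join[of "\<theta> p" u "\<theta> q" ?k] uv \<open>u = v\<close> by blast
    then have "?k = p1" using unique_join[of K ?k M p1] uv k K adj adj_sym by blast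
    then show False using k non by simp
  qed
  \<comment> \<open>A point of \<open>\<theta> p\<close> is absolute by domesticity, so on
    \<open>K\<close> it is \<open>\<theta> K\<close> or the preimage of \<open>K\<close>: two places
    for three different points.\<close>
  have pair: "u = \<theta> K \<or> \<theta> u = K" if "adj K u" "adj (\<theta> p) u" "\<not> absolute p" "p \<in> V" for u p
    using absolute_pair[OF KV(1) adj_sym[OF that(1)]] domD[OF that(2)] absolute_theta that by blast
  have "y1 \<noteq> y2" "y1 \<noteq> y3" "y2 \<noteq> y3" using neq adj dist y by blast+
  moreover have "y1 = \<theta> K \<or> \<theta> y1 = K" "y2 = \<theta> K \<or> \<theta> y2 = K" "y3 = \<theta> K \<or> \<theta> y3 = K"
    using pair y non adj_V(2)[OF adj(1)] adj_V(2)[OF adj(2)] adj_V(2)[OF adj(3)] by blast+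
  moreover have "y1 \<in> V" "y2 \<in> V" "y3 \<in> V" using y adj_V by blast+
  ultimately show False using theta_inj by metis
qed

lemma absolute_on_nonabsolute_pencil:
  assumes "adj M p" "\<not> absolute p"
  obtains b where "{y \<in> nbrs M. absolute y} \<subseteq> {\<theta> M, b}"
proof -
  have M: "absolute M" "M \<in> V" using domD[OF adj_sym] adj_V assms by blast+
  obtain b where b: "b \<in> V" "\<theta> b = M" by (rule theta_surj[OF M(2)])
  have "{y \<in> nbrs M. absolute y} \<subseteq> {\<theta> M, b}"
    using absolute_pair[OF M(1) adj_sym] theta_inj[OF _ b(1)] b(2) adj_V by blast
  then show ?thesis by (rule that)
qed

text \<open>\<open>q\<close> is \<open>p\<close> itself if there is no second non-absolute
  neighbour.\<close>

lemma nonabsolute_on_line: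
  assumes "adj M p" "\<not> absolute p"
  obtains q where "{y \<in> nbrs M. \<not> absolute y} = {p, q}"
proof (cases "\<exists>q. adj M q \<and> \<not> absolute q \<and> q \<noteq> p")
  case True
  then obtain q where "adj M q" "\<not> absolute q" "q \<noteq> p" by blast
  then have "{y \<in> nbrs M. \<not> absolute y} = {p, q}" using nonabsolute_collinear assms by blast
  then show ?thesis by (rule that)
next
  case False
  then have "{y \<in> nbrs M. \<not> absolute y} = {p, p}" using assms by blast
  then show ?thesis by (rule that)
qed

section \<open>The order of a plane with a domestic duality\<close>

lemma three_le_card_nbrs:
  assumes "x \<in> V" "finite (nbrs x)"
  shows "3 \<le> card (nbrs x)"
proof -
  obtain a where a: "adj x a" by (rule third_neighbour[OF assms(1)])
  obtain b where b: "adj x b" "b \<noteq> a" by (rule third_neighbour[OF assms(1)])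
  obtain c where c: "adj x c" "c \<noteq> a" "c \<noteq> b" by (rule third_neighbour[OF assms(1)])
  have "card {a, b, c} = 3" using b c by simp
  moreover have "{a, b, c} \<subseteq> nbrs x" using a b c by blast
  ultimately show ?thesis using card_mono[OF assms(2)] by metis
qed

text \<open>This excludes infinite planes, and finiteness is what gives the equation between
  cardinalities its meaning.\<close>

lemma finite_nbrs_nonabsolute:
  assumes "adj M p" "\<not> absolute p"
  shows "finite (nbrs M)"
    and "card (nbrs M) = card {y \<in> nbrs M. absolute y} + card {y \<in> nbrs M. \<not> absolute y}"
    and "card {y \<in> nbrs M. absolute y} \<le> 2"
    and "card {y \<in> nbrs M. \<not> absolute y} \<le> 2"
proof -
  let ?A = "{y \<in> nbrs M. absolute y}" and ?B = "{y \<in> nbrs M. \<not> absolute y}"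
  have pair: "finite X \<and> card X \<le> 2" if "X \<subseteq> {u, v}" for X and u v :: "'a + 'b"
  proof -
    have "card X \<le> card {u, v}" by (rule card_mono[OF _ that]) simp
    also have "\<dots> \<le> 2" by (simp add: card_insert_if)
    finally show ?thesis using finite_subset[OF that] by simp
  qed
  obtain b where "?A \<subseteq> {\<theta> M, b}" by (rule absolute_on_nonabsolute_pencil[OF assms])
  then have A: "finite ?A \<and> card ?A \<le> 2" by (rule pair)
  obtain q where "?B = {p, q}" by (rule nonabsolute_on_line[OF assms])
  then have "?B \<subseteq> {p, q}" by (rule equalityD1)
  then have B: "finite ?B \<and> card ?B \<le> 2" by (rule pair)
  have AB: "nbrs M = ?A \<union> ?B" by blast
  have "finite (?A \<union> ?B)" using A B by (intro finite_UnI) simp_all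
  then show "finite (nbrs M)" unfolding AB[symmetric] .
  have "card (?A \<union> ?B) = card ?A + card ?B"
    by (rule card_Un_disjoint) (use A B in simp_all, blast)
  then show "card (nbrs M) = card ?A + card ?B" unfolding AB[symmetric] .
  show "card ?A \<le> 2" "card ?B \<le> 2" using A B by auto
qed

text \<open>In a plane of order 3 the non-absolute points would be five points meeting every line in
  none or two points, and counting them along the lines through an absolute point gives an even number.\<close>

lemma card_nbrs_ne_4:
  assumes p: "p \<in> V" "\<not> absolute p" and four: "\<And>x. x \<in> V \<Longrightarrow> card (nbrs x) = 4"
  shows False
proof -
  define N where "N = {x \<in> V. isl x = isl p \<and> \<not> absolute x}"
  have fin: "finite (nbrs x)" if "x \<in> V" for x using four[OF that] card.infinite by fastforce
  \<comment> \<open>The four neighbours of \<open>M\<close> are at most two absolute and at most two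
    non-absolute ones, so both bounds are attained.\<close>
  have line: "card (N \<inter> nbrs M) = 2" if M: "adj M q" "q \<in> N" for M q
  proof -
    have q: "\<not> absolute q" "isl q = isl p" using M unfolding N_def by auto
    have "N \<inter> nbrs M = {y \<in> nbrs M. \<not> absolute y}"
      unfolding N_def using adj_V adj_isl M(1) q by blast
    then show ?thesis
      using finite_nbrs_nonabsolute[OF M(1) q(1)] four[OF adj_V(1)[OF M(1)]] by simp
  qed
  have pN: "p \<in> N" unfolding N_def using p by simp
  have "N \<subseteq> (\<Union>M\<in>nbrs p. nbrs M)"
  proof
    fix x assume "x \<in> N"
    then obtain M where "adj p M" "adj x M" using join[of p x] p unfolding N_def by auto
    then show "x \<in> (\<Union>M\<in>nbrs p. nbrs M)" using adj_sym by blast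
  qed
  moreover have "finite (\<Union>M\<in>nbrs p. nbrs M)" using fin p adj_V by blast
  ultimately have finN: "finite N" by (rule finite_subset)
  have "card (N - {p}) = (\<Sum>M\<in>nbrs p. card ((N - {p}) \<inter> nbrs M))"
    by (rule card_by_pencil) (use p finN fin N_def in auto)
  also have "\<dots> = (\<Sum>M\<in>nbrs p. 1)"
  proof (rule sum.cong[OF refl])
    fix M assume "M \<in> nbrs p"
    then have M: "adj M p" using adj_sym by blast
    have "(N - {p}) \<inter> nbrs M = (N \<inter> nbrs M) - {p}" by blast
    then show "card ((N - {p}) \<inter> nbrs M) = 1" using line[OF M pN] M pN by simp
  qed
  also have "\<dots> = 4" using four[OF p(1)] by simp
  finally have N5: "card N = 5" using finN pN by simp
  obtain M where M: "adj p M" by (rule third_neighbour[OF p(1)])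
  let ?a = "\<theta> M"
  have MV: "M \<in> V" "absolute M" using adj_V[OF M] domD[OF M p(2)] by auto
  have a: "?a \<in> V" "absolute ?a" "isl ?a = isl p"
    using MV theta_V absolute_theta theta_isl adj_isl[OF M] by auto
  have "card N = (\<Sum>l\<in>nbrs ?a. card (N \<inter> nbrs l))"
    by (rule card_by_pencil) (use a finN fin N_def in auto)
  moreover have "even (\<Sum>l\<in>nbrs ?a. card (N \<inter> nbrs l))"
  proof (rule dvd_sum)
    fix l assume "l \<in> nbrs ?a"
    show "even (card (N \<inter> nbrs l))"
    proof (cases "N \<inter> nbrs l = {}")
      case False
      then show ?thesis using line by fastforce
    qed simp
  qed
  ultimately show False using N5 by simp
qed

lemma card_nbrs: "x \<in> V \<Longrightarrow> card (nbrs x) = 3"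
proof -
  obtain p where p: "p \<in> V" "isl p" "\<not> absolute p" by (rule nonabsolute_exists)
  obtain M where M: "adj p M" by (rule third_neighbour[OF p(1)])
  note fin = finite_nbrs_nonabsolute[OF adj_sym[OF M] p(3)]
  have MV: "M \<in> V" by (rule adj_V(2)[OF M])
  have const: "card (nbrs x) = card (nbrs M)" if "x \<in> V" for x by (rule card_nbrs_const[OF that MV])
  have "card (nbrs M) \<noteq> 4"
  proof
    assume "card (nbrs M) = 4"
    then have "card (nbrs x) = 4" if "x \<in> V" for x using const[OF that] by simp
    then show False by (rule card_nbrs_ne_4[OF p(1,3)])
  qed
  then have "card (nbrs M) = 3" using fin three_le_card_nbrs[OF MV fin(1)] by linarith
  then show "x \<in> V \<Longrightarrow> card (nbrs x) = 3" using const by simp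
qed

lemma fano: "fano_plane \<Gamma>"
proof -
  have "card (points_on \<Gamma> l) = card (nbrs (Inr l))" for l
    by (simp add: neighbours_line card_image)
  moreover have "card (lines_on \<Gamma> p) = card (nbrs (Inl p))" for p
    by (simp add: neighbours_point card_image)
  ultimately show ?thesis unfolding fano_plane_def using plane card_nbrs by simp
qed

end

lemma domestic_plane_fano:
  assumes "projective_plane \<Gamma>" "thick \<Gamma>" "automorphism \<Gamma> \<theta>" "nontrivial \<Gamma> \<theta>" "domestic 3 \<Gamma> \<theta>"
  shows "fano_plane \<Gamma>"
proof -
  have "duality \<Gamma> \<theta>" using domestic_automorphism_odd[of 1 \<Gamma> \<theta>] assms by simp
  then interpret domestic_duality \<Gamma> \<theta> using assms by unfold_locales
  show ?thesis by (rule fano)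
qed

section \<open>Coordinates on the Fano plane\<close>

text \<open>The Fano plane from the difference set \<open>{0, 1, 3}\<close> modulo 7. With \<open>i + j\<close> in place of
  \<open>i - j\<close> the incidence is symmetric, so that points and lines may be exchanged.\<close>

definition fano_labelling :: "('p, 'l) geometry \<Rightarrow> (nat \<Rightarrow> 'p) \<Rightarrow> (nat \<Rightarrow> 'l) \<Rightarrow> bool" where
  "fano_labelling F f g \<longleftrightarrow> bij_betw f {..<7} (Points F) \<and> bij_betw g {..<7} (Lines F) \<and>
     (\<forall>i<7. \<forall>j<7. (f i, g j) \<in> Inc F \<longleftrightarrow> (i + j) mod 7 \<in> {0, 1, 3})"

lemma less_7_cases: "i < 7 \<longleftrightarrow> i = 0 \<or> i = 1 \<or> i = 2 \<or> i = 3 \<or> i = 4 \<or> i = 5 \<or> i = (6::nat)"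
  by linarith

lemma all_less_7: "(\<forall>i<7. P i) \<longleftrightarrow> P 0 \<and> P 1 \<and> P 2 \<and> P 3 \<and> P 4 \<and> P 5 \<and> P (6::nat)"
  unfolding less_7_cases by blast

text \<open>The incidences with the points 0 to 3 already distinguish the seven translates of the
  difference set. This later shows that the seven lines found are different.\<close>

lemma fano_column_inj:
  assumes "i < 7" "j < (7::nat)"
    and eq: "\<And>k. k < 7 \<Longrightarrow> (k + i) mod 7 \<in> {0, 1, 3::nat} \<longleftrightarrow> (k + j) mod 7 \<in> {0, 1, 3}"
  shows "i = j"
  using assms(1,2) eq[of 0] eq[of 1] eq[of 2] eq[of 3] unfolding less_7_cases
  by (elim disjE; simp)

lemma card3_third:
  assumes "card A = 3" "x \<in> A" "y \<in> A" "x \<noteq> y"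
  obtains z where "A = {x, y, z}" "z \<noteq> x" "z \<noteq> y"
proof -
  have "finite A" using assms(1) card.infinite by fastforce
  then have "card (A - {x, y}) = 1" using assms by (simp add: card_Diff_subset)
  then obtain z where z: "A - {x, y} = {z}" using card_1_singletonE by metis
  then have "A = {x, y, z}" "z \<noteq> x" "z \<noteq> y" using assms(2,3) by blast+
  then show ?thesis by (rule that)
qed

lemma card3_eq:
  assumes "card A = 3" "x \<in> A" "y \<in> A" "z \<in> A" "x \<noteq> y" "x \<noteq> z" "y \<noteq> z"
  shows "A = {x, y, z}"
  by (rule card3_third[OF assms(1-3,5)]) (use assms in auto)

lemma fano_thick: "fano_plane F \<Longrightarrow> thick F"
  unfolding fano_plane_def thick_def by blast

lemma fano_thick_plane: "fano_plane F \<Longrightarrow> thick_plane F"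
  using fano_thick unfolding fano_plane_def thick_plane_def by blast

lemma fano_labelling_triangle:
  assumes fano: "fano_plane F" and abc: "a \<in> Points F" "b \<in> Points F" "c \<in> Points F" "a \<noteq> b"
    and triangle: "\<And>l. (a, l) \<in> Inc F \<Longrightarrow> (b, l) \<in> Inc F \<Longrightarrow> (c, l) \<notin> Inc F"
  shows "\<exists>f g. fano_labelling F f g \<and> f 0 = a \<and> f 1 = b \<and> f 2 = c"
proof -
  interpret thick_plane F by (rule fano_thick_plane[OF fano])
  have V: "p \<in> Points F" "l \<in> Lines F" if "(p, l) \<in> Inc F" for p l
    using adj_V[of "Inl p" "Inr l"] that by auto
  have J: "\<exists>l. (p, l) \<in> Inc F \<and> (q, l) \<in> Inc F" if pq: "p \<in> Points F" "q \<in> Points F" for p q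
  proof -
    obtain z where z: "adj (Inl p) z" "adj (Inl q) z" using join[of "Inl p" "Inl q"] pq by auto
    then show ?thesis by (cases z) auto
  qed
  have M: "\<exists>p. (p, l) \<in> Inc F \<and> (p, m) \<in> Inc F" if lm: "l \<in> Lines F" "m \<in> Lines F" for l m
  proof -
    obtain z where z: "adj (Inr l) z" "adj (Inr m) z" using join[of "Inr l" "Inr m"] lm by auto
    then show ?thesis by (cases z) auto
  qed
  have U: "l = m" if "(p, l) \<in> Inc F" "(q, l) \<in> Inc F" "(p, m) \<in> Inc F" "(q, m) \<in> Inc F" "p \<noteq> q" for p q l m
    using unique_join[of "Inl p" "Inr l" "Inl q" "Inr m"] that by simp
  have c3: "\<exists>r. points_on F l = {p, q, r} \<and> r \<noteq> p \<and> r \<noteq> q" if "(p, l) \<in> Inc F" "(q, l) \<in> Inc F" "p \<noteq> q" for p q l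
  proof -
    have "card (points_on F l) = 3" using fano V(2)[OF that(1)] unfolding fano_plane_def by blast
    then show ?thesis using that unfolding points_on_def by (metis card3_third mem_Collect_eq)
  qed
  have on: "(p, l) \<in> Inc F \<longleftrightarrow> p \<in> points_on F l" for p l unfolding points_on_def by simp
  obtain l0 where l0: "(a, l0) \<in> Inc F" "(b, l0) \<in> Inc F" using J abc by blast
  obtain l1 where l1: "(a, l1) \<in> Inc F" "(c, l1) \<in> Inc F" using J abc by blast
  obtain l6 where l6: "(b, l6) \<in> Inc F" "(c, l6) \<in> Inc F" using J abc by blast
  have ac: "a \<noteq> c" and bc: "b \<noteq> c" and nc: "(c, l0) \<notin> Inc F" using triangle l0 by blast+
  obtain p3 where p3: "points_on F l0 = {a, b, p3}" "p3 \<noteq> a" "p3 \<noteq> b" using c3[OF l0 abc(4)] by blast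
  obtain p6 where p6: "points_on F l1 = {a, c, p6}" "p6 \<noteq> a" "p6 \<noteq> c" using c3[OF l1 ac] by blast
  obtain p4 where p4: "points_on F l6 = {b, c, p4}" "p4 \<noteq> b" "p4 \<noteq> c" using c3[OF l6 bc] by blast
  have na: "(a, l6) \<notin> Inc F" using triangle l6 by blast
  then have ap4: "a \<noteq> p4" using p4 on by blast
  have "p4 \<in> Points F" using V on p4 by blast
  then obtain l3 where l3: "(a, l3) \<in> Inc F" "(p4, l3) \<in> Inc F" using J abc by blast
  obtain p5 where p5: "points_on F l3 = {a, p4, p5}" "p5 \<noteq> a" "p5 \<noteq> p4" using c3[OF l3 ap4] by blast
  have i: "(p3, l0) \<in> Inc F" "(p6, l1) \<in> Inc F" "(p4, l6) \<in> Inc F" "(p5, l3) \<in> Inc F"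
    using on p3 p6 p4 p5 by auto
  have l01: "l0 \<noteq> l1" using l1 nc by blast
  have l03: "l0 \<noteq> l3" using U[of b l0 p4 l6] l0 l3 l6 i p4 na by blast
  have l13: "l1 \<noteq> l3" using U[of c l1 p4 l6] l1 l3 l6 i p4 na by blast
  have cross: "p = a" if "(p, l) \<in> Inc F" "(p, m) \<in> Inc F" "(a, l) \<in> Inc F" "(a, m) \<in> Inc F" "l \<noteq> m" for p l m
    using U that by blast
  have x01: "p \<noteq> q" if "p \<noteq> a" "(p, l0) \<in> Inc F" "(q, l1) \<in> Inc F" for p q
    using cross[of p l0 l1] that l0 l1 l01 by blast
  have x03: "p \<noteq> q" if "p \<noteq> a" "(p, l0) \<in> Inc F" "(q, l3) \<in> Inc F" for p q
    using cross[of p l0 l3] that l0 l3 l03 by blast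
  have x13: "p \<noteq> q" if "p \<noteq> a" "(p, l1) \<in> Inc F" "(q, l3) \<in> Inc F" for p q
    using cross[of p l1 l3] that l1 l3 l13 by blast
  have dist: "a \<noteq> b" "a \<noteq> c" "a \<noteq> p3" "a \<noteq> p4" "a \<noteq> p5" "a \<noteq> p6" "b \<noteq> c" "b \<noteq> p3" "b \<noteq> p4"
      "b \<noteq> p5" "b \<noteq> p6" "c \<noteq> p3" "c \<noteq> p4" "c \<noteq> p5" "c \<noteq> p6" "p3 \<noteq> p4" "p3 \<noteq> p5" "p3 \<noteq> p6"
      "p4 \<noteq> p5" "p4 \<noteq> p6" "p5 \<noteq> p6"
    using abc ac bc p3 p4 p5 p6 ap4 x01[of b p6] x01[of p3 c] x01[of p3 p6] x03[of b p5]
      x03[of p3 p4] x03[of p3 p5] x13[of c p5] x13[of p6 p4] x13[of p6 p5] l0 l1 l3 i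
    by metis+
  have pV: "p3 \<in> Points F" "p4 \<in> Points F" "p5 \<in> Points F" "p6 \<in> Points F" using V(1) i by blast+
  \<comment> \<open>Every point is joined to \<open>a\<close>, so the three lines through
    \<open>a\<close> cover the plane.\<close>
  have PF: "p \<in> {a, b, c, p3, p4, p5, p6}" if p: "p \<in> Points F" for p
  proof -
    have "card (lines_on F a) = 3" using fano abc unfolding fano_plane_def by blast
    then have la: "lines_on F a = {l0, l1, l3}"
      by (rule card3_eq) (use l0 l1 l3 l01 l03 l13 in \<open>auto simp: lines_on_def\<close>)
    obtain l where l: "(a, l) \<in> Inc F" "(p, l) \<in> Inc F" using J abc p by blast
    then have "l \<in> lines_on F a" unfolding lines_on_def by simp
    then have "p \<in> points_on F l0 \<or> p \<in> points_on F l1 \<or> p \<in> points_on F l3"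
      using l(2) unfolding la points_on_def by auto
    then show ?thesis unfolding p3 p5 p6 by auto
  qed
  obtain l2 where l2: "(b, l2) \<in> Inc F" "(p6, l2) \<in> Inc F" using J abc pV by blast
  obtain l5 where l5: "(c, l5) \<in> Inc F" "(p3, l5) \<in> Inc F" using J abc pV by blast
  obtain l4 where l4: "(p3, l4) \<in> Inc F" "(p6, l4) \<in> Inc F" using J pV by blast
  \<comment> \<open>Each of \<open>l2\<close>, \<open>l4\<close>, \<open>l5\<close> meets
    \<open>l3\<close> but misses two of its three points; the remaining one is the third point of
    that line.\<close>
  have meet3: "(a, l) \<in> Inc F \<or> (p4, l) \<in> Inc F \<or> (p5, l) \<in> Inc F" if lF: "l \<in> Lines F" for l
  proof -
    obtain p where "(p, l) \<in> Inc F" "(p, l3) \<in> Inc F" using M[OF lF V(2)[OF l3(1)]] by blast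
    then show ?thesis unfolding on[of p l3] p5(1) by auto
  qed
  have n2: "(a, l2) \<notin> Inc F" using U[of a l2 b l0] U[of a l2 p6 l1] l0 l1 l2 l01 i dist by blast
  have n5: "(a, l5) \<notin> Inc F" using U[of a l5 c l1] U[of a l5 p3 l0] l0 l1 l5 l01 i dist by blast
  have n4: "(a, l4) \<notin> Inc F" using U[of a l4 p3 l0] U[of a l4 p6 l1] l0 l1 l4 l01 i dist by blast
  have "(p4, l2) \<notin> Inc F" using U[of b l2 p4 l6] U[of c l6 p6 l1] l1 l2 l6 i dist na by blast
  then have i2: "(p5, l2) \<in> Inc F" using meet3[OF V(2)[OF l2(1)]] n2 by blast
  have "(p4, l5) \<notin> Inc F" using U[of c l5 p4 l6] U[of b l6 p3 l0] l0 l5 l6 i dist na by blast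
  then have i5: "(p5, l5) \<in> Inc F" using meet3[OF V(2)[OF l5(1)]] n5 by blast
  have "(p5, l4) \<notin> Inc F" using U[of p6 l4 p5 l2] U[of b l2 p3 l0] l0 l2 l4 i i2 dist n2 by blast
  then have i4: "(p4, l4) \<in> Inc F" using meet3[OF V(2)[OF l4(1)]] n4 by blast
  have pts: "points_on F l = {p, q, r}"
    if "(p, l) \<in> Inc F" "(q, l) \<in> Inc F" "(r, l) \<in> Inc F" "p \<noteq> q" "p \<noteq> r" "q \<noteq> r" for l p q r
  proof (rule card3_eq)
    show "card (points_on F l) = 3" using fano V(2)[OF that(1)] unfolding fano_plane_def by blast
  qed (use that on in auto)
  have P: "points_on F l2 = {b, p5, p6}" "points_on F l4 = {p3, p4, p6}" "points_on F l5 = {c, p3, p5}"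
    using pts l2 l4 l5 i2 i4 i5 dist by blast+
  let ?f = "(!) [a, b, c, p3, p4, p5, p6]" and ?g = "(!) [l0, l1, l2, l3, l4, l5, l6]"
  have inc: "\<forall>i<7. \<forall>j<7. (?f i, ?g j) \<in> Inc F \<longleftrightarrow> (i + j) mod 7 \<in> {0, 1, 3}"
  proof (intro allI impI)
    fix i j :: nat assume "i < 7" "j < 7"
    then show "(?f i, ?g j) \<in> Inc F \<longleftrightarrow> (i + j) mod 7 \<in> {0, 1, 3}"
      unfolding less_7_cases on
      by (elim disjE; simp add: P p3(1) p4(1) p5(1) p6(1) dist dist[symmetric])
  qed
  have "inj_on ?f {..<7}"
    using dist by (intro inj_on_nth) auto
  moreover have "?f ` {..<7} = set [a, b, c, p3, p4, p5, p6]"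
    using nth_image[of 7 "[a, b, c, p3, p4, p5, p6]"] by (simp add: atLeast0LessThan)
  ultimately have f: "bij_betw ?f {..<7} (Points F)"
    using PF abc pV unfolding bij_betw_def by auto
  have ginj: "inj_on ?g {..<7}"
  proof (rule inj_onI)
    fix i j assume ij: "i \<in> {..<7}" "j \<in> {..<7}" and eq: "?g i = ?g j"
    have "(k + i) mod 7 \<in> {0, 1, 3} \<longleftrightarrow> (k + j) mod 7 \<in> {0, 1, 3}" if "k < 7" for k
      using inc[rule_format, OF that] ij eq by (metis lessThan_iff)
    then show "i = j" using ij by (intro fano_column_inj) auto
  qed
  have dl: "distinct [l0, l1, l2, l3, l4, l5, l6]"
    unfolding distinct_conv_nth
  proof (intro allI impI)
    fix i j
    assume "i < length [l0, l1, l2, l3, l4, l5, l6]" "j < length [l0, l1, l2, l3, l4, l5, l6]" "i \<noteq> j"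
    then have "i \<in> {..<7}" "j \<in> {..<7}" "i \<noteq> j" by simp_all
    then show "?g i \<noteq> ?g j" using ginj unfolding inj_on_def by blast
  qed
  have lines: "lines_on F p = {l, m, n}"
    if "(p, l) \<in> Inc F" "(p, m) \<in> Inc F" "(p, n) \<in> Inc F" "l \<noteq> m" "l \<noteq> n" "m \<noteq> n" for l m n p
  proof (rule card3_eq)
    show "card (lines_on F p) = 3" using fano V(1)[OF that(1)] unfolding fano_plane_def by blast
  qed (use that in \<open>auto simp: lines_on_def\<close>)
  \<comment> \<open>Every line meets \<open>l0\<close>, so the pencils at the three points of
    \<open>l0\<close> contain all lines.\<close>
  have L: "lines_on F a = {l0, l1, l3}" "lines_on F b = {l0, l2, l6}" "lines_on F p3 = {l0, l4, l5}"
    by (rule lines; use l0 l1 l2 l3 l4 l5 l6 i dl in auto)+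
  have "l \<in> {l0, l1, l2, l3, l4, l5, l6}" if lF: "l \<in> Lines F" for l
  proof -
    obtain p where "(p, l) \<in> Inc F" "(p, l0) \<in> Inc F" using M[OF lF V(2)[OF l0(1)]] by blast
    then have "l \<in> lines_on F a \<or> l \<in> lines_on F b \<or> l \<in> lines_on F p3"
      unfolding on[of p l0] p3(1) lines_on_def by auto
    then show ?thesis unfolding L by auto
  qed
  moreover have "?g ` {..<7} = set [l0, l1, l2, l3, l4, l5, l6]"
    using nth_image[of 7 "[l0, l1, l2, l3, l4, l5, l6]"] by (simp add: atLeast0LessThan)
  moreover have "set [l0, l1, l2, l3, l4, l5, l6] \<subseteq> Lines F" using V(2) l0 l1 l2 l3 l4 l5 l6 by simp
  ultimately have "bij_betw ?g {..<7} (Lines F)"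
    using ginj unfolding bij_betw_def by auto
  then have "fano_labelling F ?f ?g" using f inc unfolding fano_labelling_def by blast
  then show ?thesis by (intro exI[of _ ?f] exI[of _ ?g]) simp
qed

lemma fano_labellingD:
  assumes "fano_labelling F f g"
  shows "bij_betw f {..<7} (Points F)" "bij_betw g {..<7} (Lines F)"
    and "i < 7 \<Longrightarrow> j < 7 \<Longrightarrow> (f i, g j) \<in> Inc F \<longleftrightarrow> (i + j) mod 7 \<in> {0, 1, 3}"
  using assms unfolding fano_labelling_def by auto

lemma fano_labelling_mem:
  assumes "fano_labelling F f g" "i < 7"
  shows "f i \<in> Points F" "g i \<in> Lines F"
  using bij_betwE fano_labellingD[OF assms(1)] assms(2) by blast+

lemma fano_labelling_eq:
  assumes "fano_labelling F f g" "i < 7" "j < 7"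
  shows "f i = f j \<longleftrightarrow> i = j" "g i = g j \<longleftrightarrow> i = j"
  using fano_labellingD(1,2)[OF assms(1)] assms(2,3) unfolding bij_betw_def inj_on_def by blast+

lemma fano_labelling_cases:
  assumes "fano_labelling F f g" "x \<in> elements F"
  obtains i where "i < 7" "x = Inl (f i)" | i where "i < 7" "x = Inr (g i)"
proof -
  have "Points F = f ` {..<7}" "Lines F = g ` {..<7}"
    using fano_labellingD(1,2)[OF assms(1)] unfolding bij_betw_def by auto
  then have "x \<in> Inl ` f ` {..<7} \<union> Inr ` g ` {..<7}" using assms(2) unfolding elements_def by simp
  then show ?thesis using that by auto
qed

lemma fano_labelling_exists:
  assumes fano: "fano_plane F"
  obtains f g where "fano_labelling F f g"
proof -
  interpret thick_plane F by (rule fano_thick_plane[OF fano])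
  obtain x where "x \<in> V" using generalised_polygonD(3)[OF plane] by blast
  moreover obtain y where "adj x y" by (rule third_neighbour[OF \<open>x \<in> V\<close>])
  ultimately obtain x where x: "x \<in> V" "isl x" using adj_isl adj_V by metis
  obtain M where M: "adj x M" by (rule third_neighbour[OF x(1)])
  obtain y where y: "adj M y" "y \<noteq> x" by (rule third_neighbour[OF adj_V(2)[OF M]])
  obtain K where K: "adj x K" "K \<noteq> M" by (rule third_neighbour[OF x(1)])
  obtain z where z: "adj K z" "z \<noteq> x" by (rule third_neighbour[OF adj_V(2)[OF K(1)]])
  have "isl y" "isl z" using x adj_isl[OF M] adj_isl[OF y(1)] adj_isl[OF K(1)] adj_isl[OF z(1)] by auto
  then obtain a b c where abc: "x = Inl a" "y = Inl b" "z = Inl c" using x by (metis isl_def)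
  have "\<exists>f g. fano_labelling F f g \<and> f 0 = a \<and> f 1 = b \<and> f 2 = c"
  proof (rule fano_labelling_triangle[OF fano])
    show "a \<in> Points F" "b \<in> Points F" "c \<in> Points F"
      using x(1) adj_V(2)[OF y(1)] adj_V(2)[OF z(1)] abc by auto
    show "a \<noteq> b" using y abc by simp
    fix l assume l: "(a, l) \<in> Inc F" "(b, l) \<in> Inc F"
    then have "Inr l = M"
      using unique_join[of x "Inr l" y M] abc M y adj_sym by auto
    then show "(c, l) \<notin> Inc F"
      using unique_join[of x M z K] abc M K z adj_sym by auto
  qed
  then show ?thesis using that by blast
qed

lemma fano_unique:
  assumes "fano_plane F" "fano_plane F'"
  shows "isomorphic_geometries F F'"
proof -
  obtain f g where l: "fano_labelling F f g" by (rule fano_labelling_exists[OF assms(1)])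
  obtain f' g' where l': "fano_labelling F' f' g'" by (rule fano_labelling_exists[OF assms(2)])
  let ?f = "f' \<circ> inv_into {..<7} f" and ?g = "g' \<circ> inv_into {..<7} g"
  note D = fano_labellingD[OF l] fano_labellingD[OF l']
  have "bij_betw ?f (Points F) (Points F')" "bij_betw ?g (Lines F) (Lines F')"
    using D bij_betw_inv_into bij_betw_trans by blast+
  moreover have "(p, m) \<in> Inc F \<longleftrightarrow> (?f p, ?g m) \<in> Inc F'" if pm: "p \<in> Points F" "m \<in> Lines F" for p m
  proof -
    obtain i where i: "i < 7" "p = f i" using D(1) pm(1) by (metis bij_betw_iff_bijections lessThan_iff)
    obtain j where j: "j < 7" "m = g j" using D(2) pm(2) by (metis bij_betw_iff_bijections lessThan_iff)
    have "inv_into {..<7} f p = i" "inv_into {..<7} g m = j"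
      using i j D(1,2) by (auto simp: bij_betw_def)
    then show ?thesis using D(3)[OF i(1) j(1)] D(6)[OF i(1) j(1)] i j by simp
  qed
  ultimately show ?thesis unfolding isomorphic_geometries_def by blast
qed

section \<open>The automorphism group\<close>

lemma aut_group_carrier: "carrier (aut_group F) = {\<theta> \<in> Bij (elements F). automorphism F \<theta>}"
  by (simp add: aut_group_def)

lemma aut_group_mult:
  "a \<in> carrier (aut_group F) \<Longrightarrow> b \<in> carrier (aut_group F) \<Longrightarrow>
    a \<otimes>\<^bsub>aut_group F\<^esub> b = compose (elements F) a b"
  by (simp add: aut_group_def BijGroup_def)

lemma aut_group_one: "\<one>\<^bsub>aut_group F\<^esub> = (\<lambda>x\<in>elements F. x)"
  by (simp add: aut_group_def BijGroup_def)

lemma aut_group_eqI: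
  assumes "a \<in> carrier (aut_group F)" "b \<in> carrier (aut_group F)" "\<And>x. x \<in> elements F \<Longrightarrow> a x = b x"
  shows "a = b"
  using assms unfolding aut_group_carrier Bij_def by (auto intro: extensionalityI)

lemma aut_group_pow:
  assumes a: "a \<in> carrier (aut_group F)"
  shows "x \<in> elements F \<Longrightarrow> (a [^]\<^bsub>aut_group F\<^esub> (k::nat)) x = (a ^^ k) x"
proof (induction k arbitrary: x)
  case 0
  then show ?case by (simp add: aut_group_one)
next
  case (Suc k)
  interpret group "aut_group F" by (rule group_aut_group)
  have "a x \<in> elements F"
    using a Suc.prems automorphism_elements unfolding aut_group_carrier by blast
  then show ?case
    using Suc a by (simp add: aut_group_mult compose_def funpow_swap1)
qed

text \<open>Leaving open which of \<open>A\<close> and \<open>B\<close> holds the points covers both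
  relabelling collineations and the canonical duality. For the latter one incidence rule is enough
  because \<open>i + j\<close> is symmetric. The restriction in \<open>\<theta>\<close> makes it a
  member of the group.\<close>

lemma automorphism_by_labels:
  assumes lab: "fano_labelling F f g"
    and u: "bij_betw u {..<7} A" and w: "bij_betw w {..<7} B"
    and AB: "A = Inl ` Points F \<and> B = Inr ` Lines F \<or> A = Inr ` Lines F \<and> B = Inl ` Points F"
    and inc: "\<And>i j. i < 7 \<Longrightarrow> j < 7 \<Longrightarrow> (u i, w j) \<in> incidence_graph F \<longleftrightarrow> (i + j) mod 7 \<in> {0, 1, 3}"
  shows "\<exists>\<theta> \<in> carrier (aut_group F). \<forall>i<7. \<theta> (Inl (f i)) = u i \<and> \<theta> (Inr (g i)) = w i"
proof -
  let ?S = "elements F"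
  note D = fano_labellingD[OF lab] and mem = fano_labelling_mem[OF lab]
  define \<theta> where "\<theta> = restrict (case_sum (u \<circ> inv_into {..<7} f) (w \<circ> inv_into {..<7} g)) ?S"
  have \<theta>: "\<theta> (Inl (f i)) = u i" "\<theta> (Inr (g i)) = w i" if "i < 7" for i
    using that mem[OF that] D(1,2) unfolding \<theta>_def by (auto simp: bij_betw_def)
  have PL: "Points F = f ` {..<7}" "Lines F = g ` {..<7}" using D unfolding bij_betw_def by auto
  have "\<theta> ` Inl ` Points F = u ` {..<7}" unfolding PL image_image using \<theta> by (intro image_cong) auto
  then have imP: "\<theta> ` Inl ` Points F = A" using u unfolding bij_betw_def by simp
  have "\<theta> ` Inr ` Lines F = w ` {..<7}" unfolding PL image_image using \<theta> by (intro image_cong) auto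
  then have imL: "\<theta> ` Inr ` Lines F = B" using w unfolding bij_betw_def by simp
  have types: "preserves_types F \<theta> \<or> interchanges_types F \<theta>"
    using AB imP imL unfolding preserves_types_def interchanges_types_def by auto
  have disj: "A \<inter> B = {}" using AB by auto
  have uA: "u i \<in> A" and wB: "w i \<in> B" if "i < 7" for i using u w that by (auto dest: bij_betwE)
  have "inj_on \<theta> ?S"
  proof (rule inj_onI)
    fix x y assume xy: "x \<in> ?S" "y \<in> ?S" "\<theta> x = \<theta> y"
    have uw: "u i \<noteq> w j" if "i < 7" "j < 7" for i j
      using uA[OF that(1)] wB[OF that(2)] disj by (metis disjoint_iff)
    have wu: "w j \<noteq> u i" if "i < 7" "j < 7" for i j
      using uw[OF that] by metis
    have uu: "i = j" if "i < 7" "j < 7" "u i = u j" for i j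
      using u that unfolding bij_betw_def inj_on_def by blast
    have ww: "i = j" if "i < 7" "j < 7" "w i = w j" for i j
      using w that unfolding bij_betw_def inj_on_def by blast
    show "x = y"
      using xy by (elim fano_labelling_cases[OF lab]) (simp_all add: \<theta> uw wu, auto dest: uu ww)
  qed
  moreover have "\<theta> ` ?S = ?S"
  proof -
    have "\<theta> ` ?S = A \<union> B" unfolding elements_def image_Un imP imL ..
    then show ?thesis using AB unfolding elements_def by auto
  qed
  ultimately have bij: "bij_betw \<theta> ?S ?S" unfolding bij_betw_def by blast
  have same: "(u i, u j) \<notin> incidence_graph F" "(w i, w j) \<notin> incidence_graph F" if ij: "i < 7" "j < 7" for i j
    using AB uA[OF ij(1)] uA[OF ij(2)] wB[OF ij(1)] wB[OF ij(2)] by auto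
  have "(x, y) \<in> incidence_graph F \<longleftrightarrow> (\<theta> x, \<theta> y) \<in> incidence_graph F" if "x \<in> ?S" "y \<in> ?S" for x y
    using that
    by (elim fano_labelling_cases[OF lab])
      (simp_all add: \<theta> same inc D(3) incidence_graph_sym[of "w _" "u _"])
  then have "automorphism F \<theta>" using bij types unfolding automorphism_def by blast
  moreover have "\<theta> \<in> Bij ?S" using bij unfolding Bij_def \<theta>_def by simp
  ultimately show ?thesis using \<theta> unfolding aut_group_carrier by blast
qed

section \<open>The canonical form of a domestic duality\<close>

text \<open>The table below is forced once \<open>f 0 = p\<close> is not absolute, \<open>f 2 = \<theta> (\<theta> p)\<close>, and \<open>f 1\<close>
  is a point of \<open>\<theta> p\<close> not collinear with these two.\<close>

definition canonical_duality ::
    "('p, 'l) geometry \<Rightarrow> (nat \<Rightarrow> 'p) \<Rightarrow> (nat \<Rightarrow> 'l) \<Rightarrow> ('p + 'l \<Rightarrow> 'p + 'l) \<Rightarrow> bool" where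
  "canonical_duality F f g \<theta> \<longleftrightarrow> fano_labelling F f g \<and>
     (\<forall>i<7. \<theta> (Inl (f i)) = Inr (g ([2, 6, 4, 0, 3, 5, 1] ! i)) \<and>
            \<theta> (Inr (g i)) = Inl (f ([1, 6, 2, 5, 0, 3, 4] ! i)))"

lemma canonical_table:
  fixes a b :: "nat \<Rightarrow> nat"
  assumes range: "\<And>i. i < 7 \<Longrightarrow> a i < 7" "\<And>i. i < 7 \<Longrightarrow> b i < 7"
    and inj: "\<And>i j. i < 7 \<Longrightarrow> j < 7 \<Longrightarrow> a i = a j \<Longrightarrow> i = j"
    and inc: "\<And>i j. i < 7 \<Longrightarrow> j < 7 \<Longrightarrow> (i + j) mod 7 \<in> {0, 1, 3} \<Longrightarrow> (b j + a i) mod 7 \<in> {0, 1, 3}"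
    and dom: "\<And>i j. i < 7 \<Longrightarrow> j < 7 \<Longrightarrow> (i + j) mod 7 \<in> {0, 1, 3} \<Longrightarrow>
      (i + a i) mod 7 \<in> {0, 1, 3} \<or> (b j + j) mod 7 \<in> {0, 1, 3}"
    and a0: "a 0 = 2" and b2: "b 2 = 2"
  shows "\<forall>i<7. a i = [2, 6, 4, 0, 3, 5, 1] ! i \<and> b i = [1, 6, 2, 5, 0, 3, 4] ! i"
proof -
  have "b 0 < 7" "(b 0 + 2) mod 7 \<in> {0, 1, 3}" "(b 0 + 0) mod 7 \<in> {0, 1, 3}"
    using range(2)[of 0] inc[of 0 0] dom[of 0 0] a0 by auto
  then have b0: "b 0 = 1" unfolding less_7_cases by (elim disjE; simp)
  have "b 1 < 7" "(b 1 + 2) mod 7 \<in> {0, 1, 3}" "(b 1 + 1) mod 7 \<in> {0, 1, 3}"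
    using range(2)[of 1] inc[of 0 1] dom[of 0 1] a0 by auto
  then have b1: "b 1 = 6" unfolding less_7_cases by (elim disjE; simp)
  have "b 3 < 7" "(b 3 + 2) mod 7 \<in> {0, 1, 3}" "(b 3 + 3) mod 7 \<in> {0, 1, 3}"
    using range(2)[of 3] inc[of 0 3] dom[of 0 3] a0 by auto
  then have b3: "b 3 = 5" unfolding less_7_cases by (elim disjE; simp)
  have "a 1 < 7" "(2 + a 1) mod 7 \<in> {0, 1, 3}" "(1 + a 1) mod 7 \<in> {0, 1, 3}"
    using range(1)[of 1] inc[of 1 2] dom[of 1 2] b2 by auto
  then have a1: "a 1 = 6" unfolding less_7_cases by (elim disjE; simp)
  have "a 5 < 7" "(2 + a 5) mod 7 \<in> {0, 1, 3}" "(5 + a 5) mod 7 \<in> {0, 1, 3}"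
    using range(1)[of 5] inc[of 5 2] dom[of 5 2] b2 by auto
  then have a5: "a 5 = 5" unfolding less_7_cases by (elim disjE; simp)
  have "a 6 < 7" "(2 + a 6) mod 7 \<in> {0, 1, 3}" "(6 + a 6) mod 7 \<in> {0, 1, 3}"
    using range(1)[of 6] inc[of 6 2] dom[of 6 2] b2 by auto
  then have a6: "a 6 = 1" unfolding less_7_cases by (elim disjE; simp)
  have "a 3 < 7" "(1 + a 3) mod 7 \<in> {0, 1, 3}" "a 3 \<noteq> 2" "a 3 \<noteq> 6"
    using range(1)[of 3] inc[of 3 0] b0 inj[of 3 0] inj[of 3 1] a0 a1 by auto
  then have a3: "a 3 = 0" unfolding less_7_cases by (elim disjE; simp)
  have "a 2 < 7" "(6 + a 2) mod 7 \<in> {0, 1, 3}" "a 2 \<noteq> 2" "a 2 \<noteq> 1"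
    using range(1)[of 2] inc[of 2 1] b1 inj[of 2 0] inj[of 2 6] a0 a6 by auto
  then have a2: "a 2 = 4" unfolding less_7_cases by (elim disjE; simp)
  have "a 4 < 7" "(5 + a 4) mod 7 \<in> {0, 1, 3}" "a 4 \<noteq> 2" "a 4 \<noteq> 5"
    using range(1)[of 4] inc[of 4 3] b3 inj[of 4 0] inj[of 4 5] a0 a5 by auto
  then have a4: "a 4 = 3" unfolding less_7_cases by (elim disjE; simp)
  have "b 5 < 7" "(b 5 + 4) mod 7 \<in> {0, 1, 3}" "(b 5 + 0) mod 7 \<in> {0, 1, 3}"
    using range(2)[of 5] inc[of 2 5] inc[of 3 5] a2 a3 by auto
  then have b5: "b 5 = 3" unfolding less_7_cases by (elim disjE; simp)
  have "b 4 < 7" "(b 4 + 0) mod 7 \<in> {0, 1, 3}" "(b 4 + 3) mod 7 \<in> {0, 1, 3}"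
    using range(2)[of 4] inc[of 3 4] inc[of 4 4] a3 a4 by auto
  then have b4: "b 4 = 0" unfolding less_7_cases by (elim disjE; simp)
  have "b 6 < 7" "(b 6 + 6) mod 7 \<in> {0, 1, 3}" "(b 6 + 4) mod 7 \<in> {0, 1, 3}"
    using range(2)[of 6] inc[of 1 6] inc[of 2 6] a1 a2 by auto
  then have b6: "b 6 = 4" unfolding less_7_cases by (elim disjE; simp)
  show ?thesis unfolding all_less_7
    by (simp add: a0 a1 a2 a3 a4 a5 a6 b0 b1 b2 b3 b4 b5 b6 del: One_nat_def)
qed

context domestic_duality
begin

text \<open>If \<open>\<theta> (\<theta> p) = p\<close>, then every line \<open>M\<close> through \<open>p\<close> has a second non-absolute point, and the images
  of these points would all coincide with \<open>\<theta> p\<close>.\<close>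

lemma theta_square_moves:
  assumes p: "p \<in> V" "\<not> absolute p"
  shows "\<theta> (\<theta> p) \<noteq> p"
proof
  assume fix_p: "\<theta> (\<theta> p) = p"
  \<comment> \<open>Both \<open>p\<close> and \<open>\<theta> M\<close> are incident with
    \<open>M\<close> and with \<open>\<theta> (\<theta> M)\<close>, so \<open>\<theta>\<close> acts
    as an involution on the pencil of \<open>p\<close>.\<close>
  have pol: "adj M (\<theta> M) \<and> adj (\<theta> p) (\<theta> M) \<and> \<theta> (\<theta> M) = M" if M: "adj p M" for M
  proof -
    have MM: "adj M (\<theta> M)" using domD[OF M p(2)] unfolding absolute_def .
    have q: "adj (\<theta> p) (\<theta> M)" by (rule theta_adjI[OF M])
    have "absolute (\<theta> M)"
      using domD[OF q] absolute_theta[OF p(1)] p(2) by blast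
    then have "adj (\<theta> M) (\<theta> (\<theta> M))" unfolding absolute_def .
    moreover have "adj p (\<theta> (\<theta> M))" using theta_adjI[OF q] fix_p by simp
    moreover have "\<theta> M \<noteq> p" using q p(2) adj_sym unfolding absolute_def by metis
    ultimately have "\<theta> (\<theta> M) = M"
      using unique_join[of "\<theta> M" "\<theta> (\<theta> M)" p M] M adj_sym[OF MM] by blast
    then show ?thesis using MM q by blast
  qed
  obtain M where M: "adj p M" by (rule third_neighbour[OF p(1)])
  obtain M' where M': "adj p M'" "M' \<noteq> M" by (rule third_neighbour[OF p(1)])
  note P = pol[OF M] and P' = pol[OF M'(1)]
  obtain r where r: "adj M r" "r \<noteq> p" "r \<noteq> \<theta> M" by (rule third_neighbour[OF adj_V(2)[OF M]])
  have V: "r \<in> V" "M \<in> V" "M' \<in> V" using adj_V r M M' by blast+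
  have q: "adj (\<theta> r) (\<theta> M)" by (rule theta_adjI[OF adj_sym[OF r(1)]])
  have "\<not> absolute r"
  proof
    assume "absolute r"
    then have "\<theta> r = M" using absolute_pair[OF domD[OF M p(2)] adj_sym[OF r(1)]] r(3) by blast
    then have "r = \<theta> M" using theta_inj[OF V(1) theta_V[OF V(2)]] P by metis
    then show False using r(3) by simp
  qed
  then have nr: "\<not> absolute (\<theta> r)" using absolute_theta V by blast
  have "isl (\<theta> r) = isl M'" using theta_isl[OF V(1)] adj_isl[OF r(1)] adj_isl[OF M] adj_isl[OF M'(1)] by auto
  \<comment> \<open>The meeting point of \<open>\<theta> r\<close> with \<open>M'\<close> is
    absolute, hence equal to \<open>\<theta> M'\<close>. So \<open>\<theta> r\<close> and
    \<open>\<theta> p\<close> share \<open>\<theta> M\<close> and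
    \<open>\<theta> M'\<close>.\<close>
  then obtain y where y: "adj (\<theta> r) y" "adj M' y" by (rule join[OF theta_V[OF V(1)] V(3)])
  have "absolute y" by (rule domD[OF y(1) nr])
  then have "y = \<theta> M' \<or> \<theta> y = M'" by (rule absolute_pair[OF domD[OF M'(1) p(2)] adj_sym[OF y(2)]])
  then have "y = \<theta> M'" using theta_inj[OF adj_V(2)[OF y(2)] theta_V[OF V(3)]] P' by metis
  moreover have "\<theta> M' \<noteq> \<theta> M" using theta_inj V M'(2) by blast
  ultimately have "\<theta> r = \<theta> p"
    using unique_join[of "\<theta> M" "\<theta> r" "\<theta> M'" "\<theta> p"] q y P P' adj_sym by metis
  then show False using theta_inj[OF V(1) p(1)] r(2) by blast
qed

lemma canonical_duality_exists: "\<exists>f g. canonical_duality \<Gamma> f g \<theta>"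
proof -
  obtain p where p: "p \<in> V" "isl p" "\<not> absolute p" by (rule nonabsolute_exists)
  let ?L = "\<theta> p" and ?z = "\<theta> (\<theta> p)"
  have z: "?z \<in> V" "isl ?z" "?z \<noteq> p"
    using theta_V theta_isl p theta_square_moves by auto
  have pL: "\<not> adj p ?L" and zL: "\<not> adj ?L ?z"
    using p absolute_theta[OF p(1)] unfolding absolute_def by auto
  obtain K where K: "adj p K" "adj ?z K" using join[OF p(1) z(1)] p z by auto
  have "K \<noteq> ?L" using K pL by blast
  obtain q0 where q0: "adj ?L q0" by (rule third_neighbour[OF theta_V[OF p(1)]])
  obtain q1 where q1: "adj ?L q1" "q1 \<noteq> q0" by (rule third_neighbour[OF theta_V[OF p(1)]])
  \<comment> \<open>\<open>K\<close> and \<open>\<theta> p\<close> have one common point, so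
    \<open>q0\<close> or \<open>q1\<close> is off \<open>K\<close>.\<close>
  have "\<exists>q. adj ?L q \<and> \<not> adj q K"
    using unique_join[of q0 ?L q1 K] q0 q1 adj_sym \<open>K \<noteq> ?L\<close> by blast
  then obtain q where q: "adj ?L q" "\<not> adj q K" by blast
  have qi: "q \<in> V" "isl q" using adj_V[OF q(1)] adj_isl[OF q(1)] theta_isl[OF p(1)] p(2) by auto
  obtain a b c where abc: "p = Inl a" "q = Inl b" "?z = Inl c" using p(2) qi(2) z(2) by (metis isl_def)
  have "\<exists>f g. fano_labelling \<Gamma> f g \<and> f 0 = a \<and> f 1 = b \<and> f 2 = c"
  proof (rule fano_labelling_triangle[OF fano])
    show "a \<in> Points \<Gamma>" "b \<in> Points \<Gamma>" "c \<in> Points \<Gamma>" using p z qi abc by auto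
    show "a \<noteq> b" using q(1) pL adj_sym abc by auto
    fix l assume l: "(a, l) \<in> Inc \<Gamma>" "(b, l) \<in> Inc \<Gamma>"
    show "(c, l) \<notin> Inc \<Gamma>"
    proof
      assume "(c, l) \<in> Inc \<Gamma>"
      then have "Inr l = K" using unique_join[of p "Inr l" ?z K] K z(3) l abc by simp
      then show False using q(2) l abc by auto
    qed
  qed
  then obtain f g where lab: "fano_labelling \<Gamma> f g" and f: "f 0 = a" "f 1 = b" "f 2 = c" by blast
  note D = fano_labellingD(3)[OF lab] and mem = fano_labelling_mem[OF lab] and eq = fano_labelling_eq[OF lab]
  have "\<exists>j<7. \<theta> (Inl (f i)) = Inr (g j)" if "i < 7" for i
  proof -
    have "Inl (f i) \<in> V" using mem that by simp
    note V = theta_V[OF this] and isl = theta_isl[OF this]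
    show ?thesis by (rule fano_labelling_cases[OF lab V]) (use isl in auto)
  qed
  then obtain s where s: "\<And>i. i < 7 \<Longrightarrow> s i < 7 \<and> \<theta> (Inl (f i)) = Inr (g (s i))" by metis
  have "\<exists>j<7. \<theta> (Inr (g i)) = Inl (f j)" if "i < 7" for i
  proof -
    have "Inr (g i) \<in> V" using mem that by simp
    note V = theta_V[OF this] and isl = theta_isl[OF this]
    show ?thesis by (rule fano_labelling_cases[OF lab V]) (use isl in auto)
  qed
  then obtain t where t: "\<And>i. i < 7 \<Longrightarrow> t i < 7 \<and> \<theta> (Inr (g i)) = Inl (f (t i))" by metis
  have lines: "?L = Inr (g (s 0))" using s[of 0] f(1) abc by simp
  have s0: "s 0 = 2"
  proof -
    have "s 0 < 7" using s by simp
    moreover have "(0 + s 0) mod 7 \<notin> {0, 1, 3}" using D[of 0 "s 0"] s[of 0] pL lines abc f by simp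
    moreover have "(2 + s 0) mod 7 \<notin> {0, 1, 3}" using D[of 2 "s 0"] s[of 0] zL lines abc f by simp
    moreover have "(1 + s 0) mod 7 \<in> {0, 1, 3}" using D[of 1 "s 0"] s[of 0] q lines abc f by simp
    ultimately show ?thesis unfolding less_7_cases by (elim disjE; simp)
  qed
  have t2: "t 2 = 2"
  proof -
    have "Inl (f (t 2)) = ?z" using t[of 2] lines s0 by simp
    then have "f (t 2) = f 2" using abc f by simp
    then show ?thesis using eq(1)[of "t 2" 2] t[of 2] by simp
  qed
  have "\<forall>i<7. s i = [2, 6, 4, 0, 3, 5, 1] ! i \<and> t i = [1, 6, 2, 5, 0, 3, 4] ! i"
  proof (rule canonical_table)
    fix i j :: nat assume ij: "i < 7" "j < 7"
    show "s i < 7" "t i < 7" using s t ij by auto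
    { assume "s i = s j"
      then have "\<theta> (Inl (f i)) = \<theta> (Inl (f j))" using s ij by simp
      then have "f i = f j" using theta_inj[of "Inl (f i)" "Inl (f j)"] mem ij by simp
      then show "i = j" using eq ij by simp }
    assume inc: "(i + j) mod 7 \<in> {0, 1, 3}"
    then have adj: "adj (Inl (f i)) (Inr (g j))" using D ij by simp
    show "(t j + s i) mod 7 \<in> {0, 1, 3}"
      using theta_adjI[OF adj] s[OF ij(1)] t[OF ij(2)] D[of "t j" "s i"] by simp
    show "(i + s i) mod 7 \<in> {0, 1, 3} \<or> (t j + j) mod 7 \<in> {0, 1, 3}"
      using domD[OF adj] D[of i "s i"] D[of "t j" j] s[OF ij(1)] t[OF ij(2)] ij
      unfolding absolute_def by auto
  qed (use s0 t2 in auto)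
  then have "canonical_duality \<Gamma> f g \<theta>" using lab s t unfolding canonical_duality_def by simp
  then show ?thesis by blast
qed

end

section \<open>Realisation, conjugacy and order of the canonical duality\<close>

lemma canonical_dualityD:
  assumes "canonical_duality F f g \<theta>"
  shows "fano_labelling F f g"
    and "i < 7 \<Longrightarrow> \<theta> (Inl (f i)) = Inr (g ([2, 6, 4, 0, 3, 5, 1] ! i))"
    and "i < 7 \<Longrightarrow> \<theta> (Inr (g i)) = Inl (f ([1, 6, 2, 5, 0, 3, 4] ! i))"
  using assms unfolding canonical_duality_def by auto

lemma canonical_duality_realised:
  assumes lab: "fano_labelling F f g"
  shows "\<exists>\<theta> \<in> carrier (aut_group F). canonical_duality F f g \<theta>"
proof -
  note D = fano_labellingD[OF lab]
  let ?p = "[2, 6, 4, 0, 3, 5, 1 :: nat]" and ?s = "[1, 6, 2, 5, 0, 3, 4 :: nat]"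
  have "x < 7 \<longleftrightarrow> x \<in> set ?p" "x < 7 \<longleftrightarrow> x \<in> set ?s" for x
    unfolding less_7_cases by auto
  then have sets: "{..<7} = set ?p" "{..<7} = set ?s" unfolding lessThan_def by blast+
  have p: "bij_betw ((!) ?p) {..<7} {..<7}" and s: "bij_betw ((!) ?s) {..<7} {..<7}"
    by (rule bij_betw_nth; (rule sets)?; simp)+
  let ?u = "\<lambda>i. Inr (g (?p ! i)) :: 'a + 'b" and ?w = "\<lambda>i. Inl (f (?s ! i)) :: 'a + 'b"
  have "\<exists>\<theta> \<in> carrier (aut_group F). \<forall>i<7. \<theta> (Inl (f i)) = ?u i \<and> \<theta> (Inr (g i)) = ?w i"
  proof (rule automorphism_by_labels[OF lab])
    have "bij_betw Inr (Lines F) (Inr ` Lines F :: ('a + 'b) set)" by (simp add: bij_betw_def)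
    then have "bij_betw (Inr \<circ> (g \<circ> (!) ?p)) {..<7} (Inr ` Lines F :: ('a + 'b) set)"
      by (rule bij_betw_trans[OF bij_betw_trans[OF p D(2)]])
    then show "bij_betw ?u {..<7} (Inr ` Lines F)" by (simp add: comp_def)
    have "bij_betw Inl (Points F) (Inl ` Points F :: ('a + 'b) set)" by (simp add: bij_betw_def)
    then have "bij_betw (Inl \<circ> (f \<circ> (!) ?s)) {..<7} (Inl ` Points F :: ('a + 'b) set)"
      by (rule bij_betw_trans[OF bij_betw_trans[OF s D(1)]])
    then show "bij_betw ?w {..<7} (Inl ` Points F)" by (simp add: comp_def)
  next
    fix i j :: nat assume ij: "i < 7" "j < 7"
    have "?p ! i < 7" "?s ! j < 7" using ij unfolding less_7_cases by (elim disjE; simp)+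
    then have "(?u i, ?w j) \<in> incidence_graph F \<longleftrightarrow> (?s ! j + ?p ! i) mod 7 \<in> {0, 1, 3}"
      using D(3) by simp
    also have "\<dots> \<longleftrightarrow> (i + j) mod 7 \<in> {0, 1, 3}"
      using ij unfolding less_7_cases by (elim disjE; simp)
    finally show "(?u i, ?w j) \<in> incidence_graph F \<longleftrightarrow> (i + j) mod 7 \<in> {0, 1, 3}" .
  qed simp
  then show ?thesis using lab unfolding canonical_duality_def by blast
qed

text \<open>The collineation carrying one labelling to the other intertwines the two dualities,
  since they have the same table.\<close>

lemma canonical_duality_conjugate:
  assumes \<theta>: "canonical_duality F f g \<theta>" "\<theta> \<in> carrier (aut_group F)"
    and \<phi>: "canonical_duality F f' g' \<phi>" "\<phi> \<in> carrier (aut_group F)"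
  shows "\<phi> \<in> conj_class (aut_group F) \<theta>"
proof -
  let ?G = "aut_group F"
  interpret group ?G by (rule group_aut_group)
  note T = canonical_dualityD[OF \<theta>(1)] and P = canonical_dualityD[OF \<phi>(1)]
  note D = fano_labellingD[OF T(1)]
  have "\<exists>\<gamma> \<in> carrier ?G. \<forall>i<7. \<gamma> (Inl (f' i)) = Inl (f i) \<and> \<gamma> (Inr (g' i)) = Inr (g i)"
  proof (rule automorphism_by_labels[OF P(1)])
    show "bij_betw (\<lambda>i. Inl (f i)) {..<7} (Inl ` Points F :: ('a + 'b) set)"
      using D(1) unfolding bij_betw_def inj_on_def by auto
    show "bij_betw (\<lambda>i. Inr (g i)) {..<7} (Inr ` Lines F :: ('a + 'b) set)"
      using D(2) unfolding bij_betw_def inj_on_def by auto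
  qed (use D(3) in simp_all)
  then obtain \<gamma> where \<gamma>: "\<gamma> \<in> carrier ?G" "\<And>i. i < 7 \<Longrightarrow> \<gamma> (Inl (f' i)) = Inl (f i)"
    "\<And>i. i < 7 \<Longrightarrow> \<gamma> (Inr (g' i)) = Inr (g i)" by blast
  have range: "[2, 6, 4, 0, 3, 5, 1] ! i < (7::nat)" "[1, 6, 2, 5, 0, 3, 4] ! i < (7::nat)" if "i < 7" for i
    using that unfolding less_7_cases by (elim disjE; simp)+
  have "\<gamma> \<otimes>\<^bsub>?G\<^esub> \<phi> = \<theta> \<otimes>\<^bsub>?G\<^esub> \<gamma>"
  proof (rule aut_group_eqI)
    fix x assume x: "x \<in> elements F"
    have "\<gamma> (\<phi> x) = \<theta> (\<gamma> x)"
      using x by (elim fano_labelling_cases[OF P(1)]) (simp_all add: \<gamma> T P range del: One_nat_def)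
    then show "(\<gamma> \<otimes>\<^bsub>?G\<^esub> \<phi>) x = (\<theta> \<otimes>\<^bsub>?G\<^esub> \<gamma>) x"
      using x \<gamma>(1) \<theta>(2) \<phi>(2) by (simp add: aut_group_mult compose_def)
  qed (use \<gamma>(1) \<theta>(2) \<phi>(2) in auto)
  then have "\<phi> = inv\<^bsub>?G\<^esub> \<gamma> \<otimes>\<^bsub>?G\<^esub> (\<theta> \<otimes>\<^bsub>?G\<^esub> \<gamma>)"
    using \<gamma>(1) \<theta>(2) \<phi>(2) inv_solve_left[of \<phi> \<gamma> "\<theta> \<otimes>\<^bsub>?G\<^esub> \<gamma>"] by simp
  then have "\<phi> = inv\<^bsub>?G\<^esub> \<gamma> \<otimes>\<^bsub>?G\<^esub> \<theta> \<otimes>\<^bsub>?G\<^esub> \<gamma>"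
    using \<gamma>(1) \<theta>(2) by (simp add: m_assoc)
  then show ?thesis using \<gamma>(1) unfolding conj_class_def by blast
qed

lemma canonical_duality_is_duality:
  assumes \<theta>: "canonical_duality F f g \<theta>" "automorphism F \<theta>"
  shows "duality F \<theta>"
proof -
  note T = canonical_dualityD[OF \<theta>(1)]
  have "Inl (f 0) \<in> elements F" "\<not> isl (\<theta> (Inl (f 0)))"
    using fano_labelling_mem[OF T(1), of 0] T(2)[of 0] by auto
  then have "\<not> preserves_types F \<theta>" using preserves_types_isl by fastforce
  then show ?thesis using \<theta>(2) unfolding duality_def automorphism_def by blast
qed

lemma canonical_duality_domestic:
  assumes fano: "fano_plane F" and \<theta>: "canonical_duality F f g \<theta>" "automorphism F \<theta>"
  shows "domestic 3 F \<theta>"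
proof -
  interpret thick_plane F by (rule fano_thick_plane[OF fano])
  interpret plane_duality F \<theta>
    by unfold_locales (rule canonical_duality_is_duality[OF \<theta>])
  note T = canonical_dualityD[OF \<theta>(1)]
  note D = fano_labellingD[OF T(1)]
  let ?p = "[2, 6, 4, 0, 3, 5, 1 :: nat]" and ?s = "[1, 6, 2, 5, 0, 3, 4 :: nat]"
  have range: "?p ! i < 7" "?s ! i < 7" if "i < 7" for i
    using that unfolding less_7_cases by (elim disjE; simp)+
  have P: "absolute (Inl (f i)) \<longleftrightarrow> (i + ?p ! i) mod 7 \<in> {0, 1, 3}" if "i < 7" for i
    unfolding absolute_def T(2)[OF that] using D(3)[OF that range(1)[OF that]] by simp
  have L: "absolute (Inr (g i)) \<longleftrightarrow> (?s ! i + i) mod 7 \<in> {0, 1, 3}" if "i < 7" for i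
    unfolding absolute_def T(3)[OF that] using D(3)[OF range(2)[OF that] that] by simp
  have *: "absolute (Inl (f i)) \<or> absolute (Inr (g j))"
    if ij: "i < 7" "j < 7" and adj: "(f i, g j) \<in> Inc F" for i j
  proof -
    have "(i + j) mod 7 \<in> {0, 1, 3}" using adj D(3)[OF ij] by simp
    then show ?thesis unfolding P[OF ij(1)] L[OF ij(2)]
      using ij unfolding less_7_cases by (elim disjE; simp)
  qed
  have "absolute x \<or> absolute y" if xy: "adj x y" for x y
    using adj_V[OF xy] xy by (elim fano_labelling_cases[OF T(1)]) (use * in auto)
  then show ?thesis using domestic_iff by blast
qed

text \<open>The non-absolute points are 0 and 2, that is, \<open>p\<close> and
  \<open>\<theta> (\<theta> p)\<close>. Five is the count at which \<open>(a - 3) / sqrt 2\<close>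
  equals \<open>sqrt 2\<close>.\<close>

lemma canonical_duality_absolute_points:
  assumes \<theta>: "canonical_duality F f g \<theta>"
  shows "card {p \<in> Points F. (Inl p, \<theta> (Inl p)) \<in> incidence_graph F} = 5"
proof -
  note T = canonical_dualityD[OF \<theta>] and D = fano_labellingD[OF canonical_dualityD(1)[OF \<theta>]]
  let ?p = "[2, 6, 4, 0, 3, 5, 1 :: nat]"
  have abs: "(Inl (f i), \<theta> (Inl (f i))) \<in> incidence_graph F \<longleftrightarrow> i \<in> {1, 3, 4, 5, 6}" if i: "i < 7" for i
  proof -
    have "?p ! i < 7" using i unfolding less_7_cases by (elim disjE; simp)
    then have "(Inl (f i), \<theta> (Inl (f i))) \<in> incidence_graph F \<longleftrightarrow> (i + ?p ! i) mod 7 \<in> {0, 1, 3}"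
      unfolding T(2)[OF i] using D(3)[OF i] by simp
    also have "\<dots> \<longleftrightarrow> i \<in> {1, 3, 4, 5, 6}" using i unfolding less_7_cases by (elim disjE; simp)
    finally show ?thesis .
  qed
  have "Points F = f ` {..<7}" and inj: "inj_on f {..<7}" using D(1) unfolding bij_betw_def by auto
  then have "{p \<in> Points F. (Inl p, \<theta> (Inl p)) \<in> incidence_graph F} = f ` {i \<in> {..<7}. i \<in> {1, 3, 4, 5, 6}}"
    using abs by auto
  also have "{i \<in> {..<7}. i \<in> {1, 3, 4, 5, 6}} = {1, 3, 4, 5, 6 :: nat}" by auto
  also have "card (f ` {1, 3, 4, 5, 6}) = card {1, 3, 4, 5, 6 :: nat}"
    by (rule card_image) (rule inj_on_subset[OF inj], auto)
  finally show ?thesis by simp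
qed

lemma canonical_duality_ord:
  assumes \<theta>: "canonical_duality F f g \<theta>" "\<theta> \<in> carrier (aut_group F)"
  shows "group.ord (aut_group F) \<theta> = 8"
proof -
  let ?G = "aut_group F"
  interpret group ?G by (rule group_aut_group)
  note T = canonical_dualityD[OF \<theta>(1)]
  have pow: "(\<theta> [^]\<^bsub>?G\<^esub> (k::nat)) x = (\<theta> ^^ k) x" if "x \<in> elements F" for x k
    by (rule aut_group_pow[OF \<theta>(2) that])
  have eight: "(\<theta> ^^ 8) x = x" if x: "x \<in> elements F" for x
  proof -
    have e: "(\<theta> ^^ 8) x = \<theta> (\<theta> (\<theta> (\<theta> (\<theta> (\<theta> (\<theta> (\<theta> x)))))))" for x by (simp add: numeral_eq_Suc)
    show ?thesis unfolding e
    proof (rule fano_labelling_cases[OF T(1) x])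
      fix i :: nat assume "i < 7" and x: "x = Inl (f i)"
      then show "\<theta> (\<theta> (\<theta> (\<theta> (\<theta> (\<theta> (\<theta> (\<theta> x))))))) = x"
        unfolding less_7_cases by (elim disjE; simp add: T del: One_nat_def)
    next
      fix i :: nat assume "i < 7" and x: "x = Inr (g i)"
      then show "\<theta> (\<theta> (\<theta> (\<theta> (\<theta> (\<theta> (\<theta> (\<theta> x))))))) = x"
        unfolding less_7_cases by (elim disjE; simp add: T del: One_nat_def)
    qed
  qed
  have "\<theta> [^]\<^bsub>?G\<^esub> (8::nat) = \<one>\<^bsub>?G\<^esub>"
  proof (rule aut_group_eqI)
    fix x assume "x \<in> elements F"
    then show "(\<theta> [^]\<^bsub>?G\<^esub> (8::nat)) x = \<one>\<^bsub>?G\<^esub> x"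
      using pow[of x 8] eight by (simp add: aut_group_one)
  qed (use \<theta>(2) in auto)
  then have dvd8: "ord \<theta> dvd 8" using pow_eq_id[OF \<theta>(2)] by simp
  have x: "Inl (f 1) \<in> elements F" using fano_labelling_mem[OF T(1), of 1] by simp
  \<comment> \<open>The orbit runs \<open>f 1\<close>, \<open>g 6\<close>, \<open>f 4\<close>,
    \<open>g 3\<close>, \<open>f 5\<close>. The points \<open>f 0\<close> and \<open>f 2\<close>
    would not do, as they lie on a cycle of length 4.\<close>
  have "(\<theta> ^^ 4) (Inl (f 1)) = Inl (f 5)"
    by (simp add: numeral_eq_Suc) (simp add: T del: One_nat_def add: One_nat_def[symmetric])
  then have "(\<theta> ^^ 4) (Inl (f 1)) \<noteq> Inl (f 1)" using fano_labelling_eq(1)[OF T(1), of 5 1] by simp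
  then have "\<theta> [^]\<^bsub>?G\<^esub> (4::nat) \<noteq> \<one>\<^bsub>?G\<^esub>"
    using pow[OF x, of 4] x by (auto simp: aut_group_one)
  then have not4: "\<not> ord \<theta> dvd 4" using pow_eq_id[OF \<theta>(2)] by simp
  have "ord \<theta> \<le> 8" using dvd8 by (rule dvd_imp_le) simp
  then have "ord \<theta> = 0 \<or> ord \<theta> = 1 \<or> ord \<theta> = 2 \<or> ord \<theta> = 3 \<or> ord \<theta> = 4 \<or> ord \<theta> = 5 \<or> ord \<theta> = 6 \<or>
      ord \<theta> = 7 \<or> ord \<theta> = 8" by linarith
  then show ?thesis using dvd8 not4 by (elim disjE) auto
qed

text \<open>\<open>\<gamma>\<close> maps absolute elements of \<open>\<phi>\<close> to absolute
  elements of \<open>\<theta>\<close>. It may be a duality itself, so the type of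
  \<open>\<phi> x\<close> is read off after applying \<open>\<gamma>\<close>.\<close>

lemma conjugate_domestic_duality:
  assumes fano: "fano_plane F" and \<theta>: "\<theta> \<in> carrier (aut_group F)" "duality F \<theta>" "domestic 3 F \<theta>"
    and \<phi>: "\<phi> \<in> conj_class (aut_group F) \<theta>"
  shows "\<phi> \<in> carrier (aut_group F)" "duality F \<phi>" "domestic 3 F \<phi>"
proof -
  let ?G = "aut_group F"
  interpret G: group ?G by (rule group_aut_group)
  obtain \<gamma> where \<gamma>: "\<gamma> \<in> carrier ?G" and \<phi>_eq: "\<phi> = inv\<^bsub>?G\<^esub> \<gamma> \<otimes>\<^bsub>?G\<^esub> \<theta> \<otimes>\<^bsub>?G\<^esub> \<gamma>"
    using \<phi> unfolding conj_class_def by blast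
  show C: "\<phi> \<in> carrier ?G" using \<gamma> \<theta>(1) \<phi>_eq by simp
  have "\<gamma> \<otimes>\<^bsub>?G\<^esub> \<phi> = \<theta> \<otimes>\<^bsub>?G\<^esub> \<gamma>"
    using \<gamma> \<theta>(1) unfolding \<phi>_eq by (simp add: G.m_assoc[symmetric])
  then have "compose (elements F) \<gamma> \<phi> = compose (elements F) \<theta> \<gamma>"
    using \<gamma> \<theta>(1) C by (simp add: aut_group_mult)
  then have comm: "\<gamma> (\<phi> x) = \<theta> (\<gamma> x)" if "x \<in> elements F" for x
    using that by (metis compose_eq)
  have aut: "automorphism F \<gamma>" "automorphism F \<phi>" using \<gamma> C unfolding aut_group_carrier by auto
  interpret thick_plane F by (rule fano_thick_plane[OF fano])
  interpret T: plane_duality F \<theta> using \<theta>(2) by unfold_locales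
  obtain x where x: "x \<in> elements F" using generalised_polygonD(3)[OF plane] by blast
  have "isl (\<phi> x) \<noteq> isl x"
  proof
    assume same: "isl (\<phi> x) = isl x"
    have "isl (\<gamma> (\<phi> x)) = isl (\<gamma> x)"
      using aut(1) preserves_types_isl interchanges_types_isl x automorphism_elements[OF aut(2) x] same
      unfolding automorphism_def by metis
    then show False
      using comm[OF x] T.theta_isl[OF automorphism_elements[OF aut(1) x]] by simp
  qed
  then have "\<not> preserves_types F \<phi>" using preserves_types_isl x by blast
  then show dual: "duality F \<phi>" using aut(2) unfolding duality_def automorphism_def by blast
  interpret P: plane_duality F \<phi> using dual by unfold_locales
  have abs: "T.absolute (\<gamma> x) \<longleftrightarrow> P.absolute x" if "x \<in> V" for x
    unfolding T.absolute_def P.absolute_def comm[OF that, symmetric]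
    using automorphism_incident[OF aut(1) that automorphism_elements[OF aut(2) that]] .
  show "domestic 3 F \<phi>"
    unfolding P.domestic_iff
  proof (intro allI impI)
    fix x y assume xy: "adj x y"
    have "adj (\<gamma> x) (\<gamma> y)" using automorphism_incident[OF aut(1) adj_V[OF xy]] xy by simp
    then have "T.absolute (\<gamma> x) \<or> T.absolute (\<gamma> y)" using \<theta>(3) T.domestic_iff by blast
    then show "P.absolute x \<or> P.absolute y" using abs adj_V[OF xy] by simp
  qed
qed

text \<open>With two non-absolute points \<open>p\<close> and \<open>q\<close>, only the line joining them could form with one of
  them a flag mapped to an opposite one. The two other lines through the third point of that line
  consist of absolute points, hence are not absolute, and there are only two non-absolute lines.\<close>

lemma five_absolute_points_domestic:
  assumes fano: "fano_plane F" and dual: "duality F \<theta>"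
    and five: "card {p \<in> Points F. (Inl p, \<theta> (Inl p)) \<in> incidence_graph F} = 5"
  shows "domestic 3 F \<theta>"
proof -
  interpret thick_plane F by (rule fano_thick_plane[OF fano])
  interpret plane_duality F \<theta> using dual by unfold_locales
  obtain f g where lab: "fano_labelling F f g" by (rule fano_labelling_exists[OF fano])
  let ?A = "{p \<in> Points F. (Inl p, \<theta> (Inl p)) \<in> incidence_graph F}"
  have seven: "card (Points F) = 7" using fano_labellingD(1)[OF lab] bij_betw_same_card by fastforce
  then have "finite (Points F)" using card.infinite by fastforce
  then have "card (Points F - ?A) = card (Points F) - card ?A"
    by (intro card_Diff_subset) auto
  also have "Points F - ?A = {p \<in> Points F. \<not> absolute (Inl p)}" unfolding absolute_def by blast
  finally have "card {p \<in> Points F. \<not> absolute (Inl p)} = 2" using seven five by simp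
  then obtain a b where ab: "{p \<in> Points F. \<not> absolute (Inl p)} = {a, b}" "a \<noteq> b"
    unfolding card_2_iff by blast
  let ?N = "{Inl a, Inl b} :: ('a + 'b) set"
  have pts: "\<not> absolute x \<longleftrightarrow> x \<in> ?N" if "x \<in> V" "isl x" for x
    using that ab(1) by (cases x) auto
  have N: "Inl a \<in> V" "Inl b \<in> V" "\<not> absolute (Inl a)" "\<not> absolute (Inl b)" using ab(1) by auto
  have lines: "L \<in> \<theta> ` ?N" if L: "L \<in> V" "\<not> isl L" "\<not> absolute L" for L
  proof -
    obtain x where x: "x \<in> V" "\<theta> x = L" by (rule theta_surj[OF L(1)])
    then have "x \<in> ?N" using pts[OF x(1)] absolute_theta[OF x(1)] theta_isl[OF x(1)] L by simp
    then show ?thesis using x by blast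
  qed
  have card3: "card (nbrs x) = 3" if "x \<in> V" for x
    using fano that unfolding fano_plane_def
    by (cases x) (auto simp: neighbours_line neighbours_point card_image)
  have flag: "absolute L" if xL: "adj x L" "isl x" "\<not> absolute x" for x L
  proof (rule ccontr)
    assume nL: "\<not> absolute L"
    have V: "x \<in> V" "L \<in> V" "\<not> isl L" using adj_V[OF xL(1)] adj_isl[OF xL(1)] xL(2) by auto
    have xN: "x \<in> ?N" using pts V xL by blast
    let ?k = "\<theta> L"
    have kL: "\<not> adj L ?k" using nL unfolding absolute_def .
    have kV: "?k \<in> V" by (rule theta_V[OF V(2)])
    show False
    proof (cases "\<exists>y. adj L y \<and> \<not> absolute y \<and> y \<noteq> x")
      case False
      obtain y where y: "adj L y" "y \<noteq> x" by (rule third_neighbour[OF V(2)])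
      obtain w where w: "adj L w" "w \<noteq> x" "w \<noteq> y" by (rule third_neighbour[OF V(2)])
      have abs: "adj y (\<theta> y)" "adj w (\<theta> w)" using False y w unfolding absolute_def by auto
      have k: "adj ?k (\<theta> x)" "adj ?k (\<theta> y)" "adj ?k (\<theta> w)"
        using theta_adjI y(1) w(1) adj_sym[OF xL(1)] by auto
      have V': "y \<in> V" "w \<in> V" using y w adj_V by blast+
      have nb: "nbrs ?k = {\<theta> x, \<theta> y, \<theta> w}"
      proof (rule card3_eq[OF card3[OF kV]])
        show "\<theta> x \<noteq> \<theta> y" "\<theta> x \<noteq> \<theta> w" "\<theta> y \<noteq> \<theta> w"
          using theta_inj V(1) V' y(2) w(2,3) by metis+
      qed (use k in auto)
      \<comment> \<open>The join \<open>M\<close> of \<open>x\<close> and \<open>\<theta> L\<close>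
        must be one of the three lines through \<open>\<theta> L\<close>. It is not
        \<open>\<theta> x\<close>, which misses \<open>x\<close>. If it were the image of
        \<open>y\<close> or \<open>w\<close>, it would contain that point as well as
        \<open>x\<close> and be equal to \<open>L\<close>, which misses
        \<open>\<theta> L\<close>.\<close>
      have "isl x = isl ?k" using theta_isl[OF V(2)] V(3) xL(2) by simp
      then obtain M where M: "adj x M" "adj ?k M" by (rule join[OF V(1) kV])
      have "M \<noteq> \<theta> x" using M(1) xL(3) unfolding absolute_def by blast
      moreover have "M \<noteq> \<theta> y"
        using unique_join[of x M y L] M abs(1) xL(1) y adj_sym kL by metis
      moreover have "M \<noteq> \<theta> w"
        using unique_join[of x M w L] M abs(2) xL(1) w adj_sym kL by metis
      ultimately show False using M(2) nb by blast
    next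
      case True
      then obtain y where y: "adj L y" "\<not> absolute y" "y \<noteq> x" by blast
      have "isl y" "y \<in> V" using adj_isl[OF y(1)] adj_V[OF y(1)] V(3) by auto
      then have yN: "?N = {x, y}" using pts[of y] y(2,3) xN by auto
      obtain r where r: "adj L r" "r \<noteq> x" "r \<noteq> y" by (rule third_neighbour[OF V(2)])
      have rV: "r \<in> V" "isl r" using adj_isl[OF r(1)] adj_V[OF r(1)] V(3) by auto
      have line: "K \<in> \<theta> ` ?N" if K: "adj r K" "K \<noteq> L" for K
      proof -
        have KV: "K \<in> V" "\<not> isl K" using adj_V[OF K(1)] adj_isl[OF K(1)] rV by auto
        have pt: "absolute u" if u: "adj K u" for u
        proof (rule ccontr)
          assume "\<not> absolute u"
          moreover have "u \<in> V" "isl u" using adj_V[OF u] adj_isl[OF u] KV by auto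
          ultimately have "u \<in> {x, y}" using pts yN by blast
          then have "adj L u" "u \<noteq> r" using y(1) adj_sym[OF xL(1)] r by auto
          then have "K = L" using unique_join[of r K u L] K(1) u r(1) adj_sym by blast
          then show False using K(2) by simp
        qed
        \<comment> \<open>All points of \<open>K\<close> are absolute, and an absolute line has at
          most two such points: \<open>\<theta> K\<close> and the preimage \<open>c\<close>.\<close>
        have "\<not> absolute K"
        proof
          assume aK: "absolute K"
          obtain c where c: "c \<in> V" "\<theta> c = K" by (rule theta_surj[OF KV(1)])
          obtain u where u: "adj K u" "u \<noteq> \<theta> K" "u \<noteq> c" by (rule third_neighbour[OF KV(1)])
          have "u = \<theta> K \<or> \<theta> u = K" by (rule absolute_pair[OF aK adj_sym[OF u(1)] pt[OF u(1)]])
          then show False using u c theta_inj[OF adj_V(2)[OF u(1)] c(1)] by metis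
        qed
        then show ?thesis by (rule lines[OF KV])
      qed
      obtain K where K: "adj r K" "K \<noteq> L" by (rule third_neighbour[OF rV(1)])
      obtain K' where K': "adj r K'" "K' \<noteq> L" "K' \<noteq> K" by (rule third_neighbour[OF rV(1)])
      have "{L, K, K'} \<subseteq> \<theta> ` ?N" using line K K' lines[OF V(2,3) nL] by blast
      then have "card {L, K, K'} \<le> card (\<theta> ` ?N)" by (rule card_mono[rotated]) simp
      also have "\<dots> \<le> card ?N" by (rule card_image_le) simp
      also have "\<dots> \<le> 2" by (simp add: card_insert_if)
      finally show False using K K' by simp
    qed
  qed
  have "absolute x \<or> absolute y" if xy: "adj x y" for x y
    using flag[of x y] flag[of y x] xy adj_sym[OF xy] adj_isl[OF xy] by blast
  then show ?thesis using domestic_iff by blast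
qed

section \<open>The character of degree 6\<close>

text \<open>Separates the integer character values of collineations from
  \<open>sqrt 2\<close>.\<close>

lemma square_int_ne_2: "(k::int)\<^sup>2 \<noteq> 2"
proof
  assume k: "k\<^sup>2 = 2"
  then have "\<bar>k\<bar> < 2" using power_mono[of 2 "\<bar>k\<bar>" 2] by (cases "\<bar>k\<bar> < 2") auto
  then have "k = -1 \<or> k = 0 \<or> k = 1" by linarith
  then show False using k by auto
qed

locale framed_fano_plane =
  fixes F :: "('p, 'l) geometry" and e :: "'p \<Rightarrow> real ^ 6"
  assumes fano: "fano_plane F" and frame: "fano_frame F e"
begin

sublocale thick_plane F by (rule fano_thick_plane[OF fano])

lemma card_points: "card (Points F) = 7" and finite_points: "finite (Points F)"
  and finite_lines: "finite (Lines F)"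
proof -
  obtain f g where "fano_labelling F f g" by (rule fano_labelling_exists[OF fano])
  note D = fano_labellingD(1,2)[OF this]
  show "card (Points F) = 7" using bij_betw_same_card[OF D(1)] by simp
  show "finite (Points F)" "finite (Lines F)" using bij_betw_finite D by blast+
qed

lemma frame_inner: "p \<in> Points F \<Longrightarrow> q \<in> Points F \<Longrightarrow> e p \<bullet> e q = (if p = q then 1 else - 1 / 6)"
  using frame unfolding fano_frame_def by (simp add: norm_eq_1)

lemma frame_span: "span (e ` Points F) = UNIV"
  using frame unfolding fano_frame_def by (rule conjunct1)

lemma frame_sum: "(\<Sum>p\<in>Points F. e p) = 0"
  using frame unfolding fano_frame_def by (elim conjE)

text \<open>The coefficients are 1 at \<open>q\<close> and -1/6 elsewhere, and the other
  \<open>h p\<close> sum to \<open>- h q\<close>. It serves for \<open>h = e\<close> and for the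
  images of the \<open>e p\<close> under an automorphism.\<close>

lemma weighted_frame_sum:
  fixes h :: "'p \<Rightarrow> real ^ 6"
  assumes q: "q \<in> Points F" and h: "(\<Sum>p\<in>Points F. h p) = 0"
  shows "(\<Sum>p\<in>Points F. (e p \<bullet> e q) *\<^sub>R h p) = (7 / 6) *\<^sub>R h q"
proof -
  have rest: "(\<Sum>p\<in>Points F - {q}. h p) = - h q"
    using h sum.remove[OF finite_points q, of h] by (simp add: eq_neg_iff_add_eq_0 add.commute)
  have "(\<Sum>p\<in>Points F. (e p \<bullet> e q) *\<^sub>R h p) = h q + (\<Sum>p\<in>Points F - {q}. (e p \<bullet> e q) *\<^sub>R h p)"
    using sum.remove[OF finite_points q, of "\<lambda>p. (e p \<bullet> e q) *\<^sub>R h p"] q by (simp add: frame_inner)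
  also have "(\<Sum>p\<in>Points F - {q}. (e p \<bullet> e q) *\<^sub>R h p) = (\<Sum>p\<in>Points F - {q}. (- 1 / 6) *\<^sub>R h p)"
    using q by (intro sum.cong) (auto simp: frame_inner)
  also have "\<dots> = (- 1 / 6) *\<^sub>R (\<Sum>p\<in>Points F - {q}. h p)" by (rule scaleR_sum_right[symmetric])
  also have "\<dots> = (1 / 6) *\<^sub>R h q" unfolding rest by simp
  finally show ?thesis using scaleR_left_distrib[of 1 "1 / 6" "h q"] by simp
qed

lemma linear_eqI:
  fixes r r' :: "real ^ 6 \<Rightarrow> real ^ 6"
  assumes "linear r" "linear r'" "\<And>p. p \<in> Points F \<Longrightarrow> r (e p) = r' (e p)"
  shows "r = r'"
proof
  fix v
  have "v \<in> span (e ` Points F)" using frame_span by simp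
  then show "r v = r' v" by (rule linear_eq_on_span[OF assms(1,2), rotated]) (use assms(3) in auto)
qed

lemma linear_frame_sum: "linear (\<lambda>v. (\<Sum>p\<in>Points F. (e p \<bullet> v) *\<^sub>R h p))"
  for h :: "'p \<Rightarrow> real ^ 6"
  by (intro linearI)
    (simp_all add: inner_right_distrib scaleR_left_distrib sum.distrib scaleR_sum_right)

text \<open>The frame constant 7/6 is the number of unit vectors divided by the dimension.\<close>

lemma tight_frame: "(\<Sum>p\<in>Points F. (e p \<bullet> v) *\<^sub>R e p) = (7 / 6) *\<^sub>R v"
proof -
  have "(\<lambda>v. \<Sum>p\<in>Points F. (e p \<bullet> v) *\<^sub>R e p) = (\<lambda>v. (7 / 6) *\<^sub>R v)"
    by (rule linear_eqI[OF linear_frame_sum linear_scale_self])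
      (rule weighted_frame_sum[OF _ frame_sum])
  then show ?thesis by (rule fun_cong)
qed

text \<open>Expanding the coordinate vectors in the tight frame replaces the trace over a basis by a
  sum over the seven points.\<close>

lemma trace_frame:
  fixes r :: "real ^ 6 \<Rightarrow> real ^ 6"
  assumes r: "linear r"
  shows "trace (matrix r) = (6 / 7) * (\<Sum>p\<in>Points F. e p \<bullet> r (e p))"
proof -
  have component: "r (axis i 1) $ i = (6 / 7) * (\<Sum>p\<in>Points F. e p $ i * r (e p) $ i)" for i
  proof -
    have "axis i 1 = (6 / 7) *\<^sub>R (\<Sum>p\<in>Points F. (e p \<bullet> axis i 1) *\<^sub>R e p)"
      unfolding tight_frame by simp
    then have "r (axis i 1) = r ((6 / 7) *\<^sub>R (\<Sum>p\<in>Points F. (e p \<bullet> axis i 1) *\<^sub>R e p))"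
      by (rule arg_cong)
    also have "\<dots> = (6 / 7) *\<^sub>R (\<Sum>p\<in>Points F. (e p \<bullet> axis i 1) *\<^sub>R r (e p))"
      by (simp only: linear_scale[OF r] linear_sum[OF r])
    finally show ?thesis by (simp add: inner_axis)
  qed
  have "trace (matrix r) = (\<Sum>i\<in>UNIV. r (axis i 1) $ i)"
    by (simp add: trace_def matrix_def)
  also have "\<dots> = (\<Sum>i\<in>UNIV. (6 / 7) * (\<Sum>p\<in>Points F. e p $ i * r (e p) $ i))"
    by (intro sum.cong refl component)
  also have "\<dots> = (6 / 7) * (\<Sum>p\<in>Points F. \<Sum>i\<in>UNIV. e p $ i * r (e p) $ i)"
    unfolding sum_distrib_left[symmetric] by (subst sum.swap) rule
  finally show ?thesis by (simp add: inner_vec_def)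
qed

section \<open>Line vectors and the linear action\<close>

abbreviation vec :: "'p + 'l \<Rightarrow> real ^ 6" where
  "vec \<equiv> elem_vec F e"

lemma points_on_subset: "points_on F l \<subseteq> Points F" and lines_on_subset: "lines_on F p \<subseteq> Lines F"
  using generalised_polygonD(1)[OF plane] unfolding point_line_geometry_def points_on_def lines_on_def by auto

lemma card_on: "l \<in> Lines F \<Longrightarrow> card (points_on F l) = 3" "p \<in> Points F \<Longrightarrow> card (lines_on F p) = 3"
  using fano unfolding fano_plane_def by auto

text \<open>The points off the line sum to minus the sum over its points, so the weights combine to
  4 + 3 = 7 and the factor 7 cancels.\<close>

lemma line_vec: "vec (Inr l) = (1 / sqrt 2) *\<^sub>R (\<Sum>p\<in>points_on F l. e p)"
proof -
  let ?S = "\<Sum>p\<in>points_on F l. e p"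
  have "(\<Sum>p\<in>Points F - points_on F l. e p) = - ?S"
    using sum_diff[OF finite_points points_on_subset, of e l] frame_sum by simp
  then have "vec (Inr l) = (1 / (7 * sqrt 2)) *\<^sub>R (4 *\<^sub>R ?S + 3 *\<^sub>R ?S)" by simp
  also have "4 *\<^sub>R ?S + 3 *\<^sub>R ?S = 7 *\<^sub>R ?S" by (simp add: scaleR_left_distrib[symmetric])
  finally show ?thesis by simp
qed

lemma sum_lines_vec: "(\<Sum>l\<in>Lines F. vec (Inr l)) = 0"
proof -
  have "(\<Sum>l\<in>Lines F. \<Sum>p\<in>points_on F l. e p) = (\<Sum>l\<in>Lines F. \<Sum>p\<in>{p \<in> Points F. (p, l) \<in> Inc F}. e p)"
    using points_on_subset by (intro sum.cong) (auto simp: points_on_def)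
  also have "\<dots> = (\<Sum>p\<in>Points F. \<Sum>l\<in>{l \<in> Lines F. (p, l) \<in> Inc F}. e p)"
    by (rule sum.swap_restrict[OF finite_lines finite_points])
  also have "\<dots> = (\<Sum>p\<in>Points F. 3 *\<^sub>R e p)"
  proof (rule sum.cong[OF refl])
    fix p assume p: "p \<in> Points F"
    have "{l \<in> Lines F. (p, l) \<in> Inc F} = lines_on F p" using lines_on_subset unfolding lines_on_def by blast
    then show "(\<Sum>l\<in>{l \<in> Lines F. (p, l) \<in> Inc F}. e p) = 3 *\<^sub>R e p"
      using card_on(2)[OF p] by (simp only: sum_constant_scaleR) simp
  qed
  also have "\<dots> = 0" using frame_sum by (simp add: scaleR_sum_right[symmetric])
  finally have "(\<Sum>l\<in>Lines F. \<Sum>p\<in>points_on F l. e p) = 0" .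
  then show ?thesis unfolding line_vec by (simp add: scaleR_sum_right[symmetric])
qed

text \<open>The scaling of the line vectors makes this relation symmetric in points and lines, so that
  dualities act linearly as well.\<close>

lemma sum_neighbours_vec:
  assumes x: "x \<in> V"
  shows "(\<Sum>y\<in>nbrs x. vec y) = sqrt 2 *\<^sub>R vec x"
proof (cases x)
  case (Inr l)
  have "(\<Sum>y\<in>nbrs x. vec y) = (\<Sum>p\<in>points_on F l. e p)"
    unfolding Inr neighbours_line by (subst sum.reindex) (auto simp: inj_on_def)
  then show ?thesis unfolding Inr line_vec by simp
next
  case (Inl p)
  then have p: "p \<in> Points F" using x by simp
  note fl = finite_subset[OF lines_on_subset finite_lines] and fp = finite_subset[OF points_on_subset finite_points]
  \<comment> \<open>The three lines through \<open>p\<close> contain every other point exactly once,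
    so these points contribute \<open>- e p\<close> and \<open>p\<close> itself contributes
    \<open>3 *\<^sub>R e p\<close>.\<close>
  have "(\<Sum>l\<in>lines_on F p. \<Sum>q\<in>points_on F l - {p}. e q) = (\<Sum>q\<in>(\<Union>l\<in>lines_on F p. points_on F l - {p}). e q)"
  proof (rule sum.UNION_disjoint[symmetric])
    show "\<forall>l\<in>lines_on F p. \<forall>m\<in>lines_on F p. l \<noteq> m \<longrightarrow> (points_on F l - {p}) \<inter> (points_on F m - {p}) = {}"
      using unique_join[of "Inl p" "Inr _" "Inl _" "Inr _"] unfolding lines_on_def points_on_def by auto
  qed (use fl fp in auto)
  also have "(\<Union>l\<in>lines_on F p. points_on F l - {p}) = Points F - {p}"
  proof (intro equalityI subsetI)
    fix q assume "q \<in> Points F - {p}"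
    then have q: "q \<in> Points F" "q \<noteq> p" by auto
    obtain z where z: "adj (Inl p) z" "adj (Inl q) z" using join[of "Inl p" "Inl q"] p q by auto
    then obtain l where "(p, l) \<in> Inc F" "(q, l) \<in> Inc F" by (cases z) auto
    then show "q \<in> (\<Union>l\<in>lines_on F p. points_on F l - {p})" using q unfolding lines_on_def points_on_def by auto
  qed (use points_on_subset in auto)
  also have "(\<Sum>q\<in>Points F - {p}. e q) = - e p"
    using frame_sum sum.remove[OF finite_points p, of e] by (simp add: eq_neg_iff_add_eq_0 add.commute)
  finally have rest: "(\<Sum>l\<in>lines_on F p. \<Sum>q\<in>points_on F l - {p}. e q) = - e p" .
  have "(\<Sum>l\<in>lines_on F p. \<Sum>q\<in>points_on F l. e q) = (\<Sum>l\<in>lines_on F p. e p + (\<Sum>q\<in>points_on F l - {p}. e q))"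
    by (intro sum.cong refl sum.remove fp) (simp add: lines_on_def points_on_def)
  also have "\<dots> = 3 *\<^sub>R e p - e p"
    using card_on(2)[OF p] by (simp only: sum.distrib rest sum_constant_scaleR) simp
  also have "\<dots> = 2 *\<^sub>R e p" using scaleR_left_diff_distrib[of 3 1 "e p"] by simp
  finally have two: "(\<Sum>l\<in>lines_on F p. \<Sum>q\<in>points_on F l. e q) = 2 *\<^sub>R e p" .
  have "(\<Sum>y\<in>nbrs x. vec y) = (\<Sum>l\<in>lines_on F p. vec (Inr l))"
    unfolding Inl neighbours_point by (subst sum.reindex) (auto simp: inj_on_def)
  also have "\<dots> = (1 / sqrt 2) *\<^sub>R (2 *\<^sub>R e p)"
    unfolding line_vec two[symmetric] by (rule scaleR_sum_right[symmetric])
  also have "\<dots> = sqrt 2 *\<^sub>R e p" by (simp add: real_div_sqrt)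
  finally show ?thesis unfolding Inl by simp
qed

text \<open>The seven spanning vectors \<open>e p\<close> satisfy one linear relation up to scaling.
  Their images satisfy it too, which is what a linear extension requires.\<close>

lemma sum_image_points:
  assumes aut: "automorphism F \<theta>"
  shows "(\<Sum>p\<in>Points F. vec (\<theta> (Inl p))) = 0"
proof -
  have "inj_on (\<lambda>p. \<theta> (Inl p)) (Points F)"
  proof (rule inj_onI)
    fix p q assume "p \<in> Points F" "q \<in> Points F" "\<theta> (Inl p) = \<theta> (Inl q)"
    then show "p = q" using automorphism_inj[OF aut, of "Inl p" "Inl q"] by simp
  qed
  then have "(\<Sum>p\<in>Points F. vec (\<theta> (Inl p))) = (\<Sum>x\<in>(\<lambda>p. \<theta> (Inl p)) ` Points F. vec x)"
    by (simp add: sum.reindex)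
  also have "(\<lambda>p. \<theta> (Inl p)) ` Points F = \<theta> ` Inl ` Points F" by (simp add: image_image)
  also have "(\<Sum>x\<in>\<theta> ` Inl ` Points F. vec x) = 0"
  proof (cases "preserves_types F \<theta>")
    case True
    then have "\<theta> ` Inl ` Points F = Inl ` Points F" unfolding preserves_types_def by simp
    then show ?thesis using frame_sum by (simp add: sum.reindex)
  next
    case False
    then have "\<theta> ` Inl ` Points F = Inr ` Lines F"
      using aut unfolding automorphism_def interchanges_types_def by blast
    then show ?thesis using sum_lines_vec by (simp add: sum.reindex del: elem_vec.simps)
  qed
  finally show ?thesis .
qed

lemma sum_image_line:
  assumes aut: "automorphism F \<theta>" and l: "l \<in> Lines F"
  shows "(\<Sum>p\<in>points_on F l. vec (\<theta> (Inl p))) = sqrt 2 *\<^sub>R vec (\<theta> (Inr l))"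
proof -
  have lV: "Inr l \<in> V" using l by simp
  have "nbrs (\<theta> (Inr l)) = \<theta> ` nbrs (Inr l)"
  proof safe
    fix z assume z: "adj (\<theta> (Inr l)) z"
    obtain w where "w \<in> V" "\<theta> w = z" by (rule automorphism_surj[OF aut adj_V(2)[OF z]])
    then show "z \<in> \<theta> ` nbrs (Inr l)" using z automorphism_incident[OF aut lV] by auto
  next
    fix w assume w: "adj (Inr l) w"
    then show "adj (\<theta> (Inr l)) (\<theta> w)" using automorphism_incident[OF aut lV adj_V(2)[OF w]] by simp
  qed
  moreover have "inj_on \<theta> (nbrs (Inr l))"
    by (rule inj_onI) (use automorphism_inj[OF aut] adj_V(2) in blast)
  ultimately have "(\<Sum>y\<in>nbrs (Inr l). vec (\<theta> y)) = (\<Sum>z\<in>nbrs (\<theta> (Inr l)). vec z)"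
    by (simp add: sum.reindex)
  also have "\<dots> = sqrt 2 *\<^sub>R vec (\<theta> (Inr l))"
    by (rule sum_neighbours_vec[OF automorphism_elements[OF aut lV]])
  finally show ?thesis unfolding neighbours_line by (simp add: sum.reindex)
qed

lemma lin_action:
  assumes aut: "automorphism F \<theta>"
  shows "linear (lin_action F e \<theta>)"
    and "p \<in> Points F \<Longrightarrow> lin_action F e \<theta> (e p) = vec (\<theta> (Inl p))"
proof -
  let ?Q = "\<lambda>r. linear r \<and> (\<forall>x \<in> elements F. r (vec x) = vec (\<theta> x))"
  \<comment> \<open>The tight frame expansion of \<open>v\<close>, with each \<open>e p\<close>
    replaced by its prescribed image.\<close>
  define r where "r v = (6 / 7) *\<^sub>R (\<Sum>p\<in>Points F. (e p \<bullet> v) *\<^sub>R vec (\<theta> (Inl p)))" for v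
  have lin: "linear r"
    unfolding r_def by (rule linear_compose_scale_right[OF linear_frame_sum])
  have rp: "r (e p) = vec (\<theta> (Inl p))" if "p \<in> Points F" for p
    unfolding r_def weighted_frame_sum[OF that sum_image_points[OF aut]] by simp
  have rl: "r (vec (Inr l)) = vec (\<theta> (Inr l))" if l: "l \<in> Lines F" for l
  proof -
    have "r (vec (Inr l)) = (1 / sqrt 2) *\<^sub>R (\<Sum>p\<in>points_on F l. r (e p))"
      unfolding line_vec by (simp add: linear_scale[OF lin] linear_sum[OF lin])
    also have "(\<Sum>p\<in>points_on F l. r (e p)) = (\<Sum>p\<in>points_on F l. vec (\<theta> (Inl p)))"
      using points_on_subset rp by (intro sum.cong) auto
    finally show ?thesis unfolding sum_image_line[OF aut l] by simp
  qed
  have Q: "?Q r" using lin rp rl unfolding elements_def by auto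
  have unique: "r' = r" if "?Q r'" for r'
  proof (rule linear_eqI)
    fix p assume "p \<in> Points F"
    then have "Inl p \<in> elements F" by simp
    then have "r' (vec (Inl p)) = r (vec (Inl p))" using that Q by metis
    then show "r' (e p) = r (e p)" by simp
  qed (use that Q in auto)
  have "lin_action F e \<theta> = r" unfolding lin_action_def by (rule the_equality[where P = ?Q, OF Q unique])
  then show "linear (lin_action F e \<theta>)" "p \<in> Points F \<Longrightarrow> lin_action F e \<theta> (e p) = vec (\<theta> (Inl p))"
    using lin rp by auto
qed

section \<open>Character values\<close>

lemma chi4_sum:
  assumes aut: "automorphism F \<theta>"
  shows "chi4 F e \<theta> = (6 / 7) * (\<Sum>p\<in>Points F. e p \<bullet> vec (\<theta> (Inl p)))"
  unfolding chi4_def trace_frame[OF lin_action(1)[OF aut]] using lin_action(2)[OF aut] by simp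

lemma sum_two_values:
  assumes "A \<subseteq> Points F" "\<And>p. p \<in> Points F \<Longrightarrow> h p = (if p \<in> A then u else v :: real)"
  shows "(\<Sum>p\<in>Points F. h p) = real (card A) * u + (7 - real (card A)) * v"
proof -
  have fin: "finite A" by (rule finite_subset[OF assms(1) finite_points])
  have "(\<Sum>p\<in>Points F. h p) = (\<Sum>p\<in>A. h p) + (\<Sum>p\<in>Points F - A. h p)"
    using sum.subset_diff[OF assms(1) finite_points, of h] by simp
  also have "(\<Sum>p\<in>A. h p) = (\<Sum>p\<in>A. u)" using assms by (intro sum.cong) auto
  also have "(\<Sum>p\<in>Points F - A. h p) = (\<Sum>p\<in>Points F - A. v)" using assms by (intro sum.cong) auto
  moreover have "card A \<le> 7" using card_mono[OF finite_points assms(1)] card_points by simp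
  ultimately show ?thesis by (simp add: card_Diff_subset[OF fin assms(1)] card_points)
qed

text \<open>On collineations this is the permutation character on the points minus the trivial
  character.\<close>

lemma chi4_collineation:
  assumes aut: "automorphism F \<theta>" "preserves_types F \<theta>"
  shows "chi4 F e \<theta> = real (card {p \<in> Points F. \<theta> (Inl p) = Inl p}) - 1"
proof -
  let ?A = "{p \<in> Points F. \<theta> (Inl p) = Inl p}"
  have "e p \<bullet> vec (\<theta> (Inl p)) = (if p \<in> ?A then 1 else - 1 / 6)" if p: "p \<in> Points F" for p
  proof -
    have "isl (\<theta> (Inl p))" "\<theta> (Inl p) \<in> elements F"
      using preserves_types_isl[OF aut(2), of "Inl p"] automorphism_elements[OF aut(1), of "Inl p"] p by auto
    then obtain q where "\<theta> (Inl p) = Inl q" "q \<in> Points F" by (cases "\<theta> (Inl p)") auto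
    then show ?thesis using p by (simp add: frame_inner)
  qed
  then have "(\<Sum>p\<in>Points F. e p \<bullet> vec (\<theta> (Inl p))) =
      real (card ?A) * 1 + (7 - real (card ?A)) * (- 1 / 6)"
    by (intro sum_two_values) auto
  then show ?thesis unfolding chi4_sum[OF aut(1)] by (simp add: field_simps)
qed

text \<open>A point on the line contributes \<open>(1 - 2 / 6) / sqrt 2\<close>, a point off it
  \<open>(- 3 / 6) / sqrt 2\<close>.\<close>

lemma chi4_duality:
  assumes dual: "duality F \<theta>"
  shows "chi4 F e \<theta> = (real (card {p \<in> Points F. adj (Inl p) (\<theta> (Inl p))}) - 3) / sqrt 2"
proof -
  interpret plane_duality F \<theta> using dual by unfold_locales
  let ?A = "{p \<in> Points F. adj (Inl p) (\<theta> (Inl p))}"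
  have "e p \<bullet> vec (\<theta> (Inl p)) = (if p \<in> ?A then (2 / 3) / sqrt 2 else (- 1 / 2) / sqrt 2)"
    if p: "p \<in> Points F" for p
  proof -
    have "\<not> isl (\<theta> (Inl p))" "\<theta> (Inl p) \<in> elements F"
      using theta_isl[of "Inl p"] theta_V[of "Inl p"] p by auto
    then obtain l where l: "\<theta> (Inl p) = Inr l" "l \<in> Lines F" by (cases "\<theta> (Inl p)") auto
    have fin: "finite (points_on F l)" by (rule finite_subset[OF points_on_subset finite_points])
    have "e p \<bullet> vec (Inr l) = (\<Sum>q\<in>points_on F l. e p \<bullet> e q) / sqrt 2"
      unfolding line_vec by (simp add: inner_sum_right)
    also have "(\<Sum>q\<in>points_on F l. e p \<bullet> e q) = (\<Sum>q\<in>points_on F l. if p = q then 1 else - 1 / 6)"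
      using subsetD[OF points_on_subset[of l]] p by (intro sum.cong refl frame_inner)
    also have "\<dots> = (if p \<in> points_on F l then 2 / 3 else - 1 / 2)"
    proof (cases "p \<in> points_on F l")
      case True
      have "(\<Sum>q\<in>points_on F l - {p}. if p = q then 1 else - 1 / 6 :: real) = (\<Sum>q\<in>points_on F l - {p}. - 1 / 6)"
        by (intro sum.cong) auto
      then show ?thesis
        using True card_on(1)[OF l(2)] fin
        by (subst sum.remove[OF fin True]) simp
    next
      case False
      then have "(\<Sum>q\<in>points_on F l. if p = q then 1 else - 1 / 6 :: real) = (\<Sum>q\<in>points_on F l. - 1 / 6)"
        by (intro sum.cong) auto
      then show ?thesis using False card_on(1)[OF l(2)] by simp
    qed
    finally show ?thesis using p l unfolding points_on_def by simp
  qed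
  then have "(\<Sum>p\<in>Points F. e p \<bullet> vec (\<theta> (Inl p))) =
      real (card ?A) * ((2 / 3) / sqrt 2) + (7 - real (card ?A)) * ((- 1 / 2) / sqrt 2)"
    by (intro sum_two_values) auto
  then show ?thesis unfolding chi4_sum[OF aut] by (simp add: field_simps)
qed

lemma chi4_sqrt2_iff:
  assumes aut: "automorphism F \<theta>"
  shows "chi4 F e \<theta> = sqrt 2 \<longleftrightarrow>
    duality F \<theta> \<and> card {p \<in> Points F. adj (Inl p) (\<theta> (Inl p))} = 5"
proof (cases "preserves_types F \<theta>")
  case True
  let ?c = "card {p \<in> Points F. \<theta> (Inl p) = Inl p}"
  have "chi4 F e \<theta> \<noteq> sqrt 2"
  proof
    assume "chi4 F e \<theta> = sqrt 2"
    \<comment> \<open>The subtraction takes place in \<open>int\<close> because there may be no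
      fixed point.\<close>
    then have c: "real_of_int (int ?c - 1) = sqrt 2" using chi4_collineation[OF aut True] by simp
    have "real_of_int ((int ?c - 1)\<^sup>2) = (real_of_int (int ?c - 1))\<^sup>2" by (rule of_int_power)
    also have "\<dots> = real_of_int 2" unfolding c by simp
    finally have "(int ?c - 1)\<^sup>2 = 2" by (simp only: of_int_eq_iff)
    then show False using square_int_ne_2 by blast
  qed
  moreover have "\<not> duality F \<theta>"
  proof
    assume "duality F \<theta>"
    then have inter: "interchanges_types F \<theta>" unfolding duality_def by simp
    obtain x where "x \<in> elements F" using generalised_polygonD(3)[OF plane] by blast
    then show False using preserves_types_isl[OF True] interchanges_types_isl[OF inter] by blast
  qed
  ultimately show ?thesis by blast
next
  case False
  then have dual: "duality F \<theta>" using aut unfolding duality_def automorphism_def by blast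
  let ?a = "card {p \<in> Points F. adj (Inl p) (\<theta> (Inl p))}"
  have "(real ?a - 3) / sqrt 2 = sqrt 2 \<longleftrightarrow> real ?a - 3 = 2"
    by (simp add: divide_eq_eq)
  also have "\<dots> \<longleftrightarrow> ?a = 5" by linarith
  finally show ?thesis using dual chi4_duality[OF dual] by simp
qed

end

section \<open>Domestic automorphisms of the Fano plane\<close>

lemma fano_domestic_canonical:
  assumes fano: "fano_plane F" and dual: "duality F \<theta>" "domestic 3 F \<theta>"
  shows "\<exists>f g. canonical_duality F f g \<theta>"
proof -
  interpret thick_plane F by (rule fano_thick_plane[OF fano])
  interpret domestic_duality F \<theta> using dual by unfold_locales
  show ?thesis by (rule canonical_duality_exists)
qed

text \<open>Both inclusions pass through the canonical form. A conjugate of \<open>\<theta>\<close>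
  is again a domestic duality, so its table gives order 8 and five absolute points. Conversely the
  value \<open>sqrt 2\<close> gives a duality with five absolute points, which is domestic, has the
  table, and is therefore conjugate to \<open>\<theta>\<close>.\<close>

lemma fano_conj_class_8A:
  assumes fano: "fano_plane F" and frame: "fano_frame F e"
    and \<theta>: "canonical_duality F f g \<theta>" "\<theta> \<in> carrier (aut_group F)"
  shows "conj_class (aut_group F) \<theta> = class_8A F e"
proof
  interpret framed_fano_plane F e using fano frame by unfold_locales
  have aut: "automorphism F \<theta>" using \<theta>(2) unfolding aut_group_carrier by simp
  show "conj_class (aut_group F) \<theta> \<subseteq> class_8A F e"
  proof
    fix \<phi> assume "\<phi> \<in> conj_class (aut_group F) \<theta>"
    then have \<phi>: "\<phi> \<in> carrier (aut_group F)" "duality F \<phi>" "domestic 3 F \<phi>"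
      using conjugate_domestic_duality[OF fano \<theta>(2) canonical_duality_is_duality[OF \<theta>(1) aut]
          canonical_duality_domestic[OF fano \<theta>(1) aut]] by blast+
    obtain f' g' where can: "canonical_duality F f' g' \<phi>"
      using fano_domestic_canonical[OF fano \<phi>(2,3)] by blast
    have "chi4 F e \<phi> = sqrt 2"
      using chi4_sqrt2_iff[of \<phi>] canonical_duality_absolute_points[OF can] \<phi>(2)
      unfolding duality_def by blast
    then show "\<phi> \<in> class_8A F e"
      using \<phi>(1) canonical_duality_ord[OF can \<phi>(1)] unfolding class_8A_def by blast
  qed
  show "class_8A F e \<subseteq> conj_class (aut_group F) \<theta>"
  proof
    fix \<phi> assume "\<phi> \<in> class_8A F e"
    then have \<phi>: "\<phi> \<in> carrier (aut_group F)" "chi4 F e \<phi> = sqrt 2" unfolding class_8A_def by auto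
    have "automorphism F \<phi>" using \<phi>(1) unfolding aut_group_carrier by simp
    then have "duality F \<phi>" "domestic 3 F \<phi>"
      using chi4_sqrt2_iff[of \<phi>] \<phi>(2) five_absolute_points_domestic[OF fano, of \<phi>] by blast+
    then obtain f' g' where "canonical_duality F f' g' \<phi>"
      using fano_domestic_canonical[OF fano] by blast
    then show "\<phi> \<in> conj_class (aut_group F) \<theta>"
      using canonical_duality_conjugate[OF \<theta>] \<phi>(1) by blast
  qed
qed

lemma fano_domestic:
  assumes fano: "fano_plane F"
  shows "\<exists>\<theta> \<in> carrier (aut_group F).
           nontrivial F \<theta> \<and> domestic 3 F \<theta> \<and>
           (\<forall>\<phi> \<in> carrier (aut_group F). nontrivial F \<phi> \<and> domestic 3 F \<phi> \<longrightarrow>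
              \<phi> \<in> conj_class (aut_group F) \<theta>) \<and>
           exceptional_domestic 3 F \<theta> \<and> duality F \<theta> \<and>
           group.ord (aut_group F) \<theta> = 8 \<and>
           (\<forall>e. fano_frame F e \<longrightarrow> conj_class (aut_group F) \<theta> = class_8A F e)"
proof -
  interpret thick_plane F by (rule fano_thick_plane[OF fano])
  obtain f g where "fano_labelling F f g" by (rule fano_labelling_exists[OF fano])
  then obtain \<theta> where \<theta>: "\<theta> \<in> carrier (aut_group F)" "canonical_duality F f g \<theta>"
    using canonical_duality_realised by blast
  have aut: "automorphism F \<theta>" using \<theta>(1) unfolding aut_group_carrier by simp
  have odd: "exceptional_domestic 3 F \<phi>" "duality F \<phi>"
    if "automorphism F \<phi>" "nontrivial F \<phi>" "domestic 3 F \<phi>" for \<phi>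
    using domestic_automorphism_odd[of 1 F \<phi>] plane thick that by auto
  have dual: "duality F \<theta>" by (rule canonical_duality_is_duality[OF \<theta>(2) aut])
  have dom: "domestic 3 F \<theta>" by (rule canonical_duality_domestic[OF fano \<theta>(2) aut])
  obtain x where x: "x \<in> elements F" using generalised_polygonD(3)[OF plane] by blast
  have "isl (\<theta> x) \<longleftrightarrow> \<not> isl x"
    using dual x interchanges_types_isl unfolding duality_def by blast
  then have non: "nontrivial F \<theta>" using x unfolding nontrivial_def by metis
  have "\<phi> \<in> conj_class (aut_group F) \<theta>"
    if \<phi>: "\<phi> \<in> carrier (aut_group F)" "nontrivial F \<phi>" "domestic 3 F \<phi>" for \<phi>
  proof -
    have "automorphism F \<phi>" using \<phi>(1) unfolding aut_group_carrier by simp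
    then have "duality F \<phi>" using odd \<phi>(2,3) by blast
    then obtain f' g' where "canonical_duality F f' g' \<phi>"
      using fano_domestic_canonical[OF fano _ \<phi>(3)] by blast
    then show ?thesis using canonical_duality_conjugate[OF \<theta>(2,1)] \<phi>(1) by blast
  qed
  moreover have "group.ord (aut_group F) \<theta> = 8" by (rule canonical_duality_ord[OF \<theta>(2,1)])
  moreover have "conj_class (aut_group F) \<theta> = class_8A F e" if "fano_frame F e" for e
    by (rule fano_conj_class_8A[OF fano that \<theta>(2,1)])
  ultimately show ?thesis using \<theta>(1) non dom dual odd(1)[OF aut non dom] by blast
qed

theorem theorem2p6:
  fixes \<Gamma> :: "('p, 'l) geometry" and F :: "('r, 's) geometry"
  shows
    "(\<forall>n \<theta>. n \<ge> 1 \<and> generalised_polygon (2 * n + 1) \<Gamma> \<and> thick \<Gamma> \<and>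
        automorphism \<Gamma> \<theta> \<and> nontrivial \<Gamma> \<theta> \<and> domestic (2 * n + 1) \<Gamma> \<theta> \<longrightarrow>
        exceptional_domestic (2 * n + 1) \<Gamma> \<theta> \<and> duality \<Gamma> \<theta>) \<and>
     (fano_plane F \<longrightarrow> projective_plane \<Gamma> \<and> thick \<Gamma> \<and> \<not> isomorphic_geometries \<Gamma> F \<longrightarrow>
        \<not> (\<exists>\<theta>. automorphism \<Gamma> \<theta> \<and> nontrivial \<Gamma> \<theta> \<and> domestic 3 \<Gamma> \<theta>)) \<and>
     (fano_plane F \<longrightarrow>
        (\<exists>\<theta> \<in> carrier (aut_group F).
           nontrivial F \<theta> \<and> domestic 3 F \<theta> \<and>
           (\<forall>\<phi> \<in> carrier (aut_group F). nontrivial F \<phi> \<and> domestic 3 F \<phi> \<longrightarrow>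
              \<phi> \<in> conj_class (aut_group F) \<theta>) \<and>
           exceptional_domestic 3 F \<theta> \<and> duality F \<theta> \<and>
           group.ord (aut_group F) \<theta> = 8 \<and>
           (\<forall>e. fano_frame F e \<longrightarrow> conj_class (aut_group F) \<theta> = class_8A F e)))"
  using domestic_automorphism_odd[of _ \<Gamma>] domestic_plane_fano[of \<Gamma>] fano_unique[of \<Gamma> F] fano_domestic[of F]
  by blast

end
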